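(* Fix $k\in\mathbb N$ and let $J^{(1)},\dots,J^{(k)}$ be infinite pairwise disjoint subsets of $\mathbb Z$ satisfying the following condition: for all $t\in\mathbb Z$ and $p_1,\dots,p_k,q_1,\dots,q_k\in\mathbb Z^+$ there exists $n\in\mathbb N$ such that if $$\sum_{i=1}^k\sum_{r=1}^{p_i}j^{(i)}_r=t+\sum_{i=1}^k\sum_{s=1}^{q_i}l^{(i)}_s$$ for some $j^{(i)}_r,l^{(i)}_s\in J^{(i)}$ such that the $j^{(i)}_r$ have distinct absolute values, the $l^{(i)}_s$ have distinct absolute values, and $|j^{(i)}_r|,|l^{(i)}_s|>n$, then $t=0$ and $p_i=q_i$ for $i=1,\dots,k$. Let $\mathcal T_k$ have the topology given by the neighbourhoods $\mathcal V_{\gamma,n}$ ($n\in\mathbb N$) of $\gamma\in\mathcal T_k$, and let $\mathcal S_k=\mathcal T_k\cup\{\infty\}$ have the one-point compactification topology. Let $a_1,\dots,a_k\in\ell_1(\mathbb Z)$ be power bounded in $\ell_1(\mathbb Z)$ (i.e. $\sup_m\|a_i^m\|_1<\infty$) and satisfy $\|a_i^m\|_\infty\to0$ as $m\to\infty$ for each $i=1,\dots,k$. Define a bounded projection $\Theta:\ell_1(\mathcal S_k)\to\ell_1(\mathbb Z)$ which is also an algebra homomorphism by $\Theta(\delta_{e_i})=a_i$ ($i=1,\dots,k$). Then $\ker\Theta$ is weak$^*$-closed in $\ell_1(\mathcal S_k)$ (with respect to $C(\mathcal S_k)$) and $F={}^\perp\ker\Theta\subset C(\mathcal S_k)$ restricts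 to $\mathbb Z$ to define a shift-invariant predual $E$ of $\ell_1(\mathbb Z)$. The resulting weak$^*$-topology on $\ell_1(\mathbb Z)$ is such that $\delta_n\to a_i$ as $|n|\to\infty$ through $J^{(i)}$, for each $i$.
   Context: Scalars are complex, $\mathbb Z^+=\{0,1,2,\dots\}$, and powers $a^m$ in $\ell_1(\mathbb Z)$ are convolution powers. A closed subspace $E\subseteq\ell_\infty(\mathbb Z)$ is a concrete predual of $\ell_1(\mathbb Z)$ if $\iota_E:\ell_1(\mathbb Z)\to E^*$, $\iota_E(a)(x)=\sum_n x(n)a(n)$, is an isomorphism of Banach spaces (not assumed isometric); it is a shift-invariant predual if moreover $\sigma(E)=E$, where $\sigma(x)(n)=x(n-1)$. The associated weak$^*$-topology on $\ell_1(\mathbb Z)$ is the coarsest making $a\mapsto\sum_n x(n)a(n)$ continuous for all $x\in E$. $\mathcal T_k=\mathbb Z\times(\mathbb Z^+)^k$ is the additive semigroup with elements $\gamma=(\gamma_0,\gamma_1,\dots,\gamma_k)$; $\mathcal S_k=\mathcal T_k\cup\{\infty\}$ with $\infty+\gamma=\gamma+\infty=\infty$ for all $\gamma\in\mathcal S_k$. $e_i$ ($1\le i\le k$) has $1$ in the $i$-th coordinate and $0$ elsewhere (coordinates numbered from $0$). $\mathbb Z$ is embedded in $\mathcal S_k$ by $n\mapsto(n,0,\dots,0)$, and $\ell_1(\mathbb Z)$ is regarded as a subalgebra of the convolution algebra $\ell_1(\mathcal S_k)$, which is also identified with $C(\mathcal S_k)^*$. A projection $\Theta:\ell_1(\mathcal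 S_k)\to\ell_1(\mathbb Z)$ is a linear map with $\Theta(a)=a$ for $a\in\ell_1(\mathbb Z)$; the bounded projection which is an algebra homomorphism with $\Theta(\delta_{e_i})=a_i$ is uniquely determined, with $\Theta(\delta_\infty)=0$ and $\Theta(\delta_\gamma)=\delta_{\gamma_0}a_1^{\gamma_1}\cdots a_k^{\gamma_k}$. ${}^\perp\ker\Theta=\{f\in C(\mathcal S_k):\langle\mu,f\rangle=0\ \forall\mu\in\ker\Theta\}$. For $\gamma\in\mathcal T_k$ and $n\in\mathbb N$, $\mathcal V_{\gamma,n}$ is the set of $\beta=(\beta_0,\dots,\beta_k)\in\mathcal T_k$ with $\beta_i\le\gamma_i$ for $i=1,\dots,k$ and $$\beta_0=\gamma_0+\sum_{i=1}^k\sum_{r=1}^{\gamma_i-\beta_i}j^{(i)}_r$$ for some family $(j^{(i)}_r)$ with $j^{(i)}_r\in J^{(i)}$ for all $r$, with $|j^{(i)}_r|\ne|j^{(i')}_s|$ whenever $(i,r)\ne(i',s)$, and with $n<|j^{(i)}_1|<\cdots<|j^{(i)}_{\gamma_i-\beta_i}|$ for each $i$ (empty sums are $0$). The sets $\mathcal V_{\gamma,n}$, $n\in\mathbb N$, form a neighbourhood basis at $\gamma$ for the topology on $\mathcal T_k$. *)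

theory Defs
  imports "HOL-Analysis.Analysis"
begin

text \<open>The sequence spaces are sets of complex functions on an index type. Since
  \<^theory>\<open>HOL-Analysis.Infinite_Set_Sum\<close> redeclares absolute summability, it is written out through
  \<^const>\<open>summable_on\<close>.\<close>

definition l1 :: "('a \<Rightarrow> complex) set" where
  "l1 = {a. (\<lambda>s. norm (a s)) summable_on UNIV}"

definition l1_norm :: "('a \<Rightarrow> complex) \<Rightarrow> real" where
  "l1_norm a = (\<Sum>\<^sub>\<infinity>s. norm (a s))"

definition linf :: "('a \<Rightarrow> complex) set" where
  "linf = {x. bounded (range x)}"

text \<open>Only meaningful on \<^term>\<open>linf\<close>.\<close>

definition linf_norm :: "('a \<Rightarrow> complex) \<Rightarrow> real" where
  "linf_norm x = (SUP s. norm (x s))"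

definition delta :: "'a \<Rightarrow> 'a \<Rightarrow> complex" where
  "delta s = (\<lambda>t. if t = s then 1 else 0)"

definition pairing :: "('a \<Rightarrow> complex) \<Rightarrow> ('a \<Rightarrow> complex) \<Rightarrow> complex" where
  "pairing x a = (\<Sum>\<^sub>\<infinity>s. x s * a s)"

text \<open>Convolution over a semigroup operation \<open>p\<close>.\<close>

definition conv :: "('a \<Rightarrow> 'a \<Rightarrow> 'a) \<Rightarrow> ('a \<Rightarrow> complex) \<Rightarrow> ('a \<Rightarrow> complex) \<Rightarrow> 'a \<Rightarrow> complex" where
  "conv p a b = (\<lambda>s. \<Sum>\<^sub>\<infinity>(t, u) \<in> {(t, u). p t u = s}. a t * b u)"

definition conv_pow :: "(int \<Rightarrow> complex) \<Rightarrow> nat \<Rightarrow> int \<Rightarrow> complex" where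
  "conv_pow a m = (conv (+) a ^^ m) (delta 0)"

definition power_bounded :: "(int \<Rightarrow> complex) \<Rightarrow> bool" where
  "power_bounded a \<longleftrightarrow> bdd_above (range (\<lambda>m. l1_norm (conv_pow a m)))"

text \<open>The coarsest topology on \<^term>\<open>l1\<close> making \<open>a \<mapsto> pairing x a\<close> continuous for every \<open>x \<in> E\<close>.
  The set \<^term>\<open>l1\<close> is added to the subbasis so that it is the whole space even when \<open>E\<close> is empty.\<close>

definition weak_star_topology :: "('a \<Rightarrow> complex) set \<Rightarrow> ('a \<Rightarrow> complex) topology" where
  "weak_star_topology E = topology_generated_by
     (insert l1 {{a \<in> l1. pairing x a \<in> U} |x U. x \<in> E \<and> open U})"


text \<open>The dual of a subspace \<open>E\<close> of \<^term>\<open>linf\<close>. Functionals are represented as functions that are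
  \<^const>\<open>undefined\<close> outside \<open>E\<close>, so that equality of functionals is equality on \<open>E\<close>.\<close>

definition dual_space :: "('a \<Rightarrow> complex) set \<Rightarrow> (('a \<Rightarrow> complex) \<Rightarrow> complex) set" where
  "dual_space E = {\<phi> \<in> extensional E.
     (\<forall>x\<in>E. \<forall>y\<in>E. \<phi> (\<lambda>s. x s + y s) = \<phi> x + \<phi> y) \<and>
     (\<forall>c. \<forall>x\<in>E. \<phi> (\<lambda>s. c * x s) = c * \<phi> x) \<and>
     (\<exists>C. \<forall>x\<in>E. norm (\<phi> x) \<le> C * linf_norm x)}"

definition dual_norm :: "('a \<Rightarrow> complex) set \<Rightarrow> (('a \<Rightarrow> complex) \<Rightarrow> complex) \<Rightarrow> real" where
  "dual_norm E \<phi> = (SUP x\<in>{x \<in> E. linf_norm x \<le> 1}. norm (\<phi> x))"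

definition iota :: "('a \<Rightarrow> complex) set \<Rightarrow> ('a \<Rightarrow> complex) \<Rightarrow> ('a \<Rightarrow> complex) \<Rightarrow> complex" where
  "iota E a = (\<lambda>x\<in>E. pairing x a)"

definition closed_subspace_linf :: "('a \<Rightarrow> complex) set \<Rightarrow> bool" where
  "closed_subspace_linf E \<longleftrightarrow>
     E \<subseteq> linf \<and>
     (\<lambda>_. 0) \<in> E \<and>
     (\<forall>x\<in>E. \<forall>y\<in>E. (\<lambda>s. x s + y s) \<in> E) \<and>
     (\<forall>c. \<forall>x\<in>E. (\<lambda>s. c * x s) \<in> E) \<and>
     (\<forall>X x. (\<forall>m::nat. X m \<in> E) \<and> x \<in> linf \<and>
        (\<lambda>m. linf_norm (\<lambda>s. X m s - x s)) \<longlonglongrightarrow> 0 \<longrightarrow> x \<in> E)"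

text \<open>The last four conjuncts say that \<^term>\<open>iota E\<close> is an isomorphism of Banach spaces, not
  necessarily isometric: a linear bijection onto the dual, bounded with bounded inverse.\<close>

definition concrete_predual :: "(int \<Rightarrow> complex) set \<Rightarrow> bool" where
  "concrete_predual E \<longleftrightarrow>
     closed_subspace_linf E \<and>
     (\<forall>a\<in>l1. \<forall>b\<in>l1. \<forall>c d. iota E (\<lambda>n. c * a n + d * b n) = (\<lambda>x\<in>E. c * iota E a x + d * iota E b x)) \<and>
     bij_betw (iota E) l1 (dual_space E) \<and>
     (\<exists>C. \<forall>a\<in>l1. dual_norm E (iota E a) \<le> C * l1_norm a) \<and>
     (\<exists>C. \<forall>a\<in>l1. l1_norm a \<le> C * dual_norm E (iota E a))"

definition shift :: "(int \<Rightarrow> complex) \<Rightarrow> int \<Rightarrow> complex" where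
  "shift x = (\<lambda>n. x (n - 1))"

definition shift_invariant_predual :: "(int \<Rightarrow> complex) set \<Rightarrow> bool" where
  "shift_invariant_predual E \<longleftrightarrow> concrete_predual E \<and> shift ` E = E"


text \<open>The number \<open>k \<ge> 1\<close> is the cardinality of a finite index type \<open>'k\<close>. An element
  \<open>(\<gamma>\<^sub>0, \<gamma>\<^sub>1, \<dots>, \<gamma>\<^sub>k)\<close> is the pair of \<open>\<gamma>\<^sub>0\<close> and the vector of the other coordinates; in the
  type of \<open>S\<^sub>k\<close> the point at infinity is \<^const>\<open>None\<close>.\<close>

type_synonym 'k T = "int \<times> (nat, 'k) vec"
type_synonym 'k S = "(int \<times> (nat, 'k) vec) option"

definition S_plus :: "('k::finite) S \<Rightarrow> 'k S \<Rightarrow> 'k S" where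
  "S_plus s t = (case (s, t) of (Some \<beta>, Some \<gamma>) \<Rightarrow> Some (\<beta> + \<gamma>) | _ \<Rightarrow> None)"

definition S_int :: "int \<Rightarrow> ('k::finite) S" where
  "S_int n = Some (n, 0)"

definition S_unit :: "'k \<Rightarrow> ('k::finite) S" where
  "S_unit i = Some (0, axis i 1)"

text \<open>The inclusion of \<open>\<ell>\<^sub>1(\<int>)\<close> in \<open>\<ell>\<^sub>1(S\<^sub>k)\<close>: extension by zero.\<close>

definition l1_embed :: "(int \<Rightarrow> complex) \<Rightarrow> ('k::finite) S \<Rightarrow> complex" where
  "l1_embed a = (\<lambda>s. case s of Some \<gamma> \<Rightarrow> (if snd \<gamma> = 0 then a (fst \<gamma>) else 0) | None \<Rightarrow> 0)"

text \<open>The hypothesis on the sets \<open>J\<^sup>(\<^sup>i\<^sup>)\<close>. Families \<open>(j\<^sup>(\<^sup>i\<^sup>)\<^sub>r)\<close> are functions \<open>j i r\<close> of which only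
  the values at \<open>1 \<le> r \<le> p i\<close> matter; absolute values are distinct across all pairs \<open>(i, r)\<close>.\<close>

definition J_condition :: "('k::finite \<Rightarrow> int set) \<Rightarrow> bool" where
  "J_condition J \<longleftrightarrow> (\<forall>(t::int) (p :: 'k \<Rightarrow> nat) (q :: 'k \<Rightarrow> nat). \<exists>n::nat.
     \<forall>(j :: 'k \<Rightarrow> nat \<Rightarrow> int) (l :: 'k \<Rightarrow> nat \<Rightarrow> int).
       (\<forall>i. \<forall>r\<in>{1..p i}. j i r \<in> J i \<and> \<bar>j i r\<bar> > int n) \<and>
       (\<forall>i. \<forall>s\<in>{1..q i}. l i s \<in> J i \<and> \<bar>l i s\<bar> > int n) \<and>
       inj_on (\<lambda>(i, r). \<bar>j i r\<bar>) (SIGMA i:UNIV. {1..p i}) \<and>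
       inj_on (\<lambda>(i, s). \<bar>l i s\<bar>) (SIGMA i:UNIV. {1..q i}) \<and>
       (\<Sum>i\<in>UNIV. \<Sum>r=1..p i. j i r) = t + (\<Sum>i\<in>UNIV. \<Sum>s=1..q i. l i s)
       \<longrightarrow> t = 0 \<and> (\<forall>i. p i = q i))"

definition T_nbhd :: "('k::finite \<Rightarrow> int set) \<Rightarrow> 'k T \<Rightarrow> nat \<Rightarrow> 'k T set" where
  "T_nbhd J \<gamma> n = {\<beta>. (\<forall>i. snd \<beta> $ i \<le> snd \<gamma> $ i) \<and>
     (\<exists>j :: 'k \<Rightarrow> nat \<Rightarrow> int.
        (\<forall>i. \<forall>r\<in>{1..snd \<gamma> $ i - snd \<beta> $ i}. j i r \<in> J i \<and> int n < \<bar>j i r\<bar>) \<and>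
        inj_on (\<lambda>(i, r). \<bar>j i r\<bar>) (SIGMA i:UNIV. {1..snd \<gamma> $ i - snd \<beta> $ i}) \<and>
        (\<forall>i. strict_mono_on {1..snd \<gamma> $ i - snd \<beta> $ i} (\<lambda>r. \<bar>j i r\<bar>)) \<and>
        fst \<beta> = fst \<gamma> + (\<Sum>i\<in>UNIV. \<Sum>r=1..snd \<gamma> $ i - snd \<beta> $ i. j i r))}"

text \<open>The topology in which the sets \<^term>\<open>T_nbhd J \<gamma> n\<close> form a neighbourhood basis at \<open>\<gamma>\<close>.\<close>

definition T_topology :: "('k::finite \<Rightarrow> int set) \<Rightarrow> 'k T topology" where
  "T_topology J = topology (\<lambda>U. \<forall>\<gamma>\<in>U. \<exists>n. T_nbhd J \<gamma> n \<subseteq> U)"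

lemma T_nbhd_antimono: "m \<le> n \<Longrightarrow> T_nbhd J \<gamma> n \<subseteq> T_nbhd J \<gamma> m"
  unfolding T_nbhd_def by fastforce

lemma openin_T_topology:
  "openin (T_topology J) U \<longleftrightarrow> (\<forall>\<gamma>\<in>U. \<exists>n. T_nbhd J \<gamma> n \<subseteq> U)"
proof -
  have "istopology (\<lambda>U. \<forall>\<gamma>\<in>U. \<exists>n. T_nbhd J \<gamma> n \<subseteq> U)"
    unfolding istopology_def
  proof (intro conjI allI impI ballI)
    fix U V \<gamma>
    assume "\<forall>\<gamma>\<in>U. \<exists>n. T_nbhd J \<gamma> n \<subseteq> U" "\<forall>\<gamma>\<in>V. \<exists>n. T_nbhd J \<gamma> n \<subseteq> V" "\<gamma> \<in> U \<inter> V"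
    then obtain m n where "T_nbhd J \<gamma> m \<subseteq> U" "T_nbhd J \<gamma> n \<subseteq> V"
      by blast
    then have "T_nbhd J \<gamma> (max m n) \<subseteq> U \<inter> V"
      using T_nbhd_antimono[of m "max m n" J \<gamma>] T_nbhd_antimono[of n "max m n" J \<gamma>] by auto
    then show "\<exists>n. T_nbhd J \<gamma> n \<subseteq> U \<inter> V" ..
  next
    fix \<K> \<gamma>
    assume "\<forall>K\<in>\<K>. \<forall>\<gamma>\<in>K. \<exists>n. T_nbhd J \<gamma> n \<subseteq> K" "\<gamma> \<in> \<Union>\<K>"
    then show "\<exists>n. T_nbhd J \<gamma> n \<subseteq> \<Union>\<K>"
      by (meson Union_iff Union_upper subset_trans)
  qed
  then show ?thesis
    by (simp add: T_topology_def)
qed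

definition S_topology :: "('k::finite \<Rightarrow> int set) \<Rightarrow> 'k S topology" where
  "S_topology J = Alexandroff_compactification (T_topology J)"

definition C_S :: "('k::finite \<Rightarrow> int set) \<Rightarrow> ('k S \<Rightarrow> complex) set" where
  "C_S J = {f. continuous_map (S_topology J) euclidean f}"

text \<open>Only the values of \<open>\<Theta>\<close> on \<^term>\<open>l1\<close> matter.\<close>

definition bounded_hom_projection ::
    "((('k::finite) S \<Rightarrow> complex) \<Rightarrow> int \<Rightarrow> complex) \<Rightarrow> bool" where
  "bounded_hom_projection \<Theta> \<longleftrightarrow>
     (\<forall>\<mu>\<in>l1. \<Theta> \<mu> \<in> l1) \<and>
     (\<forall>\<mu>\<in>l1. \<forall>\<nu>\<in>l1. \<forall>c d. \<Theta> (\<lambda>s. c * \<mu> s + d * \<nu> s) = (\<lambda>n. c * \<Theta> \<mu> n + d * \<Theta> \<nu> n)) \<and>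
     (\<exists>C. \<forall>\<mu>\<in>l1. l1_norm (\<Theta> \<mu>) \<le> C * l1_norm \<mu>) \<and>
     (\<forall>a\<in>l1. \<Theta> (l1_embed a) = a) \<and>
     (\<forall>\<mu>\<in>l1. \<forall>\<nu>\<in>l1. \<Theta> (conv S_plus \<mu> \<nu>) = conv (+) (\<Theta> \<mu>) (\<Theta> \<nu>))"

definition l1_kernel :: "(('a \<Rightarrow> complex) \<Rightarrow> int \<Rightarrow> complex) \<Rightarrow> ('a \<Rightarrow> complex) set" where
  "l1_kernel \<Theta> = {\<mu> \<in> l1. \<Theta> \<mu> = (\<lambda>_. 0)}"

definition pre_annihilator ::
    "('a \<Rightarrow> complex) set \<Rightarrow> ('a \<Rightarrow> complex) set \<Rightarrow> ('a \<Rightarrow> complex) set" where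
  "pre_annihilator C K = {f \<in> C. \<forall>\<mu>\<in>K. pairing f \<mu> = 0}"

definition restrict_int :: "(('k::finite) S \<Rightarrow> complex) \<Rightarrow> int \<Rightarrow> complex" where
  "restrict_int f = (\<lambda>n. f (S_int n))"

end

theory Submission
  imports Defs
begin

text \<open>The space \<open>S\<^sub>k\<close> is compact, countable and has a base of clopen sets, and translations act continuously
  on it, so \<open>C(S\<^sub>k)\<^sup>* = \<ell>\<^sub>1(S\<^sub>k)\<close> and convolution is separately weak-star continuous. By the Krein-Smulian
  theorem \<open>ker \<Theta>\<close> is weak-star closed once it contains the limits of its bounded nets. If \<open>\<mu>\<close> is such a limit
  of measures \<open>\<kappa>\<close>, write \<open>\<kappa> = \<kappa> - \<Theta> \<kappa>\<close> and split \<open>\<kappa>\<close> into the part on the box \<open>{\<gamma>. \<gamma>\<^sub>i < r for all i \<ge> 1}\<close> and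
  the rest. The first part contributes a combination of elements
  \<open>\<zeta> * (\<delta>\<^sub>p - \<theta> p)\<close> of \<open>ker \<Theta>\<close>, where \<open>\<theta> p = \<Theta> \<delta>\<^sub>p\<close>; for the rest every image under \<open>\<Theta>\<close> has a factor \<open>a\<^sub>i\<^sup>r\<close>, and this persists
  in the limit because multiplication by \<open>a\<^sub>i\<^sup>r\<close> is weak-star continuous. Hence \<open>\<parallel>\<Theta> \<mu>\<parallel>\<^sub>\<infinity>\<close> is at most a constant times
  \<open>max\<^sub>i \<parallel>a\<^sub>i\<^sup>r\<parallel>\<^sub>\<infinity>\<close>, which tends to \<open>0\<close>. Duality then gives \<open>F\<^sup>* = \<ell>\<^sub>1(S\<^sub>k) / ker \<Theta> = \<ell>\<^sub>1(\<int>)\<close>, and the restriction from \<open>F\<close>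
  to \<open>E\<close> is bounded below since \<open>f \<gamma> = \<langle>f, \<theta> \<gamma>\<rangle>\<close> for \<open>f \<in> F\<close>.\<close>

text \<open>The obstacle is that \<open>\<Theta>\<close> need not be weak-star continuous: for
  continuous f the function sending s to the pairing of f with \<open>\<theta> s\<close> is in
  general discontinuous, so the limit of \<open>\<Theta> \<kappa>\<close> cannot be read off from
  the limit of \<open>\<kappa>\<close>. What does behave well is each slice of the semigroup with
  coordinates 1 to k fixed, where that function is an average of translates of f. Truncation at r
  leaves finitely many slices. The tail is then controlled in the sup norm only, which is all that
  the hypothesis on the powers provides; hence the estimate is made coordinate by coordinate, and
  exact vanishing comes from r being arbitrary while \<open>\<mu>\<close> is fixed. Compactness of
  balls is obtained from generalised limits: a functional of norm at most 1 on the bounded functions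
  of the index, composed with the pairings of a bounded net, is a bounded functional on the
  continuous functions and so is given by a measure. The arithmetic condition on the sets J enters
  as the Hausdorff property of the semigroup, and power boundedness as the uniform bound on the
  \<open>\<theta> s\<close> from which \<open>\<Theta>\<close> is built.\<close>

section \<open>Sequence spaces and convolution\<close>

lemma l1I:
  assumes "\<And>A. finite A \<Longrightarrow> (\<Sum>s\<in>A. norm (a s)) \<le> R"
  shows "a \<in> l1" and "l1_norm a \<le> R"
proof -
  have "(\<lambda>s. norm (a s)) summable_on UNIV"
    using assms by (intro nonneg_bdd_above_summable_on bdd_aboveI2[where M=R]) auto
  then show "a \<in> l1"
    by (simp add: l1_def)
  then show "l1_norm a \<le> R"
    unfolding l1_norm_def l1_def using assms by (intro infsum_le_finite_sums) auto
qed

lemma l1_norm_sum_le: "a \<in> l1 \<Longrightarrow> finite A \<Longrightarrow> (\<Sum>s\<in>A. norm (a s)) \<le> l1_norm a"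
  unfolding l1_def l1_norm_def by (intro finite_sum_le_infsum) auto

lemma l1_norm_ge: "a \<in> l1 \<Longrightarrow> norm (a s) \<le> l1_norm a"
  using l1_norm_sum_le[of a "{s}"] by simp

lemma l1_norm_nonneg: "l1_norm a \<ge> 0"
  unfolding l1_norm_def by (intro infsum_nonneg) auto

lemma l1_summable: "a \<in> l1 \<Longrightarrow> (\<lambda>s. norm (a s)) summable_on A"
  unfolding l1_def using summable_on_subset_banach by blast

lemma l1_dominated:
  assumes "b \<in> l1" "\<And>s. norm (a s) \<le> norm (b s)"
  shows "a \<in> l1" "l1_norm a \<le> l1_norm b"
proof -
  have *: "(\<Sum>s\<in>A. norm (a s)) \<le> l1_norm b" if "finite A" for A
    using sum_mono[of A "\<lambda>s. norm (a s)" "\<lambda>s. norm (b s)", OF assms(2)] l1_norm_sum_le[OF assms(1) that] by linarith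
  show "a \<in> l1" "l1_norm a \<le> l1_norm b"
    by (rule l1I[OF *]; assumption)+
qed

lemma l1_cmult:
  assumes "a \<in> l1"
  shows "(\<lambda>s. c * a s) \<in> l1" "l1_norm (\<lambda>s. c * a s) = norm c * l1_norm a"
  using assms summable_on_cmult_right[of "\<lambda>s. norm (a s)" UNIV "norm c"]
    infsum_cmult_right'[of "norm c" "\<lambda>s. norm (a s)" UNIV]
  by (auto simp: l1_def l1_norm_def norm_mult)

lemma l1_add:
  assumes "a \<in> l1" "b \<in> l1"
  shows "(\<lambda>s. a s + b s) \<in> l1" "l1_norm (\<lambda>s. a s + b s) \<le> l1_norm a + l1_norm b"
proof -
  have *: "(\<Sum>s\<in>A. norm (a s + b s)) \<le> l1_norm a + l1_norm b" if "finite A" for A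
  proof -
    have "(\<Sum>s\<in>A. norm (a s + b s)) \<le> (\<Sum>s\<in>A. norm (a s)) + (\<Sum>s\<in>A. norm (b s))"
      by (simp add: norm_triangle_ineq sum_mono flip: sum.distrib)
    then show ?thesis
      using l1_norm_sum_le[OF assms(1) that] l1_norm_sum_le[OF assms(2) that] by linarith
  qed
  show "(\<lambda>s. a s + b s) \<in> l1" "l1_norm (\<lambda>s. a s + b s) \<le> l1_norm a + l1_norm b"
    by (rule l1I[OF *]; assumption)+
qed

lemma l1_lincomb: "a \<in> l1 \<Longrightarrow> b \<in> l1 \<Longrightarrow> (\<lambda>s. c * a s + d * b s) \<in> l1"
  by (intro l1_add l1_cmult)

lemma l1_diff: "a \<in> l1 \<Longrightarrow> b \<in> l1 \<Longrightarrow> (\<lambda>s. a s - b s) \<in> l1"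
  using l1_lincomb[of a b 1 "-1"] by simp

lemma l1_zero: "(\<lambda>_. 0) \<in> l1" "l1_norm (\<lambda>_. 0) = 0"
  by (simp_all add: l1_def l1_norm_def)

lemma l1_sum: "finite I \<Longrightarrow> (\<And>i. i \<in> I \<Longrightarrow> a i \<in> l1) \<Longrightarrow> (\<lambda>s. \<Sum>i\<in>I. a i s) \<in> l1"
  by (induction I rule: finite_induct) (auto simp: l1_zero l1_add(1))

lemma l1_tail:
  assumes "a \<in> l1" "e > 0"
  obtains A where "finite A" "l1_norm (\<lambda>s. if s \<in> A then 0 else a s) \<le> e"
proof -
  have "\<exists>A. finite A \<and> A \<subseteq> UNIV \<and> dist (\<Sum>s\<in>A. norm (a s)) (\<Sum>\<^sub>\<infinity>s. norm (a s)) \<le> e"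
    using infsum_finite_approximation[of "\<lambda>s. norm (a s)" UNIV e] assms by (simp add: l1_def)
  then obtain A where A: "finite A" "dist (\<Sum>s\<in>A. norm (a s)) (l1_norm a) \<le> e"
    by (auto simp: l1_norm_def)
  have "(\<Sum>s\<in>B. norm (if s \<in> A then 0 else a s)) \<le> e" if "finite B" for B
  proof -
    have "(\<Sum>s\<in>B. norm (if s \<in> A then 0 else a s)) = (\<Sum>s\<in>B - A. norm (a s))"
      by (rule sum.mono_neutral_cong_right) (use that in auto)
    also have "\<dots> = (\<Sum>s\<in>A \<union> (B - A). norm (a s)) - (\<Sum>s\<in>A. norm (a s))"
      using A that by (subst sum.union_disjoint) auto
    also have "\<dots> \<le> e"
      using l1_norm_sum_le[OF assms(1), of "A \<union> (B - A)"] A that by (auto simp: dist_real_def)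
    finally show ?thesis .
  qed
  then show ?thesis
    by (intro that[OF A(1)] l1I(2))
qed

section \<open>Bounded functions and their pairing with \<open>l1\<close>\<close>

lemma linfI: "(\<And>s. norm (x s) \<le> B) \<Longrightarrow> x \<in> linf"
  unfolding linf_def bounded_iff by auto

lemma linf_norm_bdd: "x \<in> linf \<Longrightarrow> bdd_above (range (\<lambda>s. norm (x s)))"
  unfolding linf_def bounded_iff by (auto simp: bdd_above_def)

lemma linf_norm_ge: "x \<in> linf \<Longrightarrow> norm (x s) \<le> linf_norm x"
  unfolding linf_norm_def by (intro cSUP_upper linf_norm_bdd) auto

lemma linf_norm_le: "(\<And>s. norm (x s) \<le> B) \<Longrightarrow> linf_norm x \<le> B"
  unfolding linf_norm_def by (intro cSUP_least) auto

lemma linf_norm_nonneg: "x \<in> linf \<Longrightarrow> linf_norm x \<ge> 0"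
  by (rule order_trans[OF norm_ge_zero linf_norm_ge[where s=undefined]])

lemma linf_zero: "(\<lambda>_. 0) \<in> linf" "linf_norm (\<lambda>_. 0) = 0"
  by (simp_all add: linf_def linf_norm_def)

lemma linf_add:
  assumes "x \<in> linf" "y \<in> linf"
  shows "(\<lambda>s. x s + y s) \<in> linf" "linf_norm (\<lambda>s. x s + y s) \<le> linf_norm x + linf_norm y"
proof -
  have *: "norm (x s + y s) \<le> linf_norm x + linf_norm y" for s
    using norm_triangle_ineq[of "x s" "y s"] linf_norm_ge[OF assms(1), of s]
      linf_norm_ge[OF assms(2), of s] by linarith
  show "(\<lambda>s. x s + y s) \<in> linf"
    by (rule linfI, rule *)
  show "linf_norm (\<lambda>s. x s + y s) \<le> linf_norm x + linf_norm y"
    by (rule linf_norm_le, rule *)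
qed

lemma linf_cmult:
  assumes "x \<in> linf"
  shows "(\<lambda>s. c * x s) \<in> linf" "linf_norm (\<lambda>s. c * x s) = norm c * linf_norm x"
proof -
  have le: "norm (c * x s) \<le> norm c * linf_norm x" if "x \<in> linf" for c x and s :: 'a
    unfolding norm_mult by (intro mult_left_mono linf_norm_ge that) auto
  show 1: "(\<lambda>s. c * x s) \<in> linf"
    by (rule linfI, rule le[OF assms])
  show "linf_norm (\<lambda>s. c * x s) = norm c * linf_norm x"
  proof (cases "c = 0")
    case False
    have "linf_norm x = linf_norm (\<lambda>s. inverse c * (c * x s))"
      using False by (simp flip: mult.assoc)
    also have "\<dots> \<le> norm (inverse c) * linf_norm (\<lambda>s. c * x s)"
      by (rule linf_norm_le, rule le[OF 1])
    finally have "norm c * linf_norm x \<le> linf_norm (\<lambda>s. c * x s)"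
      using False by (simp add: norm_inverse norm_divide field_simps)
    moreover have "linf_norm (\<lambda>s. c * x s) \<le> norm c * linf_norm x"
      by (rule linf_norm_le, rule le[OF assms])
    ultimately show ?thesis
      by simp
  qed (simp add: linf_zero)
qed

lemma linf_lincomb: "x \<in> linf \<Longrightarrow> y \<in> linf \<Longrightarrow> (\<lambda>s. c * x s + d * y s) \<in> linf"
  by (intro linf_add linf_cmult)

lemma linf_diff: "x \<in> linf \<Longrightarrow> y \<in> linf \<Longrightarrow> (\<lambda>s. x s - y s) \<in> linf"
  using linf_lincomb[of x y 1 "-1"] by simp

lemma l1_subset_linf: "l1 \<subseteq> linf"
  by (auto intro: linfI[OF l1_norm_ge])

lemma l1_mult_linf:
  assumes "x \<in> linf" "a \<in> l1"
  shows "(\<lambda>s. x s * a s) \<in> l1" "l1_norm (\<lambda>s. x s * a s) \<le> linf_norm x * l1_norm a"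
proof -
  have *: "norm (x s * a s) \<le> norm (complex_of_real (linf_norm x) * a s)" for s
    using linf_norm_ge[OF assms(1), of s] linf_norm_nonneg[OF assms(1)]
    by (simp add: norm_mult mult_right_mono)
  note d = l1_dominated[OF l1_cmult(1)[OF assms(2), of "complex_of_real (linf_norm x)"] *]
  show "(\<lambda>s. x s * a s) \<in> l1"
    by (rule d(1))
  show "l1_norm (\<lambda>s. x s * a s) \<le> linf_norm x * l1_norm a"
    using d(2) l1_cmult(2)[OF assms(2), of "complex_of_real (linf_norm x)"] linf_norm_nonneg[OF assms(1)]
    by simp
qed

lemma pairing_has_sum: "x \<in> linf \<Longrightarrow> a \<in> l1 \<Longrightarrow> ((\<lambda>s. x s * a s) has_sum pairing x a) UNIV"
  unfolding pairing_def using l1_mult_linf(1) abs_summable_summable has_sum_infsum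
  by (fastforce simp: l1_def)

lemma pairing_summable: "x \<in> linf \<Longrightarrow> a \<in> l1 \<Longrightarrow> (\<lambda>s. x s * a s) summable_on UNIV"
  using pairing_has_sum has_sum_imp_summable by blast

lemma pairing_bound:
  assumes "x \<in> linf" "a \<in> l1"
  shows "norm (pairing x a) \<le> linf_norm x * l1_norm a"
proof -
  have "norm (pairing x a) \<le> (\<Sum>\<^sub>\<infinity>s. norm (x s * a s))"
    unfolding pairing_def using l1_mult_linf(1)[OF assms]
    by (intro norm_infsum_bound) (simp add: l1_def)
  then show ?thesis
    using l1_mult_linf(2)[OF assms] by (simp add: l1_norm_def)
qed

lemma pairing_bound':
  assumes "\<And>s. norm (x s) \<le> B" "a \<in> l1"
  shows "norm (pairing x a) \<le> B * l1_norm a"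
  by (rule order_trans[OF pairing_bound[OF linfI[of x B, OF assms(1)] assms(2)]
        mult_right_mono[OF linf_norm_le[of x B, OF assms(1)] l1_norm_nonneg]])

lemma pairing_lincomb_right:
  assumes "x \<in> linf" "a \<in> l1" "b \<in> l1"
  shows "pairing x (\<lambda>s. c * a s + d * b s) = c * pairing x a + d * pairing x b"
proof -
  have "((\<lambda>s. c * (x s * a s) + d * (x s * b s)) has_sum (c * pairing x a + d * pairing x b)) UNIV"
    by (intro has_sum_add has_sum_cmult_right pairing_has_sum assms)
  then show ?thesis
    by (simp add: pairing_def infsumI algebra_simps)
qed

lemma pairing_lincomb_left:
  assumes "x \<in> linf" "y \<in> linf" "a \<in> l1"
  shows "pairing (\<lambda>s. c * x s + d * y s) a = c * pairing x a + d * pairing y a"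
proof -
  have "((\<lambda>s. c * (x s * a s) + d * (y s * a s)) has_sum (c * pairing x a + d * pairing y a)) UNIV"
    by (intro has_sum_add has_sum_cmult_right pairing_has_sum assms)
  then show ?thesis
    by (simp add: pairing_def infsumI algebra_simps)
qed

lemma pairing_zero [simp]: "pairing x (\<lambda>_. 0) = 0" "pairing (\<lambda>_. 0) a = 0"
  by (simp_all add: pairing_def)

lemma pairing_add_right:
  "x \<in> linf \<Longrightarrow> a \<in> l1 \<Longrightarrow> b \<in> l1 \<Longrightarrow> pairing x (\<lambda>s. a s + b s) = pairing x a + pairing x b"
  using pairing_lincomb_right[of x a b 1 1] by simp

lemma pairing_diff_right:
  "x \<in> linf \<Longrightarrow> a \<in> l1 \<Longrightarrow> b \<in> l1 \<Longrightarrow> pairing x (\<lambda>s. a s - b s) = pairing x a - pairing x b"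
  using pairing_lincomb_right[of x a b 1 "-1"] by simp

lemma pairing_diff_left:
  "x \<in> linf \<Longrightarrow> y \<in> linf \<Longrightarrow> a \<in> l1 \<Longrightarrow> pairing (\<lambda>s. x s - y s) a = pairing x a - pairing y a"
  using pairing_lincomb_left[of x y a 1 "-1"] by simp

lemma pairing_sum_right:
  "finite I \<Longrightarrow> x \<in> linf \<Longrightarrow> (\<And>i. i \<in> I \<Longrightarrow> a i \<in> l1) \<Longrightarrow>
     pairing x (\<lambda>s. \<Sum>i\<in>I. a i s) = (\<Sum>i\<in>I. pairing x (a i))"
  by (induction I rule: finite_induct) (auto simp: pairing_add_right l1_sum)

lemma delta_l1: "delta s \<in> l1" "l1_norm (delta s) = 1"
proof -
  have "((\<lambda>t. norm (delta s t)) has_sum 1) UNIV"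
    by (rule has_sum_finite_neutralI[of "{s}"]) (auto simp: delta_def)
  then show "delta s \<in> l1" "l1_norm (delta s) = 1"
    by (auto simp: l1_def l1_norm_def has_sum_imp_summable infsumI)
qed

lemma pairing_delta: "pairing x (delta s) = x s"
proof -
  have "((\<lambda>t. x t * delta s t) has_sum x s) UNIV"
    by (rule has_sum_finite_neutralI[of "{s}"]) (auto simp: delta_def)
  then show ?thesis
    by (simp add: pairing_def infsumI)
qed

lemma pairing_delta_left: "pairing (delta s) a = a s"
  using pairing_delta[of a s] by (simp add: pairing_def mult.commute)

lemma delta_linf: "delta s \<in> linf"
  by (rule subsetD[OF l1_subset_linf delta_l1(1)])

lemma l1_eqI:
  assumes "a \<in> l1" "b \<in> l1" "\<And>x. x \<in> linf \<Longrightarrow> pairing x a = pairing x b"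
  shows "a = b"
  using assms(3)[OF delta_linf] by (auto simp: pairing_delta_left fun_eq_iff)

section \<open>Double sums and convolution\<close>

lemma l1_product:
  assumes "a \<in> l1" "b \<in> l1"
  shows "(\<lambda>(s, t). a s * b t) \<in> l1" "l1_norm (\<lambda>(s, t). a s * b t) = l1_norm a * l1_norm b"
proof -
  have *: "((\<lambda>(s, t). norm (a s) * norm (b t)) has_sum l1_norm a * l1_norm b) (UNIV \<times> UNIV)"
  proof (rule has_sum_SigmaI)
    show "((\<lambda>t. case (s, t) of (s, t) \<Rightarrow> norm (a s) * norm (b t)) has_sum norm (a s) * l1_norm b) UNIV" for s
      unfolding prod.case l1_norm_def using assms(2)
      by (intro has_sum_cmult_right has_sum_infsum) (simp add: l1_def)
    show "((\<lambda>s. norm (a s) * l1_norm b) has_sum l1_norm a * l1_norm b) UNIV"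
      unfolding l1_norm_def using assms(1) by (intro has_sum_cmult_left has_sum_infsum) (simp add: l1_def)
    show "(\<lambda>(s, t). norm (a s) * norm (b t)) summable_on UNIV \<times> UNIV"
    proof (rule summable_on_SigmaI)
      show "((\<lambda>t. case (s, t) of (s, t) \<Rightarrow> norm (a s) * norm (b t)) has_sum norm (a s) * l1_norm b) UNIV" for s
        unfolding prod.case l1_norm_def using assms(2)
        by (intro has_sum_cmult_right has_sum_infsum) (simp add: l1_def)
      show "(\<lambda>s. norm (a s) * l1_norm b) summable_on UNIV"
        using assms(1) by (intro summable_on_cmult_left) (simp add: l1_def)
    qed auto
  qed
  then show "(\<lambda>(s, t). a s * b t) \<in> l1" "l1_norm (\<lambda>(s, t). a s * b t) = l1_norm a * l1_norm b"
    by (auto simp: l1_def l1_norm_def norm_mult case_prod_unfold has_sum_imp_summable infsumI)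
qed

text \<open>No summability is required, because an infinite sum commutes with multiplication by a
  constant even when it diverges. The two Fubini statements that follow are reduced to the
  right-hand side.\<close>

lemma pairing_iterated:
  "pairing (\<lambda>s. pairing (h s) b) a = (\<Sum>\<^sub>\<infinity>s. \<Sum>\<^sub>\<infinity>t. h s t * (a s * b t))"
proof -
  have "pairing (h s) b * a s = (\<Sum>\<^sub>\<infinity>t. h s t * b t * a s)" for s
    unfolding pairing_def by (rule infsum_cmult_left'[symmetric])
  then show ?thesis
    unfolding pairing_def[of _ a] by (simp only: mult.assoc mult.commute[of "b _"])
qed

lemma pairing_product:
  assumes "a \<in> l1" "b \<in> l1" "\<And>s t. norm (h s t) \<le> B"
  shows "pairing (\<lambda>s. pairing (\<lambda>t. h s t) b) a = pairing (\<lambda>(s, t). h s t) (\<lambda>(s, t). a s * b t)"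
proof -
  have "(\<lambda>(s, t). h s t) \<in> linf"
    using assms(3) by (intro linfI[of _ B]) auto
  from pairing_summable[OF this l1_product(1)[OF assms(1,2)]]
  have "(\<lambda>(s, t). h s t * (a s * b t)) summable_on UNIV \<times> UNIV"
    by (simp add: case_prod_unfold)
  from infsum_Sigma'_banach[OF this]
  have "pairing (\<lambda>(s, t). h s t) (\<lambda>(s, t). a s * b t) = (\<Sum>\<^sub>\<infinity>s. \<Sum>\<^sub>\<infinity>t. h s t * (a s * b t))"
    by (simp add: pairing_def case_prod_unfold)
  then show ?thesis
    by (simp add: pairing_iterated)
qed

lemma pairing_swap:
  assumes "a \<in> l1" "b \<in> l1" "\<And>s t. norm (h s t) \<le> B"
  shows "pairing (\<lambda>s. pairing (\<lambda>t. h s t) b) a = pairing (\<lambda>t. pairing (\<lambda>s. h s t) a) b"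
proof -
  have "(\<lambda>(s, t). h s t) \<in> linf"
    using assms(3) by (intro linfI[of _ B]) auto
  from pairing_summable[OF this l1_product(1)[OF assms(1,2)]]
  have "(\<lambda>(s, t). h s t * (a s * b t)) summable_on UNIV \<times> UNIV"
    by (simp add: case_prod_unfold)
  from infsum_swap_banach[OF this]
  have "(\<Sum>\<^sub>\<infinity>s. \<Sum>\<^sub>\<infinity>t. h s t * (a s * b t)) = (\<Sum>\<^sub>\<infinity>t. \<Sum>\<^sub>\<infinity>s. h s t * (a s * b t))" .
  then show ?thesis
    unfolding pairing_iterated by (simp only: mult.commute[of "b _"])
qed

text \<open>The fibres of \<open>p\<close> partition the set of all pairs. Summing the product of
  \<open>a\<close> and \<open>b\<close> along this partition gives the norm bound, and the same
  rearrangement with the weight \<open>x (p t u)\<close>, constant on each fibre, gives the formula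
  for the pairing.\<close>

lemma
  assumes "a \<in> l1" "b \<in> l1"
  shows conv_l1: "conv p a b \<in> l1" "l1_norm (conv p a b) \<le> l1_norm a * l1_norm b"
    and pairing_conv: "x \<in> linf \<Longrightarrow>
      pairing x (conv p a b) = pairing (\<lambda>t. pairing (\<lambda>u. x (p t u)) b) a"
proof -
  define ab where "ab = (\<lambda>(s, t). a s * b t)"
  note ab = l1_product[OF assms, folded ab_def]
  define F where "F s = {(t, u). p t u = s}" for s
  have conv: "conv p a b s = (\<Sum>\<^sub>\<infinity>z\<in>F s. ab z)" for s
    by (simp add: conv_def F_def ab_def)
  \<comment> \<open>The partition into fibres is expressed by a bijection from the disjoint union of
    the fibres onto the set of pairs, so that Fubini for \<open>Sigma\<close> applies.\<close>
  have inj: "inj_on snd (Sigma UNIV F)" and img: "snd ` Sigma UNIV F = UNIV"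
    unfolding F_def by (force simp: inj_on_def image_iff)+
  have "(\<lambda>z. norm (ab z)) summable_on (snd ` Sigma UNIV F)"
    using ab(1) by (simp add: img l1_def)
  then have "(\<lambda>y. norm (ab (snd y))) summable_on Sigma UNIV F"
    using summable_on_reindex[OF inj, of "\<lambda>z. norm (ab z)"] by (simp add: o_def)
  then have *: "(\<lambda>s. \<Sum>\<^sub>\<infinity>z\<in>F s. norm (ab z)) summable_on UNIV"
    and **: "(\<Sum>\<^sub>\<infinity>s. \<Sum>\<^sub>\<infinity>z\<in>F s. norm (ab z)) = (\<Sum>\<^sub>\<infinity>y\<in>Sigma UNIV F. norm (ab (snd y)))"
    using summable_on_Sigma_banach[of "\<lambda>s z. norm (ab z)" UNIV F]
      infsum_Sigma'_banach[of "\<lambda>s z. norm (ab z)" UNIV F] by (auto simp: case_prod_unfold)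
  have sum: "(\<Sum>\<^sub>\<infinity>s. \<Sum>\<^sub>\<infinity>z\<in>F s. norm (ab z)) = l1_norm ab"
    using infsum_reindex[OF inj, of "\<lambda>z. norm (ab z)"] by (simp add: ** img o_def l1_norm_def)
  have le: "norm (conv p a b s) \<le> (\<Sum>\<^sub>\<infinity>z\<in>F s. norm (ab z))" for s
    unfolding conv by (rule norm_infsum_bound, rule l1_summable[OF ab(1)])
  have bnd: "(\<Sum>s\<in>A. norm (conv p a b s)) \<le> l1_norm a * l1_norm b" if "finite A" for A
  proof -
    have "(\<Sum>s\<in>A. norm (conv p a b s)) \<le> (\<Sum>s\<in>A. \<Sum>\<^sub>\<infinity>z\<in>F s. norm (ab z))"
      by (intro sum_mono le)
    also have "\<dots> \<le> (\<Sum>\<^sub>\<infinity>s. \<Sum>\<^sub>\<infinity>z\<in>F s. norm (ab z))"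
      by (intro finite_sum_le_infsum * that) (auto intro: infsum_nonneg)
    finally show ?thesis
      by (simp add: sum ab(2))
  qed
  show "conv p a b \<in> l1" "l1_norm (conv p a b) \<le> l1_norm a * l1_norm b"
    by (rule l1I[OF bnd]; assumption)+
  assume x: "x \<in> linf"
  define x2 where "x2 = (\<lambda>(t, u). x (p t u))"
  have x2: "x2 \<in> linf"
    using linf_norm_ge[OF x] by (intro linfI[of _ "linf_norm x"]) (auto simp: x2_def)
  have "(\<lambda>z. x2 z * ab z) summable_on (snd ` Sigma UNIV F)"
    unfolding img using pairing_summable[OF x2 ab(1)] .
  then have "(\<lambda>(s, z). x2 z * ab z) summable_on Sigma UNIV F"
    using summable_on_reindex[OF inj, of "\<lambda>z. x2 z * ab z"] by (simp add: o_def case_prod_unfold)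
  from infsum_Sigma'_banach[OF this]
  have "(\<Sum>\<^sub>\<infinity>s. \<Sum>\<^sub>\<infinity>z\<in>F s. x2 z * ab z) = (\<Sum>\<^sub>\<infinity>z\<in>Sigma UNIV F. x2 (snd z) * ab (snd z))"
    by (simp add: case_prod_unfold)
  also have "\<dots> = pairing x2 ab"
    using infsum_reindex[OF inj, of "\<lambda>z. x2 z * ab z"] by (simp add: img o_def pairing_def)
  finally have "pairing x2 ab = (\<Sum>\<^sub>\<infinity>s. \<Sum>\<^sub>\<infinity>z\<in>F s. x2 z * ab z)" ..
  also have "\<dots> = (\<Sum>\<^sub>\<infinity>s. \<Sum>\<^sub>\<infinity>z\<in>F s. x s * ab z)"
    by (intro infsum_cong) (auto simp: F_def x2_def)
  also have "\<dots> = pairing x (conv p a b)"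
    by (simp add: pairing_def conv infsum_cmult_right')
  finally show "pairing x (conv p a b) = pairing (\<lambda>t. pairing (\<lambda>u. x (p t u)) b) a"
    using pairing_product[OF assms, of "\<lambda>t u. x (p t u)" "linf_norm x"] linf_norm_ge[OF x]
    by (simp add: x2_def ab_def)
qed

text \<open>Identities between convolutions are tested against bounded functions; sums over fibres
  then turn into iterated pairings, where commutativity and associativity of \<open>p\<close> can be
  applied directly to the argument of \<open>x\<close>.\<close>

lemma conv_eqI:
  assumes "a \<in> l1" "b \<in> l1" "c \<in> l1"
    "\<And>x. x \<in> linf \<Longrightarrow> pairing (\<lambda>t. pairing (\<lambda>u. x (p t u)) b) a = pairing x c"
  shows "conv p a b = c"
  using assms by (intro l1_eqI conv_l1) (simp_all add: pairing_conv)

lemma pairing_linf: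
  assumes "\<And>s t. norm (h s t) \<le> B" "b \<in> l1"
  shows "(\<lambda>s. pairing (h s) b) \<in> linf"
  by (rule linfI, rule pairing_bound'[OF assms])

lemma conv_delta_delta: "conv p (delta s) (delta t) = delta (p s t)"
  by (rule conv_eqI) (simp_all add: delta_l1 pairing_delta)

lemma conv_commute:
  assumes "a \<in> l1" "b \<in> l1" "\<And>s t. p s t = p t s"
  shows "conv p a b = conv p b a"
proof (rule conv_eqI[OF assms(1,2) conv_l1(1)[OF assms(2,1)]])
  fix x :: "'a \<Rightarrow> complex" assume "x \<in> linf"
  then show "pairing (\<lambda>t. pairing (\<lambda>u. x (p t u)) b) a = pairing x (conv p b a)"
    using pairing_swap[OF assms(1,2), of "\<lambda>t u. x (p t u)", OF linf_norm_ge[OF \<open>x \<in> linf\<close>]]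
    by (simp add: pairing_conv assms(1,2) assms(3)[of _ "_ :: 'a"])
qed

lemma conv_assoc:
  assumes "a \<in> l1" "b \<in> l1" "c \<in> l1" "\<And>s t u. p (p s t) u = p s (p t u)"
  shows "conv p (conv p a b) c = conv p a (conv p b c)"
proof (rule conv_eqI)
  fix x :: "'a \<Rightarrow> complex" assume x: "x \<in> linf"
  note b = linf_norm_ge[OF x]
  have 1: "(\<lambda>t. pairing (\<lambda>u. x (p t u)) c) \<in> linf"
    by (rule pairing_linf[OF b assms(3)])
  have 2: "(\<lambda>u. x (p t u)) \<in> linf" for t
    by (rule linfI[OF b])
  show "pairing (\<lambda>t. pairing (\<lambda>u. x (p t u)) c) (conv p a b) = pairing x (conv p a (conv p b c))"
    using pairing_conv[OF assms(1,2) 1, of p] pairing_conv[OF assms(1) conv_l1(1)[OF assms(2,3), of p] x, of p]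
      pairing_conv[OF assms(2,3) 2, where p=p] assms(4) by simp
qed (intro conv_l1 assms)+

lemma conv_int:
  fixes n :: int
  assumes "a \<in> l1" "b \<in> l1"
  shows "conv (+) a b n = pairing (\<lambda>u. a (n - u)) b"
proof -
  have eq: "(\<lambda>t. delta n (t + u)) = delta (n - u)" for u
    by (auto simp: delta_def fun_eq_iff)
  have "norm (delta n (t + u)) \<le> 1" for t u :: int
    by (simp add: delta_def)
  note sw = pairing_swap[OF assms, of "\<lambda>t u. delta n (t + u)", OF this]
  have "conv (+) a b n = pairing (delta n) (conv (+) a b)"
    by (simp add: pairing_delta_left)
  also have "\<dots> = pairing (\<lambda>u. pairing (\<lambda>t. delta n (t + u)) a) b"
    by (simp add: pairing_conv[OF assms delta_linf] sw)
  finally show ?thesis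
    by (simp add: eq pairing_delta_left)
qed

text \<open>This is why smallness of the powers in the sup norm is useful: such a factor makes every
  coordinate of a convolution small, uniformly over partners of bounded \<open>l1\<close>
  norm.\<close>

lemma conv_int_bound:
  fixes n :: int
  assumes "a \<in> l1" "b \<in> l1"
  shows "norm (conv (+) a b n) \<le> linf_norm a * l1_norm b"
  unfolding conv_int[OF assms] using assms l1_subset_linf
  by (intro pairing_bound' linf_norm_ge) auto

section \<open>Linear functionals on subspaces given as sets of functions\<close>

definition lin_on :: "('a \<Rightarrow> complex) set \<Rightarrow> (('a \<Rightarrow> complex) \<Rightarrow> complex) \<Rightarrow> bool" where
  "lin_on V \<phi> \<longleftrightarrow> (\<forall>x\<in>V. \<forall>y\<in>V. \<forall>c d. \<phi> (\<lambda>s. c * x s + d * y s) = c * \<phi> x + d * \<phi> y)"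

definition lin_closed :: "('a \<Rightarrow> complex) set \<Rightarrow> bool" where
  "lin_closed V \<longleftrightarrow> (\<lambda>_. 0) \<in> V \<and> (\<forall>x\<in>V. \<forall>y\<in>V. \<forall>c d. (\<lambda>s. c * x s + d * y s) \<in> V)"

lemma lin_onD: "lin_on V \<phi> \<Longrightarrow> x \<in> V \<Longrightarrow> y \<in> V \<Longrightarrow> \<phi> (\<lambda>s. c * x s + d * y s) = c * \<phi> x + d * \<phi> y"
  by (simp add: lin_on_def)

lemma lin_on_cmult: "lin_on V \<phi> \<Longrightarrow> x \<in> V \<Longrightarrow> \<phi> (\<lambda>s. c * x s) = c * \<phi> x"
  using lin_onD[of V \<phi> x x c 0] by simp

lemma lin_on_add: "lin_on V \<phi> \<Longrightarrow> x \<in> V \<Longrightarrow> y \<in> V \<Longrightarrow> \<phi> (\<lambda>s. x s + y s) = \<phi> x + \<phi> y"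
  using lin_onD[of V \<phi> x y 1 1] by simp

lemma lin_on_diff: "lin_on V \<phi> \<Longrightarrow> x \<in> V \<Longrightarrow> y \<in> V \<Longrightarrow> \<phi> (\<lambda>s. x s - y s) = \<phi> x - \<phi> y"
  using lin_onD[of V \<phi> x y 1 "-1"] by simp

lemma lin_on_zero: "lin_on V \<phi> \<Longrightarrow> x \<in> V \<Longrightarrow> \<phi> (\<lambda>_. 0) = 0"
  using lin_on_cmult[of V \<phi> x 0] by simp

lemma lin_on_subset: "lin_on V \<phi> \<Longrightarrow> U \<subseteq> V \<Longrightarrow> lin_on U \<phi>"
  by (auto simp: lin_on_def subset_iff)

lemma lin_closed_lincomb: "lin_closed V \<Longrightarrow> x \<in> V \<Longrightarrow> y \<in> V \<Longrightarrow> (\<lambda>s. c * x s + d * y s) \<in> V"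
  by (simp add: lin_closed_def)

lemma lin_closed_zero: "lin_closed V \<Longrightarrow> (\<lambda>_. 0) \<in> V"
  by (simp add: lin_closed_def)

lemma lin_closed_cmult: "lin_closed V \<Longrightarrow> x \<in> V \<Longrightarrow> (\<lambda>s. c * x s) \<in> V"
  using lin_closed_lincomb[of V x x c 0] by simp

lemma lin_closed_add: "lin_closed V \<Longrightarrow> x \<in> V \<Longrightarrow> y \<in> V \<Longrightarrow> (\<lambda>s. x s + y s) \<in> V"
  using lin_closed_lincomb[of V x y 1 1] by simp

lemma lin_closed_diff: "lin_closed V \<Longrightarrow> x \<in> V \<Longrightarrow> y \<in> V \<Longrightarrow> (\<lambda>s. x s - y s) \<in> V"
  using lin_closed_lincomb[of V x y 1 "-1"] by simp

lemma lin_sum: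
  assumes "lin_closed V" "finite I" "\<And>i. i \<in> I \<Longrightarrow> f i \<in> V"
  shows "(\<lambda>s. \<Sum>i\<in>I. c i * f i s) \<in> V"
    and "lin_on V \<phi> \<Longrightarrow> \<phi> (\<lambda>s. \<Sum>i\<in>I. c i * f i s) = (\<Sum>i\<in>I. c i * \<phi> (f i))"
proof -
  have "(\<lambda>s. \<Sum>i\<in>I. c i * f i s) \<in> V \<and>
      (lin_on V \<phi> \<longrightarrow> \<phi> (\<lambda>s. \<Sum>i\<in>I. c i * f i s) = (\<Sum>i\<in>I. c i * \<phi> (f i)))"
    using assms(2,3)
  proof (induction I rule: finite_induct)
    case empty
    then show ?case
      using lin_closed_zero[OF assms(1)] lin_on_zero[of V \<phi> "\<lambda>_. 0"] by simp
  next
    case (insert i I)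
    then show ?case
      using lin_closed_lincomb[OF assms(1), of "f i" "\<lambda>s. \<Sum>i\<in>I. c i * f i s" "c i" 1]
        lin_onD[of V \<phi> "f i" "\<lambda>s. \<Sum>i\<in>I. c i * f i s" "c i" 1] by simp
  qed
  then show "(\<lambda>s. \<Sum>i\<in>I. c i * f i s) \<in> V"
    and "lin_on V \<phi> \<Longrightarrow> \<phi> (\<lambda>s. \<Sum>i\<in>I. c i * f i s) = (\<Sum>i\<in>I. c i * \<phi> (f i))" by blast+
qed

lemma lin_closed_l1: "lin_closed l1"
  by (auto simp: lin_closed_def l1_zero l1_lincomb)

lemma lin_closed_linf: "lin_closed linf"
  by (auto simp: lin_closed_def linf_zero linf_lincomb)

lemma lin_on_pairing: "x \<in> linf \<Longrightarrow> lin_on l1 (pairing x)"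
  by (simp add: lin_on_def pairing_lincomb_right)

text \<open>The dual of \<open>l1\<close> is \<open>linf\<close>. The difference
  \<open>\<psi>\<close> of both sides vanishes on point masses, hence on finitely supported
  elements, and by boundedness only an arbitrarily small tail of \<open>\<mu>\<close>
  contributes.\<close>

lemma l1_functional:
  assumes lin: "lin_on l1 \<phi>" and bnd: "\<And>\<mu>. \<mu> \<in> l1 \<Longrightarrow> norm (\<phi> \<mu>) \<le> C * l1_norm \<mu>" and \<mu>: "\<mu> \<in> l1"
  shows "(\<lambda>s. \<phi> (delta s)) \<in> linf" "\<phi> \<mu> = pairing (\<lambda>s. \<phi> (delta s)) \<mu>"
proof -
  have le: "norm (\<phi> (delta s)) \<le> C" for s
    using bnd[OF delta_l1(1), of s] by (simp add: delta_l1)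
  show linf: "(\<lambda>s. \<phi> (delta s)) \<in> linf"
    by (rule linfI[OF le])
  have C: "C \<ge> 0"
    using le norm_ge_zero order_trans by blast
  define \<psi> where "\<psi> \<nu> = \<phi> \<nu> - pairing (\<lambda>s. \<phi> (delta s)) \<nu>" for \<nu>
  have \<psi>lin: "lin_on l1 \<psi>"
    using lin lin_on_pairing[OF linf] by (simp add: lin_on_def \<psi>_def algebra_simps)
  have \<psi>0: "\<psi> (delta s) = 0" for s
    by (simp add: \<psi>_def pairing_delta)
  have \<psi>le: "norm (\<psi> \<nu>) \<le> 2 * C * l1_norm \<nu>" if "\<nu> \<in> l1" for \<nu>
    using norm_triangle_ineq4[of "\<phi> \<nu>" "pairing (\<lambda>s. \<phi> (delta s)) \<nu>"]
      bnd[OF that] pairing_bound'[of "\<lambda>s. \<phi> (delta s)" C, OF le that] by (simp add: \<psi>_def)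
  have "norm (\<psi> \<mu>) \<le> e" if "e > 0" for e
  proof -
    \<comment> \<open>The factor 2 * C is the bound for \<open>\<psi>\<close>; adding 1 keeps the
      quotient meaningful when \<open>C\<close> is 0.\<close>
    have "e / (2 * C + 1) > 0"
      using that C by simp
    then obtain A where A: "finite A" "l1_norm (\<lambda>s. if s \<in> A then 0 else \<mu> s) \<le> e / (2 * C + 1)"
      by (rule l1_tail[OF \<mu>])
    let ?t = "\<lambda>s. if s \<in> A then 0 else \<mu> s" and ?m = "\<lambda>t. \<Sum>s\<in>A. \<mu> s * delta s t"
    have t: "?t \<in> l1"
      by (rule l1_dominated[OF \<mu>]) auto
    have m: "?m \<in> l1" "\<psi> ?m = 0"
      using lin_sum(1)[OF lin_closed_l1 A(1), where f=delta and c=\<mu>]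
        lin_sum(2)[OF lin_closed_l1 A(1), where f=delta and c=\<mu> and \<phi>=\<psi>] \<psi>lin \<psi>0 by (auto simp: delta_l1(1))
    have "?m t = (if t \<in> A then \<mu> t else 0)" for t
      using A(1) by (simp add: delta_def if_distrib[of "\<lambda>x. _ * x"] sum.delta cong: if_cong)
    then have "(\<lambda>s. ?t s + ?m s) = \<mu>"
      by (auto simp: fun_eq_iff)
    then have "\<psi> \<mu> = \<psi> ?t"
      using lin_on_add[OF \<psi>lin t m(1)] m(2) by simp
    also have "norm \<dots> \<le> 2 * C * (e / (2 * C + 1))"
      using \<psi>le[OF t] A(2) C by (meson mult_left_mono order_trans mult_nonneg_nonneg zero_le_numeral)
    also have "\<dots> \<le> e"
      using C that by (simp add: field_simps)
    finally show ?thesis .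
  qed
  then have "norm (\<psi> \<mu>) \<le> 0"
    by (rule field_le_epsilon) simp
  then show "\<phi> \<mu> = pairing (\<lambda>s. \<phi> (delta s)) \<mu>"
    by (simp add: \<psi>_def)
qed

section \<open>The Hahn-Banach theorem for bounded functions\<close>

text \<open>The complex functions are regarded as a real vector space. Homogeneity is demanded as an
  inequality only, the form in which it passes to infima; equality follows by applying it to the
  inverse scalar.\<close>

definition sublin :: "(('a \<Rightarrow> complex) \<Rightarrow> real) \<Rightarrow> bool" where
  "sublin q \<longleftrightarrow> q (\<lambda>_. 0) = 0 \<and>
     (\<forall>x\<in>linf. \<forall>y\<in>linf. q (\<lambda>s. x s + y s) \<le> q x + q y) \<and>
     (\<forall>x\<in>linf. \<forall>t>0. q (\<lambda>s. of_real t * x s) \<le> t * q x)"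

lemma sublin_ge:
  assumes "sublin q" "x \<in> linf"
  shows "- q (\<lambda>s. - x s) \<le> q x"
proof -
  have "(\<lambda>s. - x s) \<in> linf"
    using linf_cmult(1)[OF assms(2), of "-1"] by simp
  then have "q (\<lambda>s. x s + - x s) \<le> q x + q (\<lambda>s. - x s)"
    using assms(1)[unfolded sublin_def, THEN conjunct2, THEN conjunct1, rule_format, OF assms(2)] by blast
  then show ?thesis
    using assms(1) by (simp add: sublin_def)
qed

lemma sublin_scale:
  assumes "sublin q" "x \<in> linf" "t > 0"
  shows "q (\<lambda>s. of_real t * x s) = t * q x"
proof (rule antisym)
  show "q (\<lambda>s. of_real t * x s) \<le> t * q x"
    using assms by (simp add: sublin_def)
  have "q (\<lambda>s. of_real (inverse t) * (of_real t * x s)) \<le> inverse t * q (\<lambda>s. of_real t * x s)"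
    using assms linf_cmult(1)[OF assms(2), of "of_real t"] unfolding sublin_def
    by (meson positive_imp_inverse_positive)
  moreover have "(\<lambda>s. of_real (inverse t) * (of_real t * x s)) = x"
    using assms(3) by (simp add: fun_eq_iff flip: mult.assoc of_real_mult)
  ultimately show "t * q x \<le> q (\<lambda>s. of_real t * x s)"
    using assms(3) by (simp add: field_simps)
qed

text \<open>Minimality is applied to \<open>x \<mapsto> inf\<^sub>t (q (x + t y) - t q y)\<close>, which is again sublinear.\<close>
lemma minimal_sublin_additive:
  assumes q: "sublin q" and out: "\<And>x. x \<notin> linf \<Longrightarrow> q x = 0"
    and min: "\<And>r. sublin r \<Longrightarrow> (\<And>x. x \<notin> linf \<Longrightarrow> r x = 0) \<Longrightarrow> (\<And>x. r x \<le> q x) \<Longrightarrow> r = q"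
    and x: "x \<in> linf" and y: "y \<in> linf"
  shows "q (\<lambda>s. x s + y s) = q x + q y"
proof -
  have sub: "q (\<lambda>s. x s + y s) \<le> q x + q y" if "x \<in> linf" "y \<in> linf" for x y
    using q that by (simp add: sublin_def)
  define T where "T t x = q (\<lambda>s. x s + of_real t * y s) - t * q y" for t :: real and x
  define r where "r x = (if x \<in> linf then INF t\<in>{0..}. T t x else 0)" for x
  have in': "(\<lambda>s. x s + of_real t * y s) \<in> linf" if "x \<in> linf" for x t
    using linf_lincomb[OF that y, of 1 "of_real t"] by simp
  have sc: "q (\<lambda>s. of_real t * y s) = t * q y" if "t \<ge> 0" for t
    using sublin_scale[OF q y, of t] q that by (cases "t = 0") (auto simp: sublin_def)
  have neg: "(\<lambda>s. - x s) \<in> linf" if "x \<in> linf" for x :: "'a \<Rightarrow> complex"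
    using linf_cmult(1)[OF that, of "-1"] by simp
  have low: "- q (\<lambda>s. - x s) \<le> T t x" if "x \<in> linf" "t \<ge> 0" for x t
    using sub[OF in'[OF that(1), of t] neg[OF that(1)]] sc[OF that(2)] by (simp add: T_def)
  have bdd: "bdd_below ((\<lambda>t. T t x) ` {0..})" if "x \<in> linf" for x
    using low[OF that] by (intro bdd_belowI2) auto
  have rle: "r x \<le> T t x" if "x \<in> linf" "t \<ge> 0" for x t
    unfolding r_def using that bdd[OF that(1)] by (auto intro: cINF_lower)
  have rge: "m \<le> r x" if "x \<in> linf" "\<And>t. t \<ge> 0 \<Longrightarrow> m \<le> T t x" for x m
    unfolding r_def using that by (auto intro: cINF_greatest)
  have "sublin r"
    unfolding sublin_def
  proof (intro conjI ballI allI impI)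
    have 0: "T t (\<lambda>_. 0) = 0" if "t \<ge> 0" for t
      using sc[OF that] by (simp add: T_def)
    show "r (\<lambda>_. 0) = 0"
      using rge[OF linf_zero(1), of 0] rle[OF linf_zero(1), of 0] 0 by (intro antisym) auto
  next
    fix x z :: "'a \<Rightarrow> complex" assume xz: "x \<in> linf" "z \<in> linf"
    have *: "r (\<lambda>s. x s + z s) \<le> T t x + T u z" if "t \<ge> 0" "u \<ge> 0" for t u
    proof -
      have "r (\<lambda>s. x s + z s) \<le> T (t + u) (\<lambda>s. x s + z s)"
        using that by (intro rle linf_add xz) auto
      also have "\<dots> \<le> T t x + T u z"
        using sub[OF in'[OF xz(1), of t] in'[OF xz(2), of u]] by (simp add: T_def algebra_simps)
      finally show ?thesis .
    qed
    have "r (\<lambda>s. x s + z s) - r z \<le> T t x" if "t \<ge> 0" for t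
      using rge[OF xz(2), of "r (\<lambda>s. x s + z s) - T t x"] *[OF that] by (simp add: algebra_simps)
    from rge[OF xz(1) this] show "r (\<lambda>s. x s + z s) \<le> r x + r z"
      by simp
  next
    fix x :: "'a \<Rightarrow> complex" and c :: real assume x: "x \<in> linf" and c: "c > 0"
    have "r (\<lambda>s. of_real c * x s) / c \<le> T t x" if "t \<ge> 0" for t
    proof -
      have "r (\<lambda>s. of_real c * x s) \<le> T (c * t) (\<lambda>s. of_real c * x s)"
        using that c by (intro rle linf_cmult x) auto
      also have "\<dots> = c * T t x"
        using sublin_scale[OF q in'[OF x] c, of t] by (simp add: T_def algebra_simps)
      finally show ?thesis
        using c by (simp add: field_simps)
    qed
    from rge[OF x this] show "r (\<lambda>s. of_real c * x s) \<le> c * r x"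
      using c by (simp add: field_simps)
  qed
  moreover have "r x = 0" if "x \<notin> linf" for x
    using that by (simp add: r_def)
  moreover have "r x \<le> q x" for x
    using rle[of x 0] out[of x] by (cases "x \<in> linf") (auto simp: T_def r_def)
  ultimately have "r = q"
    by (rule min)
  \<comment> \<open>At t = 1 this reads \<open>q x + q y \<le> q (x + y)\<close>, the inequality
    opposite to subadditivity.\<close>
  then have "q x \<le> T 1 x"
    using rle[OF x, of 1] by simp
  then show ?thesis
    using sub[OF x y] by (simp add: T_def)
qed

text \<open>Zorn's lemma for the reversed pointwise order. Pointwise infima of chains exist because
  every sublinear q below p satisfies q x \<ge> - p (- x). Values outside \<open>linf\<close> are
  normalised to 0, so that the order is antisymmetric on functions and minimality yields an
  equality.\<close>

lemma ex_minimal_sublin: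
  assumes p: "sublin p"
  obtains q where "sublin q" "\<And>x. x \<notin> linf \<Longrightarrow> q x = 0" "\<And>x. x \<in> linf \<Longrightarrow> q x \<le> p x"
    "\<And>r. sublin r \<Longrightarrow> (\<And>x. x \<notin> linf \<Longrightarrow> r x = 0) \<Longrightarrow> (\<And>x. r x \<le> q x) \<Longrightarrow> r = q"
proof -
  define Q where "Q = {q. sublin q \<and> (\<forall>x. x \<notin> linf \<longrightarrow> q x = 0) \<and> (\<forall>x\<in>linf. q x \<le> p x)}"
  define P where "P = (\<lambda>q r :: ('a \<Rightarrow> complex) \<Rightarrow> real. \<forall>x. r x \<le> q x)"
  have "\<exists>m\<in>Q. \<forall>a\<in>Q. P m a \<longrightarrow> a = m"
  proof (rule predicate_Zorn)
    show "partial_order_on Q (relation_of P Q)"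
      by (rule partial_order_on_relation_ofI) (auto simp: P_def fun_eq_iff intro: order_antisym order_trans)
    fix C assume C: "C \<in> Chains (relation_of P Q)"
    then have CQ: "C \<subseteq> Q" and chain: "\<And>a b. a \<in> C \<Longrightarrow> b \<in> C \<Longrightarrow> P a b \<or> P b a"
      by (auto simp: Chains_def relation_of_def)
    show "\<exists>u\<in>Q. \<forall>a\<in>C. P a u"
    proof (cases "C = {}")
      case True
      have "(\<lambda>x. if x \<in> linf then p x else 0) \<in> Q"
        using p by (auto simp: Q_def sublin_def linf_zero linf_add(1) linf_cmult(1))
      then show ?thesis
        using True by auto
    next
      case False
      define u where "u x = (INF q\<in>C. q x)" for x
      have Q: "sublin q" "\<And>x. x \<notin> linf \<Longrightarrow> q x = 0" "\<And>x. x \<in> linf \<Longrightarrow> q x \<le> p x" if "q \<in> C" for q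
        using CQ that by (auto simp: Q_def)
      have bdd: "bdd_below ((\<lambda>q. q x) ` C)" for x
      proof (cases "x \<in> linf")
        case True
        have neg: "(\<lambda>s. - x s) \<in> linf"
          using linf_cmult(1)[OF True, of "-1"] by simp
        have "- p (\<lambda>s. - x s) \<le> q x" if "q \<in> C" for q
          using sublin_ge[OF Q(1)[OF that] True] Q(3)[OF that neg] by linarith
        then show ?thesis
          by (intro bdd_belowI2) auto
      qed (auto intro!: bdd_belowI2[of _ 0] simp: Q(2))
      have ule: "u x \<le> q x" if "q \<in> C" for q x
        unfolding u_def by (rule cINF_lower[OF bdd that])
      have uge: "m \<le> u x" if "\<And>q. q \<in> C \<Longrightarrow> m \<le> q x" for m x
        unfolding u_def by (rule cINF_greatest[OF False that])
      obtain q0 where q0: "q0 \<in> C"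
        using False by blast
      have out: "u x = 0" if "\<And>q. q \<in> C \<Longrightarrow> q x = 0" for x
      proof (rule antisym)
        show "u x \<le> 0"
          using ule[OF q0, of x] that[OF q0] by linarith
        show "0 \<le> u x"
          using that by (intro uge) (metis order_refl)
      qed
      have "sublin u"
        unfolding sublin_def
      proof (intro conjI ballI allI impI)
        show "u (\<lambda>_. 0) = 0"
          using Q(1) by (intro out) (auto simp: sublin_def)
      next
        fix x y :: "'a \<Rightarrow> complex" assume xy: "x \<in> linf" "y \<in> linf"
        have *: "u (\<lambda>s. x s + y s) \<le> a x + b y" if "a \<in> C" "b \<in> C" for a b
        proof -
          have le: "u (\<lambda>s. x s + y s) \<le> c x + c y" if "c \<in> C" for c
            using ule[OF that, of "\<lambda>s. x s + y s"] Q(1)[OF that] xy unfolding sublin_def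
            by (meson order_trans)
          \<comment> \<open>Subadditivity of the infimum: of two comparable members the smaller one
            can be used for both summands.\<close>
          have "b x \<le> a x \<or> a y \<le> b y"
            using chain[OF that] by (auto simp: P_def)
          then show ?thesis
            using le[OF that(1)] le[OF that(2)] by linarith
        qed
        have fin: "u (\<lambda>s. x s + y s) - u y \<le> a x" if "a \<in> C" for a
          using uge[of "u (\<lambda>s. x s + y s) - a x" y] *[OF that] by (simp add: algebra_simps)
        have "u (\<lambda>s. x s + y s) - u y \<le> u x"
          by (rule uge) (rule fin)
        then show "u (\<lambda>s. x s + y s) \<le> u x + u y"
          by simp
      next
        fix x :: "'a \<Rightarrow> complex" and t :: real assume x: "x \<in> linf" and t: "t > 0"
        have fin: "u (\<lambda>s. of_real t * x s) / t \<le> q x" if "q \<in> C" for q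
          using ule[OF that, of "\<lambda>s. of_real t * x s"] sublin_scale[OF Q(1)[OF that] x t] t
          by (simp add: field_simps)
        have "u (\<lambda>s. of_real t * x s) / t \<le> u x"
          by (rule uge) (rule fin)
        then show "u (\<lambda>s. of_real t * x s) \<le> t * u x"
          using t by (simp add: field_simps)
      qed
      moreover have "u x \<le> p x" if "x \<in> linf" for x
        using ule[OF q0, of x] Q(3)[OF q0 that] by linarith
      ultimately have "u \<in> Q"
        using out Q(2) by (auto simp: Q_def)
      then show ?thesis
        using ule by (auto simp: P_def)
    qed
  qed
  then obtain m where m: "m \<in> Q" "\<And>a. a \<in> Q \<Longrightarrow> P m a \<Longrightarrow> a = m"
    by blast
  show ?thesis
  proof (rule that[of m])
    fix r assume "sublin r" "\<And>x. x \<notin> linf \<Longrightarrow> r x = 0" "\<And>x. r x \<le> m x"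
    moreover from this have "r \<in> Q"
      using m(1) order_trans by (fastforce simp: Q_def)
    ultimately show "r = m"
      using m(2) by (simp add: P_def)
  qed (use m(1) in \<open>auto simp: Q_def\<close>)
qed

text \<open>Phase correction. A coefficient of norm at most 1 turns a value into its norm, so that a
  sum of norms becomes one value of a linear functional.\<close>

lemma cnj_sgn_mult: "cnj (sgn z) * z = of_real (norm z)"
proof (cases "z = 0")
  case False
  have "z * cnj z = of_real (norm z) * of_real (norm z)"
    using complex_norm_square[of z] by (simp add: power2_eq_square)
  then show ?thesis
    using False by (simp add: sgn_eq field_simps)
qed simp

text \<open>The functional p is the infimal convolution of \<open>R * linf_norm\<close> and of
  \<open>Re \<phi>\<close> on \<open>U\<close>, the largest sublinear functional below both. A
  minimal sublinear q below p is real linear, and it agrees with \<open>Re \<phi>\<close> on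
  \<open>U\<close> because it lies below it at u and at - u.\<close>

theorem hahn_banach_linf:
  assumes U: "lin_closed U" "U \<subseteq> linf" and \<phi>: "lin_on U \<phi>"
    and le: "\<And>x. x \<in> U \<Longrightarrow> norm (\<phi> x) \<le> R * linf_norm x" and R: "R \<ge> 0"
  obtains L where "lin_on linf L" "\<And>x. x \<in> linf \<Longrightarrow> norm (L x) \<le> R * linf_norm x"
    "\<And>x. x \<in> U \<Longrightarrow> L x = \<phi> x"
proof -
  define T where "T u x = R * linf_norm (\<lambda>s. x s - u s) + Re (\<phi> u)" for u x
  define p where "p x = (INF u\<in>U. T u x)" for x
  note U0 = lin_closed_zero[OF U(1)]
  have UL: "u \<in> linf" if "u \<in> U" for u
    using U(2) that by blast
  \<comment> \<open>The bound on \<open>\<phi>\<close> and the triangle inequality keep the infimum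
    finite.\<close>
  have low: "- (R * linf_norm x) \<le> T u x" if "u \<in> U" "x \<in> linf" for u x
  proof -
    have u: "u \<in> linf"
      by (rule UL[OF that(1)])
    have "R * linf_norm u \<le> R * linf_norm x + R * linf_norm (\<lambda>s. x s - u s)"
      using linf_add(2)[OF that(2) linf_cmult(1)[OF linf_diff[OF that(2) u], of "-1"]]
        linf_cmult(2)[OF linf_diff[OF that(2) u], of "-1"] R
      by (simp add: mult_left_mono flip: distrib_left)
    then show ?thesis
      using le[OF that(1)] abs_Re_le_cmod[of "\<phi> u"] by (simp add: T_def)
  qed
  have bdd: "bdd_below ((\<lambda>u. T u x) ` U)" if "x \<in> linf" for x
    by (rule bdd_belowI2, rule low[OF _ that])
  have ple: "p x \<le> T u x" if "x \<in> linf" "u \<in> U" for x u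
    unfolding p_def by (rule cINF_lower[OF bdd[OF that(1)] that(2)])
  have pge: "m \<le> p x" if "\<And>u. u \<in> U \<Longrightarrow> m \<le> T u x" for x m
    unfolding p_def using U0 that by (intro cINF_greatest) auto
  have \<phi>0: "\<phi> (\<lambda>_. 0) = 0"
    by (rule lin_on_zero[OF \<phi> U0])
  have "sublin p"
    unfolding sublin_def
  proof (intro conjI ballI allI impI)
    show "p (\<lambda>_. 0) = 0"
    proof (rule antisym)
      show "p (\<lambda>_. 0) \<le> 0"
        using ple[OF linf_zero(1) U0] by (simp add: T_def \<phi>0 linf_zero)
      show "0 \<le> p (\<lambda>_. 0)"
        using low[OF _ linf_zero(1)] by (intro pge) (simp add: linf_zero)
    qed
  next
    fix x y :: "'a \<Rightarrow> complex" assume xy: "x \<in> linf" "y \<in> linf"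
    have *: "p (\<lambda>s. x s + y s) \<le> T u x + T v y" if "u \<in> U" "v \<in> U" for u v
    proof -
      have eq: "(\<lambda>s. (x s - u s) + (y s - v s)) = (\<lambda>s. (x s + y s) - (u s + v s))"
        by (simp add: algebra_simps)
      have "p (\<lambda>s. x s + y s) \<le> T (\<lambda>s. u s + v s) (\<lambda>s. x s + y s)"
        by (intro ple linf_add xy lin_closed_add U that)
      also have "\<dots> \<le> T u x + T v y"
        using linf_add(2)[OF linf_diff[OF xy(1) UL[OF that(1)]] linf_diff[OF xy(2) UL[OF that(2)]]] R
          lin_on_add[OF \<phi> that]
        by (simp add: T_def eq mult_left_mono flip: distrib_left)
      finally show ?thesis .
    qed
    have "p (\<lambda>s. x s + y s) - p y \<le> T u x" if "u \<in> U" for u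
      using pge[of "p (\<lambda>s. x s + y s) - T u x" y] *[OF that] by (simp add: algebra_simps)
    from pge[OF this] show "p (\<lambda>s. x s + y s) \<le> p x + p y"
      by simp
  next
    fix x :: "'a \<Rightarrow> complex" and t :: real assume x: "x \<in> linf" and t: "t > 0"
    have "p (\<lambda>s. of_real t * x s) / t \<le> T u x" if "u \<in> U" for u
    proof -
      have eq: "(\<lambda>s. of_real t * x s - of_real t * u s) = (\<lambda>s. of_real t * (x s - u s))"
        by (simp add: algebra_simps)
      have "p (\<lambda>s. of_real t * x s) \<le> T (\<lambda>s. of_real t * u s) (\<lambda>s. of_real t * x s)"
        by (intro ple linf_cmult x lin_closed_cmult U that)
      also have "\<dots> = t * T u x"
        using linf_cmult(2)[OF linf_diff[OF x UL[OF that]], of "of_real t"] t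
          lin_on_cmult[OF \<phi> that, of "of_real t"]
        by (simp add: T_def eq distrib_left mult.left_commute)
      finally show ?thesis
        using t by (simp add: field_simps)
    qed
    from pge[OF this] show "p (\<lambda>s. of_real t * x s) \<le> t * p x"
      using t by (simp add: field_simps)
  qed
  then obtain q where q: "sublin q" "\<And>x. x \<notin> linf \<Longrightarrow> q x = 0" "\<And>x. x \<in> linf \<Longrightarrow> q x \<le> p x"
    "\<And>r. sublin r \<Longrightarrow> (\<And>x. x \<notin> linf \<Longrightarrow> r x = 0) \<Longrightarrow> (\<And>x. r x \<le> q x) \<Longrightarrow> r = q"
    by (rule ex_minimal_sublin) blast
  have add: "q (\<lambda>s. x s + y s) = q x + q y" if "x \<in> linf" "y \<in> linf" for x y
    by (rule minimal_sublin_additive[OF q(1,2,4) that])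
  have neg: "q (\<lambda>s. - x s) = - q x" if "x \<in> linf" for x
    using add[OF that linf_cmult(1)[OF that, of "-1"]] q(1) by (simp add: sublin_def)
  have sc: "q (\<lambda>s. of_real t * x s) = t * q x" if "x \<in> linf" for x t
  proof (cases t "0 :: real" rule: linorder_cases)
    case less
    have "q (\<lambda>s. - (of_real (- t) * x s)) = - (- t * q x)"
      using neg[OF linf_cmult(1)[OF that, of "of_real (- t)"]] sublin_scale[OF q(1) that, of "- t"] less
      by simp
    then show ?thesis
      by simp
  qed (use q(1) sublin_scale[OF q(1) that] in \<open>auto simp: sublin_def\<close>)
  have qle: "q x \<le> R * linf_norm x" if "x \<in> linf" for x
    using q(3)[OF that] ple[OF that U0] by (simp add: T_def \<phi>0)
  have qU: "q u = Re (\<phi> u)" if "u \<in> U" for u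
  proof -
    have *: "q u \<le> Re (\<phi> u)" if "u \<in> U" for u
      using q(3)[OF UL[OF that]] ple[OF UL[OF that] that] by (simp add: T_def linf_zero)
    have "- q u \<le> - Re (\<phi> u)"
      using *[OF lin_closed_cmult[OF U(1) that, of "-1"]] neg[OF UL[OF that]]
        lin_on_cmult[OF \<phi> that, of "-1"] by simp
    then show ?thesis
      using *[OF that] by simp
  qed
  \<comment> \<open>The standard complexification: a complex linear functional is determined by its
    real part.\<close>
  define L where "L x = Complex (q x) (- q (\<lambda>s. \<i> * x s))" for x
  have Ladd: "L (\<lambda>s. x s + y s) = L x + L y" if "x \<in> linf" "y \<in> linf" for x y
    using add[OF that] add[OF that[THEN linf_cmult(1), of \<i>]]
    by (simp add: L_def complex_eq_iff distrib_left)
  have Lmult: "L (\<lambda>s. c * x s) = c * L x" if "x \<in> linf" for x c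
  proof -
    have i: "(\<lambda>s. \<i> * x s) \<in> linf"
      by (rule linf_cmult(1)[OF that])
    have eq: "(\<lambda>s. c * x s) = (\<lambda>s. of_real (Re c) * x s + of_real (Im c) * (\<i> * x s))"
      by (simp add: fun_eq_iff complex_eq_iff algebra_simps)
    have eq2: "(\<lambda>s. \<i> * (c * x s)) = (\<lambda>s. of_real (Re c) * (\<i> * x s) + of_real (- Im c) * x s)"
      by (simp add: fun_eq_iff complex_eq_iff algebra_simps)
    have "q (\<lambda>s. c * x s) = Re c * q x + Im c * q (\<lambda>s. \<i> * x s)"
      unfolding eq by (subst add) (simp_all only: sc linf_cmult(1) that i)
    moreover have "q (\<lambda>s. \<i> * (c * x s)) = Re c * q (\<lambda>s. \<i> * x s) + - Im c * q x"
      unfolding eq2 by (subst add) (simp_all only: sc linf_cmult(1) that i)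
    ultimately show ?thesis
      by (simp add: L_def complex_eq_iff)
  qed
  show ?thesis
  proof (rule that[of L])
    show "lin_on linf L"
      by (simp add: lin_on_def Ladd Lmult linf_cmult(1))
    show "norm (L x) \<le> R * linf_norm x" if "x \<in> linf" for x
    proof -
      \<comment> \<open>Rotating x makes the value real and nonnegative, so the bound on the real
        part q bounds the norm of L.\<close>
      define c where "c = cnj (sgn (L x))"
      have "c * L x = of_real (norm (L x))"
        by (simp add: c_def cnj_sgn_mult)
      moreover have "norm c \<le> 1"
        by (simp add: c_def norm_sgn)
      ultimately have "norm (L x) = q (\<lambda>s. c * x s)"
        using Lmult[OF that, of c] by (simp add: L_def complex_eq_iff)
      also have "\<dots> \<le> R * (norm c * linf_norm x)"
        using qle[OF linf_cmult(1)[OF that, of c]] by (simp add: linf_cmult(2)[OF that])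
      also have "\<dots> \<le> R * linf_norm x"
        using \<open>norm c \<le> 1\<close> linf_norm_nonneg[OF that] R by (intro mult_left_mono) (auto intro: mult_left_le_one_le)
      finally show ?thesis .
    qed
    show "L x = \<phi> x" if "x \<in> U" for x
      using qU[OF that] qU[OF lin_closed_cmult[OF U(1) that, of \<i>]] lin_on_cmult[OF \<phi> that, of \<i>]
      by (simp add: L_def complex_eq_iff)
  qed
qed

text \<open>On the span of x and \<open>U\<close> consider the functional sending c x + u to c. The
  hypothesis, scaled by c, says both that it is well defined and that its norm is at most 1; then it
  is extended.\<close>

lemma separate_linf:
  assumes U: "lin_closed U" "U \<subseteq> linf" and x: "x \<in> linf"
    and ge: "\<And>u. u \<in> U \<Longrightarrow> linf_norm (\<lambda>s. x s + u s) \<ge> 1"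
  obtains L where "lin_on linf L" "\<And>x. x \<in> linf \<Longrightarrow> norm (L x) \<le> linf_norm x"
    "\<And>u. u \<in> U \<Longrightarrow> L u = 0" "L x = 1"
proof -
  define W where "W = {(\<lambda>s. c * x s + u s) | c u. u \<in> U}"
  define \<phi> where "\<phi> w = (SOME c. (\<lambda>s. w s - c * x s) \<in> U)" for w
  have ge': "linf_norm (\<lambda>s. c * x s + u s) \<ge> norm c" if "u \<in> U" for c u
  proof (cases "c = 0")
    case True
    then show ?thesis
      using linf_norm_nonneg U(2) that by auto
  next
    case False
    have "u \<in> linf"
      using U(2) that by blast
    then have "(\<lambda>s. x s + inverse c * u s) \<in> linf"
      using linf_lincomb[OF x, of u 1 "inverse c"] by simp
    from linf_cmult(2)[OF this, of c] have "linf_norm (\<lambda>s. c * x s + u s) = norm c * linf_norm (\<lambda>s. x s + inverse c * u s)"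
      using False by (simp add: distrib_left flip: mult.assoc)
    then show ?thesis
      using mult_left_mono[OF ge[OF lin_closed_cmult[OF U(1) that, of "inverse c"]], of "norm c"] by simp
  qed
  have \<phi>: "\<phi> (\<lambda>s. c * x s + u s) = c" if "u \<in> U" for c u
  proof -
    have "d = c" if "(\<lambda>s. c * x s + u s - d * x s) \<in> U" for d
    proof -
      let ?v = "\<lambda>s. - 1 * (c * x s + u s - d * x s) + 1 * u s"
      have "?v \<in> U"
        by (rule lin_closed_lincomb[OF U(1) that \<open>u \<in> U\<close>])
      from ge'[OF this, of "c - d"] have "norm (c - d) \<le> linf_norm (\<lambda>s. (c - d) * x s + ?v s)" .
      moreover have "(\<lambda>s. (c - d) * x s + ?v s) = (\<lambda>_. 0)"
        by (simp add: algebra_simps)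
      ultimately show ?thesis
        by (simp add: linf_zero)
    qed
    moreover have "(\<lambda>s. c * x s + u s - c * x s) \<in> U"
      using that by simp
    ultimately show ?thesis
      unfolding \<phi>_def by (rule some_equality[rotated])
  qed
  have comb: "(\<lambda>s. c * (a * x s + u s) + d * (b * x s + v s)) = (\<lambda>s. (c * a + d * b) * x s + (c * u s + d * v s))"
    for c d a b u v by (simp add: algebra_simps)
  have 1: "lin_closed W"
    unfolding lin_closed_def
  proof (intro conjI ballI allI)
    show "(\<lambda>_. 0) \<in> W"
      unfolding W_def using lin_closed_zero[OF U(1)] by (auto intro!: exI[of _ 0])
    fix w z c d assume "w \<in> W" "z \<in> W"
    then obtain a u b v where "u \<in> U" "v \<in> U" "w = (\<lambda>s. a * x s + u s)" "z = (\<lambda>s. b * x s + v s)"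
      by (auto simp: W_def)
    then have "(\<lambda>s. c * w s + d * z s) = (\<lambda>s. (c * a + d * b) * x s + (c * u s + d * v s))"
      and "(\<lambda>s. c * u s + d * v s) \<in> U"
      using comb[of c a u d b v] lin_closed_lincomb[OF U(1)] by simp_all
    then show "(\<lambda>s. c * w s + d * z s) \<in> W"
      unfolding W_def mem_Collect_eq by (intro exI conjI)
  qed
  have 2: "W \<subseteq> linf"
    using linf_lincomb[OF x, of _ _ 1] U(2) by (auto simp: W_def)
  have 3: "lin_on W \<phi>"
    unfolding lin_on_def W_def
    using \<phi> comb lin_closed_lincomb[OF U(1)] by auto
  have "norm (\<phi> w) \<le> 1 * linf_norm w" if "w \<in> W" for w
    using that ge' \<phi> by (auto simp: W_def)
  from hahn_banach_linf[OF 1 2 3 this] obtain L where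
    L: "lin_on linf L" "\<And>x. x \<in> linf \<Longrightarrow> norm (L x) \<le> 1 * linf_norm x" "\<And>x. x \<in> W \<Longrightarrow> L x = \<phi> x"
    by auto
  show ?thesis
  proof (rule that[OF L(1)])
    show "L u = 0" if "u \<in> U" for u
    proof -
      have "u \<in> W"
        unfolding W_def mem_Collect_eq using that by (intro exI[of _ 0] exI[of _ u]) simp
      then show ?thesis
        using L(3) \<phi>[OF that, of 0] by simp
    qed
    have "x \<in> W"
      using lin_closed_zero[OF U(1)] by (auto simp: W_def intro!: exI[of _ 1] bexI exI[of _ "\<lambda>_. 0"])
    then show "L x = 1"
      using L(3)[of x] \<phi>[OF lin_closed_zero[OF U(1)], of 1] by simp
  qed (use L(2) in auto)
qed

text \<open>The constant function 1 has distance at least 1 from the functions that eventually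
  vanish along \<open>F\<close>, so a functional of norm at most 1 separates them. It ignores what
  happens off the filter and thus plays the part of passing to a convergent subnet.\<close>

lemma generalized_limit:
  assumes F: "F \<noteq> bot"
  obtains L where "lin_on linf L" "\<And>x. x \<in> linf \<Longrightarrow> norm (L x) \<le> linf_norm x"
    "L (\<lambda>_. 1) = 1" "\<And>x r. x \<in> linf \<Longrightarrow> eventually (\<lambda>i. norm (x i) \<le> r) F \<Longrightarrow> norm (L x) \<le> r"
proof -
  define U where "U = {x \<in> linf. eventually (\<lambda>i. x i = 0) F}"
  have U: "lin_closed U" "U \<subseteq> linf"
    by (auto simp: U_def lin_closed_def linf_zero linf_lincomb elim: eventually_elim2)
  have "linf_norm (\<lambda>i. 1 + u i) \<ge> 1" if u: "u \<in> U" for u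
  proof -
    have "(\<lambda>i. 1 + u i) \<in> linf"
      using u linf_add(1)[OF linfI[of "\<lambda>_. 1" 1]] by (auto simp: U_def)
    moreover obtain i where "u i = 0"
      using u eventually_happens'[OF F, of "\<lambda>i. u i = 0"] by (auto simp: U_def)
    ultimately show ?thesis
      using linf_norm_ge[of "\<lambda>i. 1 + u i" i] by simp
  qed
  note ge = this
  show ?thesis
  proof (rule separate_linf[OF U _ ge])
    show "(\<lambda>_. 1) \<in> linf"
      by (rule linfI[of _ 1]) simp
    fix L :: "('a \<Rightarrow> complex) \<Rightarrow> complex"
    assume L: "lin_on linf L" "\<And>x. x \<in> linf \<Longrightarrow> norm (L x) \<le> linf_norm x" "\<And>u. u \<in> U \<Longrightarrow> L u = 0"
      "L (\<lambda>_. 1) = 1"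
    show ?thesis
    proof (rule that[OF L(1,2,4)])
      fix x r assume x: "x \<in> linf" and ev: "eventually (\<lambda>i. norm (x i) \<le> r) F"
      obtain i where "norm (x i) \<le> r"
        using eventually_happens'[OF F ev] by blast
      then have "r \<ge> 0"
        using norm_ge_zero[of "x i"] by linarith
      \<comment> \<open>\<open>y\<close> agrees with \<open>x\<close> eventually, and unlike
        \<open>x\<close> it is bounded by \<open>r\<close> everywhere.\<close>
      define y where "y i = (if norm (x i) \<le> r then x i else 0)" for i
      have y: "norm (y i) \<le> r" for i
        using \<open>r \<ge> 0\<close> by (simp add: y_def)
      then have yl: "y \<in> linf"
        by (rule linfI)
      have "(\<lambda>i. x i - y i) \<in> U"
        using linf_diff[OF x yl] ev by (auto simp: U_def y_def elim: eventually_mono)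
      then have "L x = L y"
        using L(3) lin_on_diff[OF L(1) x yl] by simp
      also have "norm \<dots> \<le> r"
        using L(2)[OF yl] linf_norm_le[of y r, OF y] by linarith
      finally show "norm (L x) \<le> r" .
    qed
  qed
qed

text \<open>The restriction of \<open>L\<close> to the functions vanishing at infinity is given by
  an element of \<open>l1\<close>. Summability follows by testing \<open>L\<close> on finite
  combinations with corrected phases, and finite truncations approximate such functions uniformly.
  Off this subspace \<open>L\<close> can be different, hence the condition in the last part.\<close>

lemma c0_functional:
  assumes L: "lin_on linf L" "\<And>x. x \<in> linf \<Longrightarrow> norm (L x) \<le> linf_norm x"
  shows "(\<lambda>i. L (delta i)) \<in> l1" "l1_norm (\<lambda>i. L (delta i)) \<le> 1"
    and "x \<in> linf \<Longrightarrow> (\<And>e. e > 0 \<Longrightarrow> finite {i. norm (x i) > e}) \<Longrightarrow> L x = pairing x (\<lambda>i. L (delta i))"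
proof -
  have sum: "(\<lambda>j. \<Sum>i\<in>A. c i * delta i j) = (\<lambda>j. if j \<in> A then c j else 0)" if "finite A" for A and c :: "'a \<Rightarrow> complex"
    using that by (auto simp: fun_eq_iff delta_def if_distrib[of "\<lambda>x. _ * x"] cong: if_cong)
  have Lsum: "L (\<lambda>j. if j \<in> A then c j else 0) = (\<Sum>i\<in>A. c i * L (delta i))" if "finite A" for A c
    using lin_sum(2)[OF lin_closed_linf that _ L(1), where f=delta and c=c] by (simp add: sum[OF that] delta_linf)
  have *: "(\<Sum>i\<in>A. norm (L (delta i))) \<le> 1" if A: "finite A" for A
  proof -
    let ?y = "\<lambda>j. if j \<in> A then cnj (sgn (L (delta j))) else 0"
    have y: "norm (?y j) \<le> 1" for j
      by (simp add: norm_sgn)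
    have "L ?y = of_real (\<Sum>i\<in>A. norm (L (delta i)))"
      by (simp add: Lsum[OF A] cnj_sgn_mult)
    moreover have "norm (L ?y) \<le> 1"
      using L(2)[OF linfI[of ?y, OF y]] linf_norm_le[of ?y, OF y] by linarith
    ultimately show ?thesis
      by (simp add: sum_nonneg flip: of_real_sum)
  qed
  show l1: "(\<lambda>i. L (delta i)) \<in> l1" "l1_norm (\<lambda>i. L (delta i)) \<le> 1"
    by (rule l1I[OF *]; assumption)+
  assume x: "x \<in> linf" and c0: "\<And>e. e > 0 \<Longrightarrow> finite {i. norm (x i) > e}"
  let ?\<alpha> = "\<lambda>i. L (delta i)"
  have "norm (L x - pairing x ?\<alpha>) \<le> e" if e: "e > 0" for e
  proof -
    define A where "A = {i. norm (x i) > e / 2}"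
    have A: "finite A"
      using c0[of "e / 2"] e by (simp add: A_def)
    let ?y = "\<lambda>j. if j \<in> A then x j else 0"
    have y: "?y \<in> linf"
      using linf_norm_ge[OF x] linf_norm_nonneg[OF x] by (intro linfI[of _ "linf_norm x"]) auto
    have d: "norm (x j - ?y j) \<le> e / 2" for j
      using e by (auto simp: A_def)
    have "pairing ?y ?\<alpha> = (\<Sum>i\<in>A. x i * ?\<alpha> i)"
      unfolding pairing_def by (rule infsumI, rule has_sum_finite_neutralI[OF A]) auto
    then have eq: "L x - pairing x ?\<alpha> = L (\<lambda>j. x j - ?y j) - pairing (\<lambda>j. x j - ?y j) ?\<alpha>"
      unfolding lin_on_diff[OF L(1) x y] pairing_diff_left[OF x y l1(1)] by (simp add: Lsum[OF A])
    have "norm (L (\<lambda>j. x j - ?y j)) \<le> e / 2"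
      using L(2)[OF linf_diff[OF x y]] linf_norm_le[of "\<lambda>j. x j - ?y j", OF d] by linarith
    moreover have "norm (pairing (\<lambda>j. x j - ?y j) ?\<alpha>) \<le> e / 2"
      using pairing_bound'[of "\<lambda>j. x j - ?y j", OF d l1(1)] mult_left_mono[OF l1(2), of "e / 2"] e by linarith
    ultimately show ?thesis
      unfolding eq by (rule order_trans[OF norm_triangle_ineq4 order_trans[OF add_mono]]) simp
  qed
  then have "norm (L x - pairing x ?\<alpha>) \<le> 0"
    by (rule field_le_epsilon) simp
  then show "L x = pairing x ?\<alpha>"
    by simp
qed

section \<open>The dual of the continuous functions on a countable compact space\<close>

text \<open>The sets \<open>nb s n\<close> form a decreasing base of clopen neighbourhoods of \<open>s\<close> in a countable compact
  Hausdorff space, and \<open>cfun\<close> below is the space of continuous functions on it.\<close>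
locale clopen_base =
  fixes nb :: "'a::countable \<Rightarrow> nat \<Rightarrow> 'a set"
  assumes nb_self: "s \<in> nb s n"
    and nb_antimono: "m \<le> n \<Longrightarrow> nb s n \<subseteq> nb s m"
    and nb_open: "t \<in> nb s n \<Longrightarrow> \<exists>m. nb t m \<subseteq> nb s n"
    and nb_closed: "t \<notin> nb s n \<Longrightarrow> \<exists>m. nb t m \<inter> nb s n = {}"
    and nb_separate: "s \<noteq> t \<Longrightarrow> \<exists>n. t \<notin> nb s n"
    and nb_compact: "\<exists>A. finite A \<and> (\<Union>s\<in>A. nb s (N s)) = UNIV"
begin

definition cfun :: "('a \<Rightarrow> complex) set" where
  "cfun = {f. \<forall>s. \<forall>e>0. \<exists>n. \<forall>t\<in>nb s n. norm (f t - f s) < e}"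

definition clopen :: "'a set \<Rightarrow> bool" where
  "clopen V \<longleftrightarrow> (\<forall>s. \<exists>n. nb s n \<subseteq> V \<or> nb s n \<inter> V = {})"

lemma clopen_nb: "clopen (nb s n)"
  unfolding clopen_def using nb_open nb_closed by meson

lemma clopen_Compl: "clopen V \<Longrightarrow> clopen (- V)"
  unfolding clopen_def by (metis disjoint_eq_subset_Compl double_compl)

lemma clopen_Int:
  assumes "clopen V" "clopen W"
  shows "clopen (V \<inter> W)"
  unfolding clopen_def
proof
  fix s
  obtain m n where "nb s m \<subseteq> V \<or> nb s m \<inter> V = {}" "nb s n \<subseteq> W \<or> nb s n \<inter> W = {}"
    using assms by (meson clopen_def)
  moreover have "nb s (max m n) \<subseteq> nb s m" "nb s (max m n) \<subseteq> nb s n"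
    by (simp_all add: nb_antimono)
  ultimately have "nb s (max m n) \<subseteq> V \<inter> W \<or> nb s (max m n) \<inter> (V \<inter> W) = {}"
    by blast
  then show "\<exists>n. nb s n \<subseteq> V \<inter> W \<or> nb s n \<inter> (V \<inter> W) = {}" ..
qed

lemma clopen_Diff: "clopen V \<Longrightarrow> clopen W \<Longrightarrow> clopen (V - W)"
  by (simp add: Diff_eq clopen_Int clopen_Compl)

definition cut :: "'a set \<Rightarrow> ('a \<Rightarrow> complex) \<Rightarrow> 'a \<Rightarrow> complex" where
  "cut V f = (\<lambda>s. if s \<in> V then f s else 0)"

lemma cfunD: "f \<in> cfun \<Longrightarrow> e > 0 \<Longrightarrow> \<exists>n. \<forall>t\<in>nb s n. norm (f t - f s) < e"
  by (simp add: cfun_def)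

lemma cfun_cut:
  assumes f: "f \<in> cfun" and V: "clopen V"
  shows "cut V f \<in> cfun"
  unfolding cfun_def
proof (intro CollectI allI impI)
  fix s and e :: real assume e: "e > 0"
  obtain m where m: "\<forall>t\<in>nb s m. norm (f t - f s) < e"
    using cfunD[OF f e] by blast
  obtain n where n: "nb s n \<subseteq> V \<or> nb s n \<inter> V = {}"
    using V by (meson clopen_def)
  have "\<forall>t\<in>nb s (max m n). norm (cut V f t - cut V f s) < e"
    using m n nb_antimono[of m "max m n" s] nb_antimono[of n "max m n" s] nb_self[of s n] e
    unfolding cut_def by (auto simp: subset_iff disjoint_iff)
  then show "\<exists>n. \<forall>t\<in>nb s n. norm (cut V f t - cut V f s) < e" ..
qed

lemma cfun_const: "(\<lambda>_. c) \<in> cfun"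
  by (simp add: cfun_def)

lemma cfun_approx:
  assumes "\<And>e. e > 0 \<Longrightarrow> \<exists>g\<in>cfun. \<forall>s. norm (f s - g s) \<le> e"
  shows "f \<in> cfun"
  unfolding cfun_def
proof (intro CollectI allI impI)
  fix s and e :: real assume e: "e > 0"
  obtain g where g: "g \<in> cfun" "\<And>s. norm (f s - g s) \<le> e / 4"
    using assms[of "e / 4"] e by auto
  obtain n where n: "\<forall>t\<in>nb s n. norm (g t - g s) < e / 4"
    using cfunD[OF g(1), of "e / 4" s] e by auto
  have "norm (f t - f s) < e" if "t \<in> nb s n" for t
  proof -
    have "norm (f t - f s) = norm ((f t - g t) + (g t - g s) - (f s - g s))"
      by simp
    also have "\<dots> \<le> norm (f t - g t) + norm (g t - g s) + norm (f s - g s)"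
      by (meson add_mono norm_triangle_ineq norm_triangle_ineq4 order_refl order_trans)
    finally show ?thesis
      using g(2)[of t] g(2)[of s] n that e by fastforce
  qed
  then show "\<exists>n. \<forall>t\<in>nb s n. norm (f t - f s) < e" by blast
qed

lemma cfun_lincomb:
  assumes f: "f \<in> cfun" and g: "g \<in> cfun"
  shows "(\<lambda>s. c * f s + d * g s) \<in> cfun"
  unfolding cfun_def
proof (intro CollectI allI impI)
  fix s and e :: real assume e: "e > 0"
  let ?M = "norm c + norm d + 1"
  have M: "?M > 0"
    using norm_ge_zero[of c] norm_ge_zero[of d] by linarith
  define k where "k = e / ?M"
  have k: "k > 0" "?M * k = e"
    using e M by (auto simp: k_def)
  obtain m n where mn: "\<forall>t\<in>nb s m. norm (f t - f s) < k" "\<forall>t\<in>nb s n. norm (g t - g s) < k"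
    using cfunD[OF f, of k s] cfunD[OF g, of k s] k by auto
  have "norm (c * f t + d * g t - (c * f s + d * g s)) < e" if "t \<in> nb s (max m n)" for t
  proof -
    have t: "norm (f t - f s) < k" "norm (g t - g s) < k"
      using that mn nb_antimono[of m "max m n" s] nb_antimono[of n "max m n" s] by auto
    have "norm (c * f t + d * g t - (c * f s + d * g s)) = norm (c * (f t - f s) + d * (g t - g s))"
      by (simp add: algebra_simps)
    also have "\<dots> \<le> norm c * norm (f t - f s) + norm d * norm (g t - g s)"
      using norm_triangle_ineq[of "c * (f t - f s)" "d * (g t - g s)"] by (simp add: norm_mult)
    also have "\<dots> \<le> norm c * k + norm d * k"
      using t by (intro add_mono mult_left_mono) auto
    also have "\<dots> < ?M * k"
      using k(1) by (simp add: distrib_right)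
    also have "\<dots> = e"
      by (rule k(2))
    finally show ?thesis .
  qed
  then show "\<exists>n. \<forall>t\<in>nb s n. norm (c * f t + d * g t - (c * f s + d * g s)) < e" by blast
qed

lemma lin_closed_cfun: "lin_closed cfun"
  by (auto simp: lin_closed_def cfun_const cfun_lincomb)

lemma cfun_subset_linf: "cfun \<subseteq> linf"
proof
  fix f assume f: "f \<in> cfun"
  obtain N where N: "\<And>s. \<forall>t\<in>nb s (N s). norm (f t - f s) < 1"
    using cfunD[OF f, of 1] by (metis zero_less_one)
  obtain A where A: "finite A" "(\<Union>s\<in>A. nb s (N s)) = UNIV"
    using nb_compact[of N] by blast
  have "norm (f t) \<le> (\<Sum>s\<in>A. norm (f s)) + 1" for t
  proof -
    obtain s where s: "s \<in> A" "t \<in> nb s (N s)"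
      using A(2) by blast
    have "norm (f t) \<le> norm (f s) + norm (f t - f s)"
      by (rule norm_triangle_sub)
    also have "norm (f s) \<le> (\<Sum>s\<in>A. norm (f s))"
      by (rule member_le_sum) (use A s in auto)
    finally show ?thesis
      using N[of s] s(2) by fastforce
  qed
  then show "f \<in> linf"
    by (rule linfI)
qed

lemma cfun_linf: "f \<in> cfun \<Longrightarrow> f \<in> linf"
  using cfun_subset_linf by blast

definition ind :: "'a set \<Rightarrow> 'a \<Rightarrow> complex" where
  "ind V = (\<lambda>s. if s \<in> V then 1 else 0)"

lemma cfun_ind: "clopen V \<Longrightarrow> ind V \<in> cfun"
  using cfun_cut[OF cfun_const, of V 1] by (simp add: cut_def ind_def)

text \<open>The finite partial sums converge uniformly, since the tail of \<open>a\<close> is small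
  in norm and the functions have a common bound. It serves for averages of translates and again for
  the separating function in the Krein-Smulian theorem.\<close>

lemma cfun_average:
  assumes h: "\<And>m. h m \<in> cfun" and B: "\<And>m s. norm (h m s) \<le> B" and a: "a \<in> l1"
  shows "(\<lambda>s. pairing (\<lambda>m. h m s) a) \<in> cfun"
proof (rule cfun_approx)
  fix e :: real assume e: "e > 0"
  have B0: "B \<ge> 0"
    using B norm_ge_zero order_trans by blast
  then have "e / (B + 1) > 0"
    using e by simp
  then obtain A where A: "finite A" "l1_norm (\<lambda>m. if m \<in> A then 0 else a m) \<le> e / (B + 1)"
    by (rule l1_tail[OF a])
  let ?g = "\<lambda>s. \<Sum>m\<in>A. a m * h m s" and ?t = "\<lambda>m. if m \<in> A then 0 else a m"
  have t: "?t \<in> l1"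
    by (rule l1_dominated[OF a]) auto
  have "norm (pairing (\<lambda>m. h m s) a - ?g s) \<le> e" for s
  proof -
    have hs: "(\<lambda>m. h m s) \<in> linf"
      by (rule linfI[OF B])
    have d: "(\<lambda>m. a m - ?t m) \<in> l1"
      by (rule l1_diff[OF a t])
    have "pairing (\<lambda>m. h m s) (\<lambda>m. a m - ?t m) = ?g s"
      unfolding pairing_def by (rule infsumI, rule has_sum_finite_neutralI[OF A(1)]) (auto simp: mult.commute)
    then have "pairing (\<lambda>m. h m s) a - ?g s = pairing (\<lambda>m. h m s) ?t"
      using pairing_diff_right[OF hs a t] by (simp add: algebra_simps)
    also have "norm \<dots> \<le> B * (e / (B + 1))"
      using pairing_bound'[of "\<lambda>m. h m s" B, OF B t] A(2) B0 mult_left_mono order_trans by blast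
    also have "\<dots> \<le> e"
      using B0 e by (simp add: field_simps)
    finally show ?thesis .
  qed
  then show "\<exists>g\<in>cfun. \<forall>s. norm (pairing (\<lambda>m. h m s) a - g s) \<le> e"
    by (intro bexI[of _ ?g] allI lin_sum(1)[OF lin_closed_cfun A(1)] h)
qed

text \<open>No sign is imposed on \<open>R\<close>, which is why the consequences are stated with
  its absolute value.\<close>

definition bounded_functional :: "real \<Rightarrow> (('a \<Rightarrow> complex) \<Rightarrow> complex) \<Rightarrow> bool" where
  "bounded_functional R \<phi> \<longleftrightarrow> lin_on cfun \<phi> \<and> (\<forall>f\<in>cfun. norm (\<phi> f) \<le> R * linf_norm f)"

lemma bounded_functionalD:
  assumes "bounded_functional R \<phi>"
  shows "lin_on cfun \<phi>" "f \<in> cfun \<Longrightarrow> (\<And>s. norm (f s) \<le> B) \<Longrightarrow> norm (\<phi> f) \<le> \<bar>R\<bar> * B"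
proof -
  show "lin_on cfun \<phi>"
    using assms by (simp add: bounded_functional_def)
  assume f: "f \<in> cfun" "\<And>s. norm (f s) \<le> B"
  have "R * linf_norm f \<le> \<bar>R\<bar> * B"
    using linf_norm_le[of f B, OF f(2)] linf_norm_nonneg[OF cfun_linf[OF f(1)]]
    by (intro mult_mono) auto
  then show "norm (\<phi> f) \<le> \<bar>R\<bar> * B"
    using assms f(1) by (fastforce simp: bounded_functional_def)
qed

text \<open>Functions with disjoint supports, multiplied by suitable phases, add up to one function
  of norm at most 1. This is the bound by the total variation.\<close>

lemma functional_disjoint:
  assumes \<phi>: "bounded_functional R \<phi>" and I: "finite I"
    and f: "\<And>i. i \<in> I \<Longrightarrow> f i \<in> cfun" "\<And>i s. i \<in> I \<Longrightarrow> norm (f i s) \<le> 1"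
    and disj: "\<And>i j s. i \<in> I \<Longrightarrow> j \<in> I \<Longrightarrow> i \<noteq> j \<Longrightarrow> f i s = 0 \<or> f j s = 0"
  shows "(\<Sum>i\<in>I. norm (\<phi> (f i))) \<le> \<bar>R\<bar>"
proof -
  define c where "c i = cnj (sgn (\<phi> (f i)))" for i
  let ?g = "\<lambda>s. \<Sum>i\<in>I. c i * f i s"
  have c: "norm (c i) \<le> 1" for i
    by (simp add: c_def norm_sgn)
  have g: "?g \<in> cfun" "\<phi> ?g = (\<Sum>i\<in>I. c i * \<phi> (f i))"
    using lin_sum(1)[OF lin_closed_cfun I, where f=f and c=c]
      lin_sum(2)[OF lin_closed_cfun I, where f=f and c=c and \<phi>=\<phi>] f(1) bounded_functionalD(1)[OF \<phi>]
    by auto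
  have "norm (?g s) \<le> 1" for s
  proof (cases "\<exists>i\<in>I. f i s \<noteq> 0")
    case True
    then obtain i where i: "i \<in> I" "f i s \<noteq> 0"
      by blast
    have "?g s = (\<Sum>j\<in>{i}. c j * f j s)"
      by (rule sum.mono_neutral_right) (use I i disj in auto)
    then show ?thesis
      using c[of i] f(2)[OF i(1), of s] mult_mono[OF c[of i] f(2)[OF i(1), of s]] by (simp add: norm_mult)
  qed simp
  then have "norm (\<phi> ?g) \<le> \<bar>R\<bar> * 1"
    by (rule bounded_functionalD(2)[OF \<phi> g(1)])
  moreover have "\<phi> ?g = of_real (\<Sum>i\<in>I. norm (\<phi> (f i)))"
    unfolding g(2) by (simp add: c_def cnj_sgn_mult)
  ultimately show ?thesis
    by (simp add: sum_nonneg flip: of_real_sum)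
qed

text \<open>The differences of successive neighbourhoods are disjoint, so the increments of the
  sequence are absolutely summable. The limit is the mass that the functional puts on the point
  s.\<close>

lemma functional_ind_convergent:
  assumes \<phi>: "bounded_functional R \<phi>"
  shows "convergent (\<lambda>n. \<phi> (ind (nb s n)))"
proof -
  define d where "d n = ind (nb s n - nb s (Suc n))" for n
  have d: "d n \<in> cfun" for n
    by (simp add: d_def cfun_ind clopen_Diff clopen_nb)
  have eq: "\<phi> (d n) = \<phi> (ind (nb s n)) - \<phi> (ind (nb s (Suc n)))" for n
  proof -
    have "d n = (\<lambda>t. ind (nb s n) t - ind (nb s (Suc n)) t)"
      using nb_antimono[of n "Suc n" s] by (auto simp: d_def ind_def fun_eq_iff)
    then show ?thesis
      using lin_on_diff[OF bounded_functionalD(1)[OF \<phi>]] by (simp add: cfun_ind clopen_nb)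
  qed
  have "(\<Sum>n<N. norm (\<phi> (d n))) \<le> \<bar>R\<bar>" for N
  proof (rule functional_disjoint[OF \<phi>])
    fix i j :: nat and t assume "i \<noteq> j"
    then show "d i t = 0 \<or> d j t = 0"
      using nb_antimono[of "Suc i" j s] nb_antimono[of "Suc j" i s]
      by (cases "i < j") (auto simp: d_def ind_def)
  qed (auto simp: d, simp add: d_def ind_def)
  then have "summable (\<lambda>n. norm (\<phi> (d n)))"
    by (intro summableI_nonneg_bounded) auto
  then have "summable (\<lambda>n. \<phi> (d n))"
    by (rule summable_norm_cancel)
  then have "convergent (\<lambda>n. \<Sum>i<n. \<phi> (d i))"
    by (simp add: summable_iff_convergent)
  moreover have "(\<Sum>i<n. \<phi> (d i)) = \<phi> (ind (nb s 0)) - \<phi> (ind (nb s n))" for n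
    by (induction n) (auto simp: eq)
  ultimately have "convergent (\<lambda>n. \<phi> (ind (nb s 0)) - \<phi> (ind (nb s n)))"
    by simp
  from convergent_diff[OF convergent_const[of "\<phi> (ind (nb s 0))"] this] show ?thesis
    by simp
qed

lemma disjoint_nbs:
  assumes "finite A"
  obtains N where "\<And>n s t. n \<ge> N \<Longrightarrow> s \<in> A \<Longrightarrow> t \<in> A \<Longrightarrow> s \<noteq> t \<Longrightarrow> nb s n \<inter> nb t n = {}"
proof -
  have "\<exists>k. s \<noteq> t \<longrightarrow> (\<forall>n\<ge>k. nb s n \<inter> nb t n = {})" for s t
  proof (cases "s = t")
    case False
    then obtain m where "t \<notin> nb s m"
      using nb_separate by blast
    then obtain l where "nb t l \<inter> nb s m = {}"
      using nb_closed by blast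
    then have "nb s n \<inter> nb t n = {}" if "n \<ge> max m l" for n
      using nb_antimono[of m n s] nb_antimono[of l n t] that by auto
    then show ?thesis by blast
  qed simp
  then obtain k where k: "\<And>s t n. s \<noteq> t \<Longrightarrow> n \<ge> k s t \<Longrightarrow> nb s n \<inter> nb t n = {}"
    by metis
  have "k s t \<le> Max (case_prod k ` (A \<times> A))" if "s \<in> A" "t \<in> A" for s t
    by (rule Max_ge) (use assms that in auto)
  then show ?thesis
    using that[of "Max (case_prod k ` (A \<times> A))"] k order_trans by meson
qed

text \<open>Small neighbourhoods of finitely many points are disjoint, so any finite sum of masses
  is a limit of sums bounded by the total variation.\<close>

lemma l1_of_functional:
  assumes \<phi>: "bounded_functional R \<phi>" and lim: "\<And>s. (\<lambda>n. \<phi> (ind (nb s n))) \<longlonglongrightarrow> \<mu> s"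
  shows "\<mu> \<in> l1" "l1_norm \<mu> \<le> \<bar>R\<bar>"
proof -
  have *: "(\<Sum>s\<in>A. norm (\<mu> s)) \<le> \<bar>R\<bar>" if A: "finite A" for A
  proof -
    obtain N where N: "\<And>n s t. n \<ge> N \<Longrightarrow> s \<in> A \<Longrightarrow> t \<in> A \<Longrightarrow> s \<noteq> t \<Longrightarrow> nb s n \<inter> nb t n = {}"
      using disjoint_nbs[OF A] by blast
    have "(\<lambda>n. \<Sum>s\<in>A. norm (\<phi> (ind (nb s n)))) \<longlonglongrightarrow> (\<Sum>s\<in>A. norm (\<mu> s))"
      by (intro tendsto_sum tendsto_norm lim)
    moreover have "(\<Sum>s\<in>A. norm (\<phi> (ind (nb s n)))) \<le> \<bar>R\<bar>" if "n \<ge> N" for n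
    proof (rule functional_disjoint[OF \<phi> A])
      fix s t u assume "s \<in> A" "t \<in> A" "s \<noteq> t"
      then show "ind (nb s n) u = 0 \<or> ind (nb t n) u = 0"
        using N[OF that, of s t] by (auto simp: ind_def)
    qed (auto simp: cfun_ind clopen_nb, simp add: ind_def)
    ultimately show ?thesis
      by (intro LIMSEQ_le_const2) auto
  qed
  show "\<mu> \<in> l1" "l1_norm \<mu> \<le> \<bar>R\<bar>"
    by (rule l1I[OF *]; assumption)+
qed

lemma pairing_ind_nb_tendsto:
  assumes \<mu>: "\<mu> \<in> l1"
  shows "(\<lambda>n. pairing (ind (nb s n)) \<mu>) \<longlonglongrightarrow> \<mu> s"
proof (rule LIMSEQ_I)
  fix e :: real assume e: "e > 0"
  then have "e / 2 > 0"
    by simp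
  then obtain A where A: "finite A" "l1_norm (\<lambda>s. if s \<in> A then 0 else \<mu> s) \<le> e / 2"
    by (rule l1_tail[OF \<mu>])
  obtain N where N: "\<And>n s' t. n \<ge> N \<Longrightarrow> s' \<in> insert s A \<Longrightarrow> t \<in> insert s A \<Longrightarrow> s' \<noteq> t \<Longrightarrow> nb s' n \<inter> nb t n = {}"
    using disjoint_nbs[of "insert s A"] A(1) by blast
  have "norm (pairing (ind (nb s n)) \<mu> - \<mu> s) < e" if n: "n \<ge> N" for n
  proof -
    let ?f = "\<lambda>t. ind (nb s n) t - delta s t" and ?t = "\<lambda>t. if t \<in> A then 0 else \<mu> t"
    have t: "?t \<in> l1"
      by (rule l1_dominated[OF \<mu>]) auto
    have i: "ind (nb s n) \<in> linf"
      by (rule linfI[of _ 1]) (simp add: ind_def)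
    \<comment> \<open>\<open>?f\<close> vanishes on all of \<open>A\<close>: at s its two terms
      cancel, and the other points of \<open>A\<close> lie outside the neighbourhood. Only the small
      tail of \<open>\<mu>\<close> remains.\<close>
    have eq: "?f t * \<mu> t = ?f t * ?t t" for t
    proof (cases "t \<in> A \<and> t \<noteq> s")
      case True
      then have "t \<notin> nb s n"
        using N[OF n, of s t] nb_self[of t n] by auto
      then show ?thesis
        using True by (simp add: ind_def delta_def)
    qed (auto simp: ind_def delta_def nb_self)
    have "pairing ?f \<mu> = pairing ?f ?t"
      unfolding pairing_def by (rule infsum_cong) (rule eq)
    moreover have "norm (?f t) \<le> 1" for t
      by (simp add: ind_def delta_def nb_self)
    ultimately have "norm (pairing ?f \<mu>) \<le> 1 * l1_norm ?t"
      using pairing_bound'[of ?f 1 ?t] t by simp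
    moreover have "pairing ?f \<mu> = pairing (ind (nb s n)) \<mu> - \<mu> s"
      using pairing_diff_left[OF i delta_linf \<mu>, of s] by (simp add: pairing_delta_left)
    ultimately show ?thesis
      using A(2) e by simp
  qed
  then show "\<exists>N. \<forall>n\<ge>N. norm (pairing (ind (nb s n)) \<mu> - \<mu> s) < e" by blast
qed

text \<open>Otherwise there would be infinitely many functions with disjoint supports on which
  \<open>\<psi>\<close> is bounded away from \<open>0\<close>.\<close>
lemma small_variation:
  assumes \<psi>: "bounded_functional R \<psi>" and lim: "(\<lambda>n. \<psi> (ind (nb s n))) \<longlonglongrightarrow> 0" and c: "c > 0"
  shows "\<exists>n. \<forall>g\<in>cfun. (\<forall>t. norm (g t) \<le> 1) \<longrightarrow> (\<forall>t. t \<notin> nb s n \<longrightarrow> g t = 0) \<longrightarrow> norm (\<psi> g) \<le> c"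
proof (rule ccontr)
  assume "\<not> ?thesis"
  then have "\<exists>g\<in>cfun. (\<forall>t. norm (g t) \<le> 1) \<and> (\<forall>t. t \<notin> nb s n \<longrightarrow> g t = 0) \<and> norm (\<psi> g) > c" for n
    by (meson not_le)
  then obtain g where g: "\<And>n. g n \<in> cfun" "\<And>n t. norm (g n t) \<le> 1" "\<And>n t. t \<notin> nb s n \<Longrightarrow> g n t = 0"
    "\<And>n. norm (\<psi> (g n)) > c"
    by metis
  note lin = bounded_functionalD(1)[OF \<psi>]
  \<comment> \<open>Near s the function \<open>g n\<close> is almost constant, so on a small
    neighbourhood \<open>\<psi>\<close> sees a multiple of an indicator plus a small error, and the
    values on indicators tend to 0. Cutting such a neighbourhood out preserves more than half of the
    bound c.\<close>
  have "\<exists>m\<ge>n. norm (\<psi> (cut (nb s m) (g n))) < c / 2" for n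
  proof -
    define e where "e = c / (4 * \<bar>R\<bar> + 4)"
    have e: "e > 0" "\<bar>R\<bar> * e \<le> c / 4"
      using c by (auto simp: e_def field_simps)
    obtain k where k: "\<forall>t\<in>nb s k. norm (g n t - g n s) < e"
      using cfunD[OF g(1) e(1)] by blast
    obtain l where l: "\<And>m. m \<ge> l \<Longrightarrow> norm (\<psi> (ind (nb s m))) < c / 4"
      using LIMSEQ_D[OF lim, of "c / 4"] c by auto
    define m where "m = max n (max k l)"
    let ?d = "\<lambda>t. cut (nb s m) (g n) t - g n s * ind (nb s m) t"
    have i: "ind (nb s m) \<in> cfun" "cut (nb s m) (g n) \<in> cfun"
      by (simp_all add: cfun_ind cfun_cut clopen_nb g(1))
    have "norm (?d t) \<le> e" for t
      using k nb_antimono[of k m s] e(1) by (force simp: cut_def ind_def m_def)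
    moreover have "?d \<in> cfun"
      using cfun_lincomb[OF i(2) i(1), of 1 "- g n s"] by simp
    ultimately have "norm (\<psi> ?d) \<le> \<bar>R\<bar> * e"
      using bounded_functionalD(2)[OF \<psi>] by blast
    moreover have "\<psi> ?d = \<psi> (cut (nb s m) (g n)) - g n s * \<psi> (ind (nb s m))"
      using lin_onD[OF lin i(2) i(1), of 1 "- g n s"] by simp
    then have "norm (\<psi> (cut (nb s m) (g n))) \<le> norm (g n s * \<psi> (ind (nb s m))) + norm (\<psi> ?d)"
      using norm_triangle_sub[of "\<psi> (cut (nb s m) (g n))" "g n s * \<psi> (ind (nb s m))"] by simp
    moreover have "norm (g n s * \<psi> (ind (nb s m))) \<le> 1 * norm (\<psi> (ind (nb s m)))"
      unfolding norm_mult by (intro mult_right_mono g(2)) auto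
    moreover have "norm (\<psi> (ind (nb s m))) < c / 4"
      by (rule l) (simp add: m_def)
    ultimately have "norm (\<psi> (cut (nb s m) (g n))) < c / 2"
      using e(2) by linarith
    then show ?thesis
      by (auto simp: m_def intro!: exI[of _ m])
  qed
  then obtain m where m: "\<And>n. m n \<ge> n" "\<And>n. norm (\<psi> (cut (nb s (m n)) (g n))) < c / 2"
    by metis
  define h where "h n = cut (- nb s (m n)) (g n)" for n
  have h: "h n \<in> cfun" "norm (h n t) \<le> 1" for n t
    using g(2)[of n t] by (auto simp: h_def cfun_cut clopen_Compl clopen_nb g(1), simp add: cut_def)
  have hc: "norm (\<psi> (h n)) > c / 2" for n
  proof -
    have "h n = (\<lambda>t. g n t - cut (nb s (m n)) (g n) t)"
      by (auto simp: h_def cut_def)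
    then have "\<psi> (h n) = \<psi> (g n) - \<psi> (cut (nb s (m n)) (g n))"
      using lin_on_diff[OF lin g(1) cfun_cut[OF g(1) clopen_nb]] by simp
    then show ?thesis
      using g(4)[of n] m(2)[of n] norm_triangle_sub[of "\<psi> (g n)" "\<psi> (cut (nb s (m n)) (g n))"]
      by simp
  qed
  \<comment> \<open>Along the iterates of m, the function \<open>h (k i)\<close> is supported in the
    i-th neighbourhood with the next one removed, which makes the supports disjoint.\<close>
  define k where "k i = (m ^^ i) 0" for i
  have k: "k (Suc i) = m (k i)" for i
    by (simp add: k_def)
  have kmono: "k i \<le> k j" if "i \<le> j" for i j
    using that by (rule lift_Suc_mono_le[rotated]) (simp add: k m(1))
  have disj: "h (k i) t = 0 \<or> h (k j) t = 0" if "i < j" for i j t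
  proof (cases "t \<in> nb s (k j)")
    case True
    then have "t \<in> nb s (m (k i))"
      using nb_antimono[OF kmono[of "Suc i" j], of s] that by (auto simp: k)
    then show ?thesis
      by (simp add: h_def cut_def)
  qed (simp add: h_def cut_def g(3))
  have bound: "(\<Sum>i<N. norm (\<psi> (h (k i)))) \<le> \<bar>R\<bar>" for N :: nat
  proof (rule functional_disjoint[OF \<psi>])
    fix i j :: nat and t assume "i \<noteq> j"
    then show "h (k i) t = 0 \<or> h (k j) t = 0"
      using disj[of i j t] disj[of j i t] by linarith
  qed (auto simp: h)
  obtain N :: nat where "real N > \<bar>R\<bar> / (c / 2)"
    using reals_Archimedean2 by blast
  then have "\<bar>R\<bar> < real N * (c / 2)"
    using c by (simp add: field_simps)
  also have "\<dots> \<le> (\<Sum>i<N. norm (\<psi> (h (k i))))"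
  proof -
    have "(\<Sum>i<N. c / 2) \<le> (\<Sum>i<N. norm (\<psi> (h (k i))))"
      by (intro sum_mono less_imp_le hc)
    then show ?thesis
      by simp
  qed
  finally show False
    using bound[of N] by linarith
qed

text \<open>Countability of the space is what counts here: each point gets a neighbourhood on which
  \<open>\<psi>\<close> is at most \<open>c s\<close>, with the \<open>c s\<close> summing to at
  most e along the enumeration. Finitely many of these neighbourhoods cover the space, and f is cut
  along them into disjoint pieces.\<close>

lemma functional_eq_0:
  assumes \<psi>: "bounded_functional R \<psi>" and lim: "\<And>s. (\<lambda>n. \<psi> (ind (nb s n))) \<longlonglongrightarrow> 0" and f: "f \<in> cfun"
  shows "\<psi> f = 0"
proof -
  note lin = bounded_functionalD(1)[OF \<psi>]
  have unit: "\<psi> f = 0" if f: "f \<in> cfun" and f1: "\<And>t. norm (f t) \<le> 1" for f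
  proof -
    have "norm (\<psi> f) \<le> e" if e: "e > 0" for e
    proof -
      define c where "c s = e * (1 / 2) ^ Suc (to_nat s)" for s :: 'a
      have "\<exists>n. \<forall>g\<in>cfun. (\<forall>t. norm (g t) \<le> 1) \<longrightarrow> (\<forall>t. t \<notin> nb s n \<longrightarrow> g t = 0) \<longrightarrow> norm (\<psi> g) \<le> c s" for s
        using e by (intro small_variation[OF \<psi> lim]) (simp add: c_def)
      then obtain N where N: "\<And>s g. g \<in> cfun \<Longrightarrow> (\<And>t. norm (g t) \<le> 1) \<Longrightarrow> (\<And>t. t \<notin> nb s (N s) \<Longrightarrow> g t = 0)
          \<Longrightarrow> norm (\<psi> g) \<le> c s"
        by metis
      have cover: "norm (\<psi> g) \<le> (\<Sum>s\<in>A. c s)" if "finite A" "g \<in> cfun" "\<And>t. norm (g t) \<le> 1"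
          "\<And>t. t \<notin> (\<Union>s\<in>A. nb s (N s)) \<Longrightarrow> g t = 0" for A g
        using that
      proof (induction A arbitrary: g rule: finite_induct)
        case empty
        then have "g = (\<lambda>_. 0)"
          by auto
        then show ?case
          using lin_on_zero[OF lin cfun_const] by simp
      next
        case (insert s A)
        let ?u = "cut (nb s (N s)) g" and ?v = "cut (- nb s (N s)) g"
        have uv: "?u \<in> cfun" "?v \<in> cfun"
          using insert.prems(1) by (simp_all add: cfun_cut clopen_nb clopen_Compl)
        have "g = (\<lambda>t. ?u t + ?v t)"
          by (auto simp: cut_def)
        then have "\<psi> g = \<psi> ?u + \<psi> ?v"
          using lin_on_add[OF lin uv] by simp
        moreover have "norm (\<psi> ?u) \<le> c s"
          using insert.prems(2) by (intro N uv) (auto simp: cut_def)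
        moreover have "norm (\<psi> ?v) \<le> (\<Sum>s\<in>A. c s)"
          using insert.prems(2,3) by (intro insert.IH uv) (auto simp: cut_def)
        ultimately show ?case
          using insert.hyps norm_triangle_ineq[of "\<psi> ?u" "\<psi> ?v"] by simp
      qed
      obtain A where A: "finite A" "(\<Union>s\<in>A. nb s (N s)) = UNIV"
        using nb_compact[of N] by blast
      have "norm (\<psi> f) \<le> (\<Sum>s\<in>A. c s)"
        using A f f1 by (intro cover) auto
      also have "\<dots> = (\<Sum>i\<in>to_nat ` A. e * (1 / 2) ^ Suc i)"
        by (subst sum.reindex) (auto simp: c_def inj_on_def)
      also have "\<dots> \<le> (\<Sum>i. e * (1 / 2) ^ Suc i)"
        using A(1) e power_half_series by (intro sum_le_suminf summable_mult) (auto simp: sums_iff)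
      also have "\<dots> = e"
        using sums_mult[OF power_half_series, of e] by (simp add: sums_iff)
      finally show ?thesis .
    qed
    then have "norm (\<psi> f) \<le> 0"
      by (rule field_le_epsilon) simp
    then show ?thesis by simp
  qed
  define M where "M = linf_norm f + 1"
  have M: "M > 0" "\<And>t. norm (f t) \<le> M"
    using linf_norm_nonneg[OF cfun_linf[OF f]] linf_norm_ge[OF cfun_linf[OF f]]
    by (auto simp: M_def add_increasing2)
  have "\<psi> (\<lambda>t. of_real (1 / M) * f t) = 0"
    using M by (intro unit lin_closed_cmult[OF lin_closed_cfun f]) (simp add: norm_mult norm_divide field_simps)
  then show ?thesis
    using lin_on_cmult[OF lin f, of "of_real (1 / M)"] M by simp
qed

text \<open>Once the point masses are subtracted, the values on shrinking indicators tend to 0 at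
  every point and nothing is left: on a countable compact space every measure is atomic.\<close>

theorem riesz:
  assumes \<phi>: "bounded_functional R \<phi>"
  obtains \<mu> where "\<mu> \<in> l1" "l1_norm \<mu> \<le> \<bar>R\<bar>" "\<And>f. f \<in> cfun \<Longrightarrow> \<phi> f = pairing f \<mu>"
proof -
  obtain \<mu> where lim: "\<And>s. (\<lambda>n. \<phi> (ind (nb s n))) \<longlonglongrightarrow> \<mu> s"
    using functional_ind_convergent[OF \<phi>] unfolding convergent_def by metis
  note \<mu> = l1_of_functional[OF \<phi> lim]
  define \<psi> where "\<psi> f = \<phi> f - pairing f \<mu>" for f
  note lin = bounded_functionalD(1)[OF \<phi>]
  have "lin_on cfun \<psi>"
    using lin \<mu>(1) by (simp add: lin_on_def \<psi>_def pairing_lincomb_left cfun_linf algebra_simps)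
  moreover have "norm (\<psi> f) \<le> (R + l1_norm \<mu>) * linf_norm f" if "f \<in> cfun" for f
    using \<phi> that pairing_bound[OF cfun_linf[OF that] \<mu>(1)] norm_triangle_ineq4[of "\<phi> f" "pairing f \<mu>"]
    by (fastforce simp: \<psi>_def bounded_functional_def algebra_simps)
  ultimately have "bounded_functional (R + l1_norm \<mu>) \<psi>"
    by (simp add: bounded_functional_def)
  moreover have "(\<lambda>n. \<psi> (ind (nb s n))) \<longlonglongrightarrow> 0" for s
    using tendsto_diff[OF lim[of s] pairing_ind_nb_tendsto[OF \<mu>(1), of s]] by (simp add: \<psi>_def)
  ultimately have "\<psi> f = 0" if "f \<in> cfun" for f
    using functional_eq_0 that by blast
  then show ?thesis
    using that[OF \<mu>] by (simp add: \<psi>_def)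
qed

text \<open>The embedding of \<open>l1\<close> into the dual of \<open>cfun\<close> does not
  decrease norms, since the masses recovered from the functional are those of \<open>\<mu>\<close>
  itself.\<close>

lemma l1_norm_le_dual:
  assumes \<mu>: "\<mu> \<in> l1" and le: "\<And>f. f \<in> cfun \<Longrightarrow> norm (pairing f \<mu>) \<le> R * linf_norm f"
  shows "l1_norm \<mu> \<le> \<bar>R\<bar>"
proof -
  have "bounded_functional R (\<lambda>f. pairing f \<mu>)"
    using le \<mu> by (simp add: bounded_functional_def lin_on_def pairing_lincomb_left cfun_linf)
  then show ?thesis
    by (rule l1_of_functional(2)[OF _ pairing_ind_nb_tendsto[OF \<mu>]])
qed

text \<open>In the applications \<open>L\<close> is a generalised limit, and \<open>\<mu>\<close> is then the weak-star limit of the net \<open>\<kappa>\<close> along it.\<close>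
definition weak_limit :: "(('i \<Rightarrow> complex) \<Rightarrow> complex) \<Rightarrow> ('i \<Rightarrow> 'a \<Rightarrow> complex) \<Rightarrow> ('a \<Rightarrow> complex) \<Rightarrow> bool" where
  "weak_limit L \<kappa> \<mu> \<longleftrightarrow> \<mu> \<in> l1 \<and> (\<forall>f\<in>cfun. pairing f \<mu> = L (\<lambda>i. pairing f (\<kappa> i)))"

text \<open>Weak-star compactness of balls: \<open>L\<close> applied to the pairings with the net is
  a functional on \<open>cfun\<close> bounded by \<open>R\<close>, so it is given by a
  measure.\<close>

lemma ex_weak_limit:
  assumes L: "lin_on linf L" "\<And>x. x \<in> linf \<Longrightarrow> norm (L x) \<le> linf_norm x"
    and \<kappa>: "\<And>i. \<kappa> i \<in> l1" "\<And>i. l1_norm (\<kappa> i) \<le> R"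
  obtains \<mu> where "weak_limit L \<kappa> \<mu>" "l1_norm \<mu> \<le> R"
proof -
  have R: "R \<ge> 0"
    using \<kappa>(2) l1_norm_nonneg order_trans by blast
  have le: "norm (pairing f (\<kappa> i)) \<le> R * linf_norm f" if "f \<in> linf" for f i
    using pairing_bound[OF that \<kappa>(1)[of i]] mult_left_mono[OF \<kappa>(2)[of i] linf_norm_nonneg[OF that]]
    by (simp add: mult.commute)
  have linf: "(\<lambda>i. pairing f (\<kappa> i)) \<in> linf" if "f \<in> linf" for f
    by (rule linfI[OF le[OF that]])
  have "bounded_functional R (\<lambda>f. L (\<lambda>i. pairing f (\<kappa> i)))"
    unfolding bounded_functional_def lin_on_def
  proof (intro conjI ballI allI)
    fix f g c d assume fg: "f \<in> cfun" "g \<in> cfun"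
    then show "L (\<lambda>i. pairing (\<lambda>s. c * f s + d * g s) (\<kappa> i)) =
        c * L (\<lambda>i. pairing f (\<kappa> i)) + d * L (\<lambda>i. pairing g (\<kappa> i))"
      using lin_onD[OF L(1) linf linf, of f g c d] by (simp add: pairing_lincomb_left cfun_linf \<kappa>(1))
  next
    fix f assume f: "f \<in> cfun"
    show "norm (L (\<lambda>i. pairing f (\<kappa> i))) \<le> R * linf_norm f"
      using L(2)[OF linf[OF cfun_linf[OF f]]]
        linf_norm_le[of "\<lambda>i. pairing f (\<kappa> i)", OF le[OF cfun_linf[OF f]]] by linarith
  qed
  then obtain \<mu> where "\<mu> \<in> l1" "l1_norm \<mu> \<le> \<bar>R\<bar>" "\<And>f. f \<in> cfun \<Longrightarrow> L (\<lambda>i. pairing f (\<kappa> i)) = pairing f \<mu>"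
    by (rule riesz) blast
  then show ?thesis
    using R by (intro that[of \<mu>]) (auto simp: weak_limit_def)
qed

end

section \<open>The Krein-Smulian theorem\<close>

context clopen_base
begin

text \<open>A finite set that separates \<open>\<mu> + K\<close> from 0 within radius r is enlarged,
  by functions of norm at most 1 / r, to one that does so within radius r'. If every finite
  \<open>G\<close> failed, the failures \<kappa> would form a bounded net indexed by the finite
  sets. Its limit stays in \<open>K\<close>, is bounded by 1 on the ball of radius 1 / r and hence
  has norm at most r after adding \<open>\<mu>\<close>, yet it is not separated by \<open>H\<close>.
  The index type of this net is the one appearing in the hypothesis \<open>closed\<close>.\<close>

lemma krein_smulian_step:
  fixes K :: "('a \<Rightarrow> complex) set"
  assumes K: "K \<subseteq> l1"
    and closed: "\<And>(L :: (('a \<Rightarrow> complex) set \<Rightarrow> complex) \<Rightarrow> complex) \<kappa> \<nu> R. lin_on linf L \<Longrightarrow>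
      (\<And>x. x \<in> linf \<Longrightarrow> norm (L x) \<le> linf_norm x) \<Longrightarrow> (\<And>i. \<kappa> i \<in> K) \<Longrightarrow>
      (\<And>i. l1_norm (\<kappa> i) \<le> R) \<Longrightarrow> weak_limit L \<kappa> \<nu> \<Longrightarrow> \<nu> \<in> K"
    and \<mu>: "\<mu> \<in> l1" and r: "r > 0" and H: "finite H" "H \<subseteq> cfun"
    and sep: "\<And>\<kappa>. \<kappa> \<in> K \<Longrightarrow> l1_norm (\<lambda>s. \<mu> s + \<kappa> s) \<le> r \<Longrightarrow> \<exists>f\<in>H. norm (pairing f (\<lambda>s. \<mu> s + \<kappa> s)) > 1"
  shows "\<exists>G. finite G \<and> G \<subseteq> {f \<in> cfun. linf_norm f \<le> 1 / r} \<and>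
    (\<forall>\<kappa>\<in>K. l1_norm (\<lambda>s. \<mu> s + \<kappa> s) \<le> r' \<longrightarrow> (\<exists>f\<in>H \<union> G. norm (pairing f (\<lambda>s. \<mu> s + \<kappa> s)) > 1))"
proof (rule ccontr)
  define B where "B = {f \<in> cfun. linf_norm f \<le> 1 / r}"
  assume "\<not> ?thesis"
  then have ex: "\<exists>\<kappa>\<in>K. l1_norm (\<lambda>s. \<mu> s + \<kappa> s) \<le> r' \<and> (\<forall>f\<in>H \<union> G. norm (pairing f (\<lambda>s. \<mu> s + \<kappa> s)) \<le> 1)"
    if "finite G" "G \<subseteq> B" for G
    using that unfolding B_def by (meson not_le)
  \<comment> \<open>The net must be defined on all sets of functions; outside the finite subsets of
    \<open>B\<close> the witness for the empty set serves as a default and keeps the uniform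
    bounds.\<close>
  have "\<exists>\<kappa>. \<kappa> \<in> K \<and> l1_norm (\<lambda>s. \<mu> s + \<kappa> s) \<le> r' \<and> (\<forall>f\<in>H. norm (pairing f (\<lambda>s. \<mu> s + \<kappa> s)) \<le> 1) \<and>
      (finite G \<longrightarrow> G \<subseteq> B \<longrightarrow> (\<forall>f\<in>G. norm (pairing f (\<lambda>s. \<mu> s + \<kappa> s)) \<le> 1))" for G
    using ex[of G] ex[of "{}"] by (cases "finite G \<and> G \<subseteq> B") auto
  then obtain \<kappa> where \<kappa>: "\<And>G. \<kappa> G \<in> K" "\<And>G. l1_norm (\<lambda>s. \<mu> s + \<kappa> G s) \<le> r'"
    "\<And>G f. f \<in> H \<Longrightarrow> norm (pairing f (\<lambda>s. \<mu> s + \<kappa> G s)) \<le> 1"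
    "\<And>G f. finite G \<Longrightarrow> G \<subseteq> B \<Longrightarrow> f \<in> G \<Longrightarrow> norm (pairing f (\<lambda>s. \<mu> s + \<kappa> G s)) \<le> 1"
    by metis
  have \<kappa>l: "\<kappa> G \<in> l1" for G
    using \<kappa>(1) K by blast
  have \<kappa>b: "l1_norm (\<kappa> G) \<le> r' + l1_norm \<mu>" for G
  proof -
    have "l1_norm (\<kappa> G) \<le> l1_norm (\<lambda>s. \<mu> s + \<kappa> G s) + l1_norm (\<lambda>s. - 1 * \<mu> s)"
      using l1_add(2)[OF l1_add(1)[OF \<mu> \<kappa>l[of G]] l1_cmult(1)[OF \<mu>, of "- 1"]] by simp
    then show ?thesis
      using l1_cmult(2)[OF \<mu>, of "- 1"] \<kappa>(2)[of G] by simp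
  qed
  show False
  proof (rule generalized_limit[OF finite_subsets_at_top_neq_bot[of B]])
    fix L :: "(('a \<Rightarrow> complex) set \<Rightarrow> complex) \<Rightarrow> complex"
    assume L: "lin_on linf L" "\<And>x. x \<in> linf \<Longrightarrow> norm (L x) \<le> linf_norm x" "L (\<lambda>_. 1) = 1"
      "\<And>x r. x \<in> linf \<Longrightarrow> eventually (\<lambda>i. norm (x i) \<le> r) (finite_subsets_at_top B) \<Longrightarrow> norm (L x) \<le> r"
    obtain \<kappa>' where \<kappa>': "weak_limit L \<kappa> \<kappa>'"
      by (rule ex_weak_limit[OF L(1,2) \<kappa>l \<kappa>b])
    have \<kappa>'K: "\<kappa>' \<in> K"
      by (rule closed[OF L(1,2) \<kappa>(1) \<kappa>b \<kappa>'])
    have \<kappa>'l: "\<kappa>' \<in> l1"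
      using \<kappa>'K K by blast
    define \<nu> where "\<nu> = (\<lambda>s. \<mu> s + \<kappa>' s)"
    define x where "x f G = pairing f (\<lambda>s. \<mu> s + \<kappa> G s)" for f G
    have xl: "x f \<in> linf" if "f \<in> cfun" for f
    proof (rule linfI)
      show "norm (x f G) \<le> linf_norm f * r'" for G
        using pairing_bound[OF cfun_linf[OF that] l1_add(1)[OF \<mu> \<kappa>l[of G]]] \<kappa>(2)[of G]
          mult_left_mono[OF \<kappa>(2)[of G] linf_norm_nonneg[OF cfun_linf[OF that]]] by (simp add: x_def)
    qed
    have \<nu>: "pairing f \<nu> = L (x f)" if f: "f \<in> cfun" for f
    proof -
      have "(\<lambda>G. pairing f (\<kappa> G)) \<in> linf"
      proof (rule linfI)
        show "norm (pairing f (\<kappa> G)) \<le> linf_norm f * (r' + l1_norm \<mu>)" for G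
          using pairing_bound[OF cfun_linf[OF f] \<kappa>l[of G]]
            mult_left_mono[OF \<kappa>b[of G] linf_norm_nonneg[OF cfun_linf[OF f]]] by simp
      qed
      from lin_onD[OF L(1) linfI[of "\<lambda>_. 1" 1] this, of "pairing f \<mu>" 1] \<kappa>' f
      show ?thesis
        by (simp add: x_def[abs_def] \<nu>_def pairing_add_right[OF cfun_linf[OF f]] \<mu> \<kappa>l \<kappa>'l L(3) weak_limit_def)
    qed
    have \<nu>B: "norm (pairing f \<nu>) \<le> 1" if f: "f \<in> B" for f
    proof -
      have "eventually (\<lambda>G. norm (x f G) \<le> 1) (finite_subsets_at_top B)"
        unfolding eventually_finite_subsets_at_top
        by (intro exI[of _ "{f}"]) (use f \<kappa>(4) in \<open>auto simp: x_def\<close>)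
      then show ?thesis
        using L(4) xl \<nu> f by (simp add: B_def)
    qed
    have "l1_norm \<nu> \<le> \<bar>r\<bar>"
    proof (rule l1_norm_le_dual)
      show "\<nu> \<in> l1"
        unfolding \<nu>_def by (rule l1_add(1)[OF \<mu> \<kappa>'l])
      fix f assume f: "f \<in> cfun"
      show "norm (pairing f \<nu>) \<le> r * linf_norm f"
      proof (cases "linf_norm f = 0")
        case True
        then have "f = (\<lambda>_. 0)"
          using linf_norm_ge[OF cfun_linf[OF f]] by auto
        then show ?thesis
          by (simp add: linf_zero)
      next
        case False
        then have pos: "linf_norm f > 0"
          using linf_norm_nonneg[OF cfun_linf[OF f]] by simp
        define c where "c = complex_of_real (1 / (r * linf_norm f))"
        have c: "norm c * (r * linf_norm f) = 1"
          using pos r unfolding c_def norm_of_real by simp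
        have "(\<lambda>s. c * f s) \<in> B"
          using lin_closed_cmult[OF lin_closed_cfun f, of c] linf_cmult(2)[OF cfun_linf[OF f], of c] c r
          by (simp add: B_def field_simps)
        from \<nu>B[OF this] have "norm c * norm (pairing f \<nu>) \<le> 1"
          using pairing_lincomb_left[OF cfun_linf[OF f] cfun_linf[OF f] \<open>\<nu> \<in> l1\<close>, of c 0] by (simp add: norm_mult)
        also have "\<dots> = norm c * (r * linf_norm f)"
          by (simp add: c)
        finally show ?thesis
          using c by (metis mult_le_cancel_left_pos mult_zero_left norm_eq_zero zero_less_norm_iff zero_neq_one)
      qed
    qed
    then obtain f where f: "f \<in> H" "norm (pairing f \<nu>) > 1"
      using sep[OF \<kappa>'K] r by (auto simp: \<nu>_def)
    then have "f \<in> cfun"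
      using H(2) by blast
    have "norm (x f G) \<le> 1" for G
      using \<kappa>(3)[OF f(1)] by (simp add: x_def)
    then have "norm (L (x f)) \<le> 1"
      by (intro L(4) xl \<open>f \<in> cfun\<close>) auto
    then show False
      using f(2) \<nu>[OF \<open>f \<in> cfun\<close>] by simp
  qed
qed

text \<open>The functions in the sets \<open>H n\<close> form a family tending to \<open>0\<close> in norm which separates \<open>\<mu> + K\<close> from
  \<open>0\<close> uniformly, so that evaluation on it maps into \<open>c\<^sub>0\<close>, where a separating functional is an absolutely
  summable combination of its members.\<close>
theorem krein_smulian:
  fixes K :: "('a \<Rightarrow> complex) set"
  assumes K: "lin_closed K" "K \<subseteq> l1"
    and closed: "\<And>(L :: (('a \<Rightarrow> complex) set \<Rightarrow> complex) \<Rightarrow> complex) \<kappa> \<nu> R. lin_on linf L \<Longrightarrow>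
      (\<And>x. x \<in> linf \<Longrightarrow> norm (L x) \<le> linf_norm x) \<Longrightarrow> (\<And>i. \<kappa> i \<in> K) \<Longrightarrow>
      (\<And>i. l1_norm (\<kappa> i) \<le> R) \<Longrightarrow> weak_limit L \<kappa> \<nu> \<Longrightarrow> \<nu> \<in> K"
    and \<mu>: "\<mu> \<in> l1" and d: "d > 0" "\<And>\<kappa>. \<kappa> \<in> K \<Longrightarrow> l1_norm (\<lambda>s. \<mu> s + \<kappa> s) > d"
  obtains g where "g \<in> cfun" "\<And>\<kappa>. \<kappa> \<in> K \<Longrightarrow> pairing g \<kappa> = 0" "pairing g \<mu> \<noteq> 0"
proof -
  \<comment> \<open>The radii start at d, within which \<open>\<mu> + K\<close> has no elements, and
    tend to infinity, so every element of \<open>\<mu> + K\<close> is eventually reached.\<close>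
  define r where "r n = d * (real n + 1)" for n
  have r: "r n > 0" "r 0 = d" for n
    using d(1) by (simp_all add: r_def)
  define B where "B n = {f \<in> cfun. linf_norm f \<le> 1 / r n}" for n
  \<comment> \<open>Requiring \<open>H 0\<close> to be empty places all members of the family in
    \<open>B 0\<close>, which gives them the common bound 1 / d.\<close>
  define S where "S n H \<longleftrightarrow> finite H \<and> H \<subseteq> cfun \<and> (n = 0 \<longrightarrow> H = {}) \<and> (\<forall>\<kappa>\<in>K. l1_norm (\<lambda>s. \<mu> s + \<kappa> s) \<le> r n \<longrightarrow>
      (\<exists>f\<in>H. norm (pairing f (\<lambda>s. \<mu> s + \<kappa> s)) > 1))" for n H
  have "\<exists>H. \<forall>n. S n (H n) \<and> (H (Suc n) \<subseteq> H n \<union> B n \<and> H n \<subseteq> H (Suc n))"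
  proof (rule dependent_nat_choice)
    show "\<exists>H. S 0 H"
      using d(2) by (intro exI[of _ "{}"]) (auto simp: S_def r simp flip: not_le)
    fix H n assume "S n H"
    have "\<exists>G. finite G \<and> G \<subseteq> {f \<in> cfun. linf_norm f \<le> 1 / r n} \<and>
        (\<forall>\<kappa>\<in>K. l1_norm (\<lambda>s. \<mu> s + \<kappa> s) \<le> r (Suc n) \<longrightarrow> (\<exists>f\<in>H \<union> G. norm (pairing f (\<lambda>s. \<mu> s + \<kappa> s)) > 1))"
      by (rule krein_smulian_step[OF K(2) closed \<mu> r(1)[of n]])
        (use \<open>S n H\<close> in \<open>simp_all add: S_def\<close>)
    then obtain G where "finite G" "G \<subseteq> B n"
      "\<forall>\<kappa>\<in>K. l1_norm (\<lambda>s. \<mu> s + \<kappa> s) \<le> r (Suc n) \<longrightarrow> (\<exists>f\<in>H \<union> G. norm (pairing f (\<lambda>s. \<mu> s + \<kappa> s)) > 1)"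
      unfolding B_def by meson
    then show "\<exists>H'. S (Suc n) H' \<and> (H' \<subseteq> H \<union> B n \<and> H \<subseteq> H')"
      using \<open>S n H\<close> by (intro exI[of _ "H \<union> G"]) (auto simp: S_def B_def)
  qed
  then obtain H where S: "\<And>n. S n (H n)" and step: "\<And>n. H (Suc n) \<subseteq> H n \<union> B n" "\<And>n. H n \<subseteq> H (Suc n)"
    by blast
  define HH where "HH = (\<Union>n. H n)"
  have HHc: "HH \<subseteq> cfun"
    using S by (auto simp: HH_def S_def)
  have B_mono: "B m \<subseteq> B n" if "n \<le> m" for m n
  proof -
    have "1 / r m \<le> 1 / r n"
      using that d(1) by (intro divide_left_mono) (auto simp: r_def)
    then show ?thesis
      by (auto simp: B_def)
  qed
  have tail: "H m \<subseteq> H n \<union> B n" for m n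
  proof (cases "n \<le> m")
    case True
    then show ?thesis
    proof (induction m rule: dec_induct)
      case (step m)
      then show ?case
        using \<open>\<And>n. H (Suc n) \<subseteq> H n \<union> B n\<close>[of m] B_mono[of n m] by blast
    qed simp
  next
    case False
    then show ?thesis
      using lift_Suc_mono_le[of H m n] step(2) by auto
  qed
  have HHtail: "HH - H n \<subseteq> B n" for n
    using tail[of _ n] by (auto simp: HH_def)
  have "H 0 = {}"
    using S[of 0] by (simp add: S_def)
  then have HHb: "linf_norm f \<le> 1 / d" if "f \<in> HH" for f
    using HHtail[of 0] that by (auto simp: B_def r)
  \<comment> \<open>The family is indexed by all functions, with the zero function outside
    \<open>HH\<close>, so that the evaluations live on a full type.\<close>
  define h where "h f s = (if f \<in> HH then f s else 0)" for f s
  have hc: "h f \<in> cfun" for f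
    using HHc cfun_const[of 0] by (cases "f \<in> HH") (auto simp: h_def[abs_def])
  have hb: "norm (h f s) \<le> 1 / d" for f s
    using HHb[of f] linf_norm_ge[OF cfun_linf, of f s] HHc d(1) by (fastforce simp: h_def)
  define T where "T \<kappa> = (\<lambda>f. pairing (h f) \<kappa>)" for \<kappa>
  have Tl: "T \<kappa> \<in> linf" if "\<kappa> \<in> l1" for \<kappa>
    unfolding T_def by (rule pairing_linf[OF hb that])
  have Tlin: "T (\<lambda>s. a * \<kappa> s + b * \<nu> s) = (\<lambda>f. a * T \<kappa> f + b * T \<nu> f)" if "\<kappa> \<in> l1" "\<nu> \<in> l1" for a b \<kappa> \<nu>
    unfolding T_def by (simp add: pairing_lincomb_right[OF cfun_linf[OF hc] that])
  \<comment> \<open>Members outside the finite set \<open>H n\<close> have norm at most 1 / r n, so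
    for n large the evaluation there is at most e.\<close>
  have Tc0: "finite {f. norm (T \<kappa> f) > e}" if \<kappa>: "\<kappa> \<in> l1" and e: "e > 0" for \<kappa> e
  proof -
    obtain n where n: "real n > l1_norm \<kappa> / (e * d)"
      using reals_Archimedean2 by blast
    have "norm (T \<kappa> f) \<le> e" if "f \<notin> H n" for f
    proof -
      have "norm (h f s) \<le> 1 / r n" for s
        using HHtail[of n] that linf_norm_ge[OF cfun_linf, of f s] r(1)[of n] by (fastforce simp: h_def B_def)
      then have "norm (T \<kappa> f) \<le> 1 / r n * l1_norm \<kappa>"
        unfolding T_def by (rule pairing_bound'[OF _ \<kappa>])
      also have "\<dots> \<le> e"
      proof -
        have "l1_norm \<kappa> \<le> real n * (e * d)"
          using n e d(1) by (simp add: field_simps)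
        also have "\<dots> \<le> e * r n"
          using e d(1) by (simp add: r_def algebra_simps)
        finally show ?thesis
          using r(1)[of n] by (simp add: field_simps)
      qed
      finally show ?thesis .
    qed
    then have "{f. norm (T \<kappa> f) > e} \<subseteq> H n"
      by (auto simp flip: not_le)
    then show ?thesis
      using S[of n] finite_subset by (auto simp: S_def)
  qed
  define U where "U = T ` K"
  have U1: "lin_closed U"
    unfolding lin_closed_def U_def
  proof (intro conjI ballI allI)
    show "(\<lambda>_. 0) \<in> T ` K"
      using lin_closed_zero[OF K(1)] by (auto simp: T_def image_iff intro!: bexI[of _ "\<lambda>_. 0"])
    fix x y a b assume "x \<in> T ` K" "y \<in> T ` K"
    then obtain \<kappa> \<nu> where *: "\<kappa> \<in> K" "\<nu> \<in> K" "x = T \<kappa>" "y = T \<nu>"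
      by blast
    then have "(\<lambda>f. a * x f + b * y f) = T (\<lambda>s. a * \<kappa> s + b * \<nu> s)"
      using Tlin[OF subsetD[OF K(2)] subsetD[OF K(2)], of \<kappa> \<nu> a b] by simp
    then show "(\<lambda>f. a * x f + b * y f) \<in> T ` K"
      using lin_closed_lincomb[OF K(1) *(1,2), of a b] by simp
  qed
  have U2: "U \<subseteq> linf"
    using Tl K(2) by (auto simp: U_def)
  have ge: "linf_norm (\<lambda>f. T \<mu> f + u f) \<ge> 1" if u: "u \<in> U" for u
  proof -
    obtain \<kappa> where \<kappa>: "\<kappa> \<in> K" "u = T \<kappa>"
      using u by (auto simp: U_def)
    have \<kappa>l: "\<kappa> \<in> l1"
      using \<kappa>(1) K(2) by blast
    let ?\<nu> = "\<lambda>s. \<mu> s + \<kappa> s"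
    have eq: "(\<lambda>f. T \<mu> f + u f) = T ?\<nu>"
      using Tlin[OF \<mu> \<kappa>l, of 1 1] \<kappa>(2) by simp
    obtain n where "real n > l1_norm ?\<nu> / d"
      using reals_Archimedean2 by blast
    then have "l1_norm ?\<nu> \<le> r n"
      using d(1) by (simp add: r_def field_simps)
    then obtain f where f: "f \<in> H n" "norm (pairing f ?\<nu>) > 1"
      using S[of n] \<kappa>(1) unfolding S_def by blast
    have "h f = f"
      using f(1) by (auto simp: h_def HH_def fun_eq_iff)
    then have "T ?\<nu> f = pairing f ?\<nu>"
      by (simp add: T_def)
    then show ?thesis
      using f(2) linf_norm_ge[OF Tl[OF l1_add(1)[OF \<mu> \<kappa>l]], of f] by (simp add: eq)
  qed
  show ?thesis
  proof (rule separate_linf[OF U1 U2 Tl[OF \<mu>] ge])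
    fix L :: "(('a \<Rightarrow> complex) \<Rightarrow> complex) \<Rightarrow> complex"
    assume L: "lin_on linf L" "\<And>x. x \<in> linf \<Longrightarrow> norm (L x) \<le> linf_norm x"
      and LU: "\<And>u. u \<in> U \<Longrightarrow> L u = 0" and L\<mu>: "L (T \<mu>) = 1"
    define \<alpha> where "\<alpha> f = L (delta f)" for f
    have \<alpha>: "\<alpha> \<in> l1"
      unfolding \<alpha>_def[abs_def] by (rule c0_functional(1)[OF L])
    define g where "g = (\<lambda>s. pairing (\<lambda>f. h f s) \<alpha>)"
    have eq: "pairing g \<kappa> = L (T \<kappa>)" if \<kappa>: "\<kappa> \<in> l1" for \<kappa>
    proof -
      have "pairing g \<kappa> = pairing (T \<kappa>) \<alpha>"
        unfolding g_def T_def by (rule pairing_swap[OF \<kappa> \<alpha>, of "\<lambda>s f. h f s", OF hb])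
      also have "\<dots> = L (T \<kappa>)"
        unfolding \<alpha>_def[abs_def] using c0_functional(3)[OF L Tl[OF \<kappa>] Tc0[OF \<kappa>]] by simp
      finally show ?thesis .
    qed
    show thesis
    proof (rule that)
      show "g \<in> cfun"
        unfolding g_def by (rule cfun_average[OF hc hb \<alpha>])
      show "pairing g \<kappa> = 0" if "\<kappa> \<in> K" for \<kappa>
        using eq[of \<kappa>] that K(2) LU by (auto simp: U_def)
      show "pairing g \<mu> \<noteq> 0"
        by (simp add: eq[OF \<mu>] L\<mu>)
    qed
  qed
qed

end

section \<open>The topology of the semigroup\<close>

text \<open>A family \<open>(j\<^sup>(\<^sup>i\<^sup>)\<^sub>r)\<close> as in the definition of the neighbourhoods is encoded by the set of its values.\<close>
definition word :: "('k::finite \<Rightarrow> int set) \<Rightarrow> int set \<Rightarrow> bool" where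
  "word J A \<longleftrightarrow> finite A \<and> A \<subseteq> (\<Union>i. J i) \<and> inj_on abs A"

text \<open>The number of letters from each \<open>J i\<close>, that is, the amount by which the
  coordinates 1 to k drop along the word.\<close>

definition wtype :: "('k::finite \<Rightarrow> int set) \<Rightarrow> int set \<Rightarrow> (nat, 'k) vec" where
  "wtype J A = (\<chi> i. card (A \<inter> J i))"

text \<open>\<open>X\<close> is a set of forbidden absolute values. The neighbourhoods forbid an
  initial segment; arbitrary \<open>X\<close> are needed because splitting off a letter forbids its
  absolute value for the rest of the word.\<close>

definition below :: "('k::finite \<Rightarrow> int set) \<Rightarrow> int set \<Rightarrow> 'k T \<Rightarrow> 'k T set" where
  "below J X \<gamma> = {\<beta>. \<exists>A. word J A \<and> abs ` A \<inter> X = {} \<and> snd \<gamma> = snd \<beta> + wtype J A \<and> fst \<beta> = fst \<gamma> + \<Sum>A}"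

lemma disjoint_family_unique: "disjoint_family J \<Longrightarrow> x \<in> J i \<Longrightarrow> x \<in> J i' \<Longrightarrow> i = i'"
  by (auto simp: disjoint_family_on_def)

lemma wtype_empty [simp]: "wtype J {} = 0"
  by (simp add: wtype_def vec_eq_iff)

lemma word_empty [simp]: "word J {}"
  by (simp add: word_def)

lemma word_subset: "word J A \<Longrightarrow> B \<subseteq> A \<Longrightarrow> word J B"
  unfolding word_def by (meson finite_subset inj_on_subset subset_trans)

lemma wtype_Un:
  assumes "finite A" "finite B" "A \<inter> B = {}"
  shows "wtype J (A \<union> B) = wtype J A + wtype J B"
proof -
  have "card ((A \<union> B) \<inter> J i) = card (A \<inter> J i) + card (B \<inter> J i)" for i
    using assms by (subst card_Un_disjoint[symmetric]) (auto simp: Int_Un_distrib2)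
  then show ?thesis
    by (simp add: wtype_def vec_eq_iff)
qed

lemma word_Un:
  assumes "word J A" "word J B" "abs ` A \<inter> abs ` B = {}"
  shows "word J (A \<union> B)" "wtype J (A \<union> B) = wtype J A + wtype J B" "\<Sum>(A \<union> B) = \<Sum>A + \<Sum>B"
proof -
  have disj: "A \<inter> B = {}"
    using assms(3) by blast
  have fin: "finite A" "finite B"
    using assms(1,2) by (simp_all add: word_def)
  show "word J (A \<union> B)"
    using assms unfolding word_def by (auto simp: inj_on_Un)
  show "wtype J (A \<union> B) = wtype J A + wtype J B" "\<Sum>(A \<union> B) = \<Sum>A + \<Sum>B"
    using wtype_Un[OF fin disj] sum.union_disjoint[OF fin disj] by simp_all
qed

lemma word_singleton:
  assumes "disjoint_family J" "x \<in> J i"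
  shows "word J {x}" "wtype J {x} = axis i 1"
proof -
  show "word J {x}"
    using assms(2) by (auto simp: word_def)
  have "x \<notin> J j" if "j \<noteq> i" for j
    using assms that by (auto simp: disjoint_family_on_def)
  then have "card ({x} \<inter> J j) = axis i 1 $ j" for j
    using assms(2) by (cases "j = i") (auto simp: axis_def)
  then show "wtype J {x} = axis i 1"
    by (simp add: wtype_def vec_eq_iff)
qed

lemma sum_word:
  assumes "disjoint_family J" "word J A"
  shows "\<Sum>A = (\<Sum>i\<in>UNIV. \<Sum>(A \<inter> J i))"
proof -
  have "A = (\<Union>i. A \<inter> J i)"
    using assms(2) by (auto simp: word_def)
  then have "\<Sum>A = \<Sum>(\<Union>i. A \<inter> J i)"
    by simp
  also have "\<dots> = (\<Sum>i\<in>UNIV. \<Sum>(A \<inter> J i))"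
    using assms by (intro sum.UNION_disjoint) (auto simp: word_def disjoint_family_on_def)
  finally show ?thesis .
qed

lemma enumerate_word:
  assumes "word J A"
  obtains g where "bij_betw g {1..wtype J A $ i} (A \<inter> J i)" "strict_mono_on {1..wtype J A $ i} (\<lambda>r. \<bar>g r\<bar>)"
proof -
  define B where "B = A \<inter> J i"
  define c where "c = wtype J A $ i"
  define a where "a x = nat \<bar>x\<bar>" for x :: int
  have inj: "inj_on a B"
    using assms by (auto simp: word_def inj_on_def a_def B_def)
  have fin: "finite B"
    using assms by (simp add: word_def B_def)
  have card: "card (a ` B) = c"
    using card_image[OF inj] by (simp add: wtype_def B_def c_def)
  obtain h where h: "bij_betw h {..<c} (a ` B)" "strict_mono_on {..<c} h"
    using ex_bij_betw_strict_mono_card[of "a ` B"] fin card by auto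
  \<comment> \<open>The increasing enumeration of absolute values starts at 0 while the families
    start at 1, hence the shift; each absolute value determines its letter.\<close>
  define g where "g r = the_inv_into B a (h (r - 1))" for r
  have "bij_betw (\<lambda>r. r - 1) {1..c} {..<c}"
    by (rule bij_betw_byWitness[where f'=Suc]) auto
  from bij_betw_trans[OF bij_betw_trans[OF this h(1)] bij_betw_the_inv_into[OF inj_on_imp_bij_betw[OF inj]]]
  have "bij_betw g {1..c} B"
    by (simp add: g_def[abs_def] o_def)
  moreover have ag: "\<bar>g r\<bar> = int (h (r - 1))" if "r \<in> {1..c}" for r
  proof -
    have "h (r - 1) \<in> a ` B"
      by (rule bij_betwE[OF h(1), rule_format]) (use that in auto)
    then have "a (g r) = h (r - 1)"
      unfolding g_def by (rule f_the_inv_into_f[OF inj])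
    then show ?thesis
      by (simp add: a_def)
  qed
  have "strict_mono_on {1..c} (\<lambda>r. \<bar>g r\<bar>)"
  proof (rule strict_mono_onI)
    fix r q assume rq: "r \<in> {1..c}" "q \<in> {1..c}" "r < q"
    have "h (r - 1) < h (q - 1)"
      by (rule strict_mono_onD[OF h(2)]) (use rq in auto)
    then show "\<bar>g r\<bar> < \<bar>g q\<bar>"
      by (simp add: ag[OF rq(1)] ag[OF rq(2)])
  qed
  ultimately show ?thesis
    using that by (simp add: c_def B_def)
qed

text \<open>From a family to a word. Disjointness of the sets \<open>J i\<close> allows the index i
  to be recovered from a letter, so the letters from \<open>J i\<close> are exactly the i-th row of
  the family.\<close>

lemma family_word:
  fixes j :: "'k::finite \<Rightarrow> nat \<Rightarrow> int" and p :: "'k \<Rightarrow> nat"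
  assumes disj: "disjoint_family J" and J: "\<And>i r. r \<in> {1..p i} \<Longrightarrow> j i r \<in> J i"
    and inj: "inj_on (\<lambda>(i, r). \<bar>j i r\<bar>) (SIGMA i:UNIV. {1..p i})"
  defines "A \<equiv> (\<lambda>(i, r). j i r) ` (SIGMA i:UNIV. {1..p i})"
  shows "word J A" "wtype J A = (\<chi> i. p i)" "\<Sum>A = (\<Sum>i\<in>UNIV. \<Sum>r=1..p i. j i r)"
proof -
  have inj': "inj_on (\<lambda>(i, r). j i r) (SIGMA i:UNIV. {1..p i})"
    by (rule inj_onI, rule inj_onD[OF inj]) (simp_all add: case_prod_unfold)
  show "word J A"
    unfolding word_def
  proof (intro conjI)
    show "A \<subseteq> (\<Union>i. J i)"
      using J by (force simp: A_def)
    show "inj_on abs A"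
      unfolding A_def by (rule inj_on_imageI) (use inj in \<open>simp add: o_def case_prod_unfold\<close>)
  qed (simp add: A_def)
  have "A \<inter> J i = j i ` {1..p i}" for i
  proof (intro equalityI subsetI)
    fix x assume "x \<in> A \<inter> J i"
    then obtain i' r where "x = j i' r" "r \<in> {1..p i'}" "x \<in> J i"
      by (auto simp: A_def)
    moreover from this have "i' = i"
      using disjoint_family_unique[OF disj J] by blast
    ultimately show "x \<in> j i ` {1..p i}"
      by blast
  next
    fix x assume "x \<in> j i ` {1..p i}"
    then show "x \<in> A \<inter> J i"
      using J by (auto simp: A_def)
  qed
  moreover have "inj_on (j i) {1..p i}" for i
    using inj_onD[OF inj', of "(i, _)" "(i, _)"] by (intro inj_onI) simp
  ultimately show "wtype J A = (\<chi> i. p i)"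
    by (simp add: wtype_def vec_eq_iff card_image)
  show "\<Sum>A = (\<Sum>i\<in>UNIV. \<Sum>r=1..p i. j i r)"
    using sum.reindex[OF inj', of "\<lambda>x. x"] by (simp add: A_def sum.Sigma case_prod_unfold o_def)
qed

text \<open>From a word to a family: the letters from each \<open>J i\<close> are listed by
  increasing absolute value, which also meets the monotonicity demanded in the definition of the
  neighbourhoods.\<close>

lemma word_family:
  assumes disj: "disjoint_family J" and A: "word J A"
  shows "\<exists>j. (\<forall>i. \<forall>r\<in>{1..wtype J A $ i}. j i r \<in> A \<inter> J i) \<and>
    inj_on (\<lambda>(i, r). \<bar>j i r\<bar>) (SIGMA i:UNIV. {1..wtype J A $ i}) \<and>
    (\<forall>i. strict_mono_on {1..wtype J A $ i} (\<lambda>r. \<bar>j i r\<bar>)) \<and>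
    \<Sum>A = (\<Sum>i\<in>UNIV. \<Sum>r=1..wtype J A $ i. j i r)"
proof -
  have "\<exists>g. bij_betw g {1..wtype J A $ i} (A \<inter> J i) \<and> strict_mono_on {1..wtype J A $ i} (\<lambda>r. \<bar>g r\<bar>)" for i
    using enumerate_word[OF A, of i] by blast
  then obtain j where j: "\<And>i. bij_betw (j i) {1..wtype J A $ i} (A \<inter> J i)"
    "\<And>i. strict_mono_on {1..wtype J A $ i} (\<lambda>r. \<bar>j i r\<bar>)"
    by metis
  have mem: "j i r \<in> A \<inter> J i" if "r \<in> {1..wtype J A $ i}" for i r
    using bij_betwE[OF j(1)] that by blast
  have "inj_on (\<lambda>(i, r). \<bar>j i r\<bar>) (SIGMA i:UNIV. {1..wtype J A $ i})"
  proof (rule inj_onI, clarify)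
    fix i r i' r' assume r: "r \<in> {1..wtype J A $ i}" "r' \<in> {1..wtype J A $ i'}" and eq: "\<bar>j i r\<bar> = \<bar>j i' r'\<bar>"
    have "j i r = j i' r'"
      using A mem[OF r(1)] mem[OF r(2)] eq by (auto simp: word_def inj_on_def)
    then have "i = i'"
      using mem[OF r(1)] mem[OF r(2)] disjoint_family_unique[OF disj] by auto
    then show "i = i' \<and> r = r'"
      using \<open>j i r = j i' r'\<close> inj_onD[OF bij_betw_imp_inj_on[OF j(1)[of i]], of r r'] r by simp
  qed
  moreover have "\<Sum>A = (\<Sum>i\<in>UNIV. \<Sum>r=1..wtype J A $ i. j i r)"
    unfolding sum_word[OF disj A] using sum.reindex_bij_betw[OF j(1), of "\<lambda>x. x"] by simp
  ultimately show ?thesis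
    using mem j(2) by (intro exI[of _ j]) blast
qed

lemma T_nbhd_eq_below:
  assumes disj: "disjoint_family J"
  shows "T_nbhd J \<gamma> n = below J {..int n} \<gamma>"
proof (intro equalityI subsetI)
  fix \<beta> assume "\<beta> \<in> T_nbhd J \<gamma> n"
  then obtain j where j: "\<And>i. snd \<beta> $ i \<le> snd \<gamma> $ i"
    "\<And>i r. r\<in>{1..snd \<gamma> $ i - snd \<beta> $ i} \<Longrightarrow> j i r \<in> J i \<and> int n < \<bar>j i r\<bar>"
    "inj_on (\<lambda>(i, r). \<bar>j i r\<bar>) (SIGMA i:UNIV. {1..snd \<gamma> $ i - snd \<beta> $ i})"
    "fst \<beta> = fst \<gamma> + (\<Sum>i\<in>UNIV. \<Sum>r=1..snd \<gamma> $ i - snd \<beta> $ i. j i r)"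
    unfolding T_nbhd_def by blast
  define A where "A = (\<lambda>(i, r). j i r) ` (SIGMA i:UNIV. {1..snd \<gamma> $ i - snd \<beta> $ i})"
  note A = family_word[of J "\<lambda>i. snd \<gamma> $ i - snd \<beta> $ i" j, OF disj _ j(3), folded A_def]
  have "abs ` A \<inter> {..int n} = {}"
    using j(2) by (fastforce simp: A_def)
  then show "\<beta> \<in> below J {..int n} \<gamma>"
    unfolding below_def using A j(1,2,4)
    by (intro CollectI exI[of _ A]) (auto simp: vec_eq_iff)
next
  fix \<beta> assume "\<beta> \<in> below J {..int n} \<gamma>"
  then obtain A where A: "word J A" "abs ` A \<inter> {..int n} = {}" "snd \<gamma> = snd \<beta> + wtype J A" "fst \<beta> = fst \<gamma> + \<Sum>A"
    by (auto simp: below_def)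
  obtain j where j: "\<forall>i. \<forall>r\<in>{1..wtype J A $ i}. j i r \<in> A \<inter> J i"
    "inj_on (\<lambda>(i, r). \<bar>j i r\<bar>) (SIGMA i:UNIV. {1..wtype J A $ i})"
    "\<forall>i. strict_mono_on {1..wtype J A $ i} (\<lambda>r. \<bar>j i r\<bar>)"
    "\<Sum>A = (\<Sum>i\<in>UNIV. \<Sum>r=1..wtype J A $ i. j i r)"
    using word_family[OF disj A(1)] by blast
  have eq: "snd \<gamma> $ i - snd \<beta> $ i = wtype J A $ i" for i
    by (simp add: A(3))
  have "int n < \<bar>x\<bar>" if "x \<in> A" for x
    using A(2) that by (force simp: disjoint_iff)
  then show "\<beta> \<in> T_nbhd J \<gamma> n"
    unfolding T_nbhd_def eq using j A(3,4)
    by (intro CollectI conjI exI[of _ j]) auto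
qed

lemma J_condition_words:
  assumes disj: "disjoint_family J" and J: "J_condition J"
  shows "\<exists>n::nat. \<forall>A B. word J A \<longrightarrow> word J B \<longrightarrow> abs ` A \<inter> {..int n} = {} \<longrightarrow> abs ` B \<inter> {..int n} = {} \<longrightarrow>
    wtype J A = p \<longrightarrow> wtype J B = q \<longrightarrow> \<Sum>A = t + \<Sum>B \<longrightarrow> t = 0 \<and> p = q"
proof -
  from J[unfolded J_condition_def, THEN spec[of _ t], THEN spec[of _ "\<lambda>i. p $ i"], THEN spec[of _ "\<lambda>i. q $ i"]]
  obtain n :: nat where n: "\<forall>(j :: 'a \<Rightarrow> nat \<Rightarrow> int) (l :: 'a \<Rightarrow> nat \<Rightarrow> int).
       (\<forall>i. \<forall>r\<in>{1..p $ i}. j i r \<in> J i \<and> \<bar>j i r\<bar> > int n) \<and>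
       (\<forall>i. \<forall>s\<in>{1..q $ i}. l i s \<in> J i \<and> \<bar>l i s\<bar> > int n) \<and>
       inj_on (\<lambda>(i, r). \<bar>j i r\<bar>) (SIGMA i:UNIV. {1..p $ i}) \<and>
       inj_on (\<lambda>(i, s). \<bar>l i s\<bar>) (SIGMA i:UNIV. {1..q $ i}) \<and>
       (\<Sum>i\<in>UNIV. \<Sum>r=1..p $ i. j i r) = t + (\<Sum>i\<in>UNIV. \<Sum>s=1..q $ i. l i s)
       \<longrightarrow> t = 0 \<and> (\<forall>i. p $ i = q $ i)" ..
  have "t = 0 \<and> p = q" if AB: "word J A" "word J B" "abs ` A \<inter> {..int n} = {}" "abs ` B \<inter> {..int n} = {}"
    "wtype J A = p" "wtype J B = q" "\<Sum>A = t + \<Sum>B" for A B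
  proof -
    obtain j where j: "\<forall>i. \<forall>r\<in>{1..wtype J A $ i}. j i r \<in> A \<inter> J i"
      "inj_on (\<lambda>(i, r). \<bar>j i r\<bar>) (SIGMA i:UNIV. {1..wtype J A $ i})"
      "\<Sum>A = (\<Sum>i\<in>UNIV. \<Sum>r=1..wtype J A $ i. j i r)"
      using word_family[OF disj AB(1)] by blast
    obtain l where l: "\<forall>i. \<forall>r\<in>{1..wtype J B $ i}. l i r \<in> B \<inter> J i"
      "inj_on (\<lambda>(i, r). \<bar>l i r\<bar>) (SIGMA i:UNIV. {1..wtype J B $ i})"
      "\<Sum>B = (\<Sum>i\<in>UNIV. \<Sum>r=1..wtype J B $ i. l i r)"
      using word_family[OF disj AB(2)] by blast
    have "int n < \<bar>x\<bar>" if "x \<in> A \<union> B" for x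
      using AB(3,4) that by (force simp: disjoint_iff)
    then have "t = 0 \<and> (\<forall>i. p $ i = q $ i)"
      using j l AB(5-7) by (intro n[THEN spec[of _ j], THEN spec[of _ l], THEN mp]) auto
    then show ?thesis
      by (simp add: vec_eq_iff)
  qed
  then show ?thesis by blast
qed

lemma finite_vec_le: "finite {p :: (nat, 'k::finite) vec. \<forall>i. p $ i \<le> q $ i}"
proof -
  have "finite (PiE UNIV (\<lambda>i. {..q $ i}))"
    by (intro finite_PiE) auto
  then have "finite (vec_lambda ` PiE UNIV (\<lambda>i. {..q $ i}))"
    by (rule finite_imageI)
  moreover have "{p. \<forall>i. p $ i \<le> q $ i} \<subseteq> vec_lambda ` PiE UNIV (\<lambda>i. {..q $ i})"
  proof
    fix p assume "p \<in> {p. \<forall>i. p $ i \<le> q $ i}"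
    then show "p \<in> vec_lambda ` PiE UNIV (\<lambda>i. {..q $ i})"
      by (intro image_eqI[of _ _ "\<lambda>i. p $ i"]) auto
  qed
  ultimately show ?thesis
    by (rule finite_subset[rotated])
qed

lemma below_self: "\<gamma> \<in> below J X \<gamma>"
  unfolding below_def by (auto intro!: exI[of _ "{}"])

lemma below_mono: "X \<subseteq> Y \<Longrightarrow> below J Y \<gamma> \<subseteq> below J X \<gamma>"
  unfolding below_def by blast

lemma below_add: "(\<beta>0 + d0, \<beta>1 + d1) \<in> below J X (\<gamma>0 + d0, \<gamma>1 + d1) \<longleftrightarrow> (\<beta>0, \<beta>1) \<in> below J X (\<gamma>0, \<gamma>1)"
proof -
  have "\<gamma>1 + d1 = \<beta>1 + d1 + wtype J A \<longleftrightarrow> \<gamma>1 = \<beta>1 + wtype J A" for A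
  proof -
    have "\<beta>1 + d1 + wtype J A = (\<beta>1 + wtype J A) + d1"
      by (simp add: ac_simps)
    then show ?thesis
      by (simp only: add_right_cancel)
  qed
  moreover have "\<beta>0 + d0 = \<gamma>0 + d0 + \<Sum>A \<longleftrightarrow> \<beta>0 = \<gamma>0 + \<Sum>A" for A
    by linarith
  ultimately show ?thesis
    by (simp add: below_def)
qed

lemma S_plus_simps [simp]:
  "S_plus None t = None" "S_plus s None = None" "S_plus (Some \<beta>) (Some \<gamma>) = Some (\<beta> + \<gamma>)"
  by (auto simp: S_plus_def split: option.splits)

section \<open>Separation and compactness of the basic neighbourhoods\<close>

locale J_sets =
  fixes J :: "'k::finite \<Rightarrow> int set"
  assumes disj: "disjoint_family J" and Jc: "J_condition J"
begin

abbreviation V :: "'k T \<Rightarrow> nat \<Rightarrow> 'k T set" where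
  "V \<gamma> n \<equiv> below J {..int n} \<gamma>"

lemma V_antimono: "m \<le> n \<Longrightarrow> V \<gamma> n \<subseteq> V \<gamma> m"
  by (rule below_mono) auto

lemma V_open:
  assumes "\<beta> \<in> V \<gamma> n"
  shows "\<exists>m. V \<beta> m \<subseteq> V \<gamma> n"
proof -
  obtain A where A: "word J A" "abs ` A \<inter> {..int n} = {}" "snd \<gamma> = snd \<beta> + wtype J A" "fst \<beta> = fst \<gamma> + \<Sum>A"
    using assms by (auto simp: below_def)
  have "finite A"
    using A(1) by (simp add: word_def)
  \<comment> \<open>All letters leading below \<beta> must be longer than those of \<open>A\<close>,
    so that the two words merge into one. The inserted 0 covers the empty word.\<close>
  define m where "m = max n (Max (insert 0 ((\<lambda>x. nat \<bar>x\<bar>) ` A)))"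
  have m: "\<bar>x\<bar> \<le> int m" if "x \<in> A" for x
  proof -
    have "nat \<bar>x\<bar> \<le> Max (insert 0 ((\<lambda>x. nat \<bar>x\<bar>) ` A))"
      using that \<open>finite A\<close> by (intro Max_ge) auto
    then show ?thesis
      by (simp add: m_def)
  qed
  have "\<alpha> \<in> V \<gamma> n" if \<alpha>: "\<alpha> \<in> V \<beta> m" for \<alpha>
  proof -
    obtain B where B: "word J B" "abs ` B \<inter> {..int m} = {}" "snd \<beta> = snd \<alpha> + wtype J B" "fst \<alpha> = fst \<beta> + \<Sum>B"
      using \<alpha> by (auto simp: below_def)
    have "abs ` A \<inter> abs ` B = {}"
      using B(2) m by fastforce
    note U = word_Un[OF A(1) B(1) this]
    have "abs ` B \<inter> {..int n} = {}"
      using B(2) by (fastforce simp: m_def)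
    then have "abs ` (A \<union> B) \<inter> {..int n} = {}"
      unfolding image_Un Int_Un_distrib2 using A(2) by simp
    then show ?thesis
      unfolding below_def using U A(3,4) B(3,4)
      by (intro CollectI exI[of _ "A \<union> B"]) (simp add: ac_simps)
  qed
  then show ?thesis by blast
qed

text \<open>Words leading down from \<gamma> and \<delta> have only finitely many types, so one m
  serves the condition on J for all pairs of types and the shift t between the first coordinates. A
  common point would force t = 0 and equal types, hence \<gamma> = \<delta>.\<close>

lemma V_separate:
  assumes "\<gamma> \<noteq> \<delta>"
  shows "\<exists>m. V \<gamma> m \<inter> V \<delta> m = {}"
proof -
  define P where "P = {p :: (nat, 'k) vec. \<forall>i. p $ i \<le> snd \<gamma> $ i} \<times> {q :: (nat, 'k) vec. \<forall>i. q $ i \<le> snd \<delta> $ i}"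
  have P: "finite P"
    unfolding P_def by (intro finite_cartesian_product finite_vec_le)
  define t where "t = fst \<delta> - fst \<gamma>"
  have "\<exists>n::nat. \<forall>A B. word J A \<longrightarrow> word J B \<longrightarrow> abs ` A \<inter> {..int n} = {} \<longrightarrow>
      abs ` B \<inter> {..int n} = {} \<longrightarrow> wtype J A = fst z \<longrightarrow> wtype J B = snd z \<longrightarrow> \<Sum>A = t + \<Sum>B \<longrightarrow>
      t = 0 \<and> fst z = snd z" for z
    by (rule J_condition_words[OF disj Jc])
  from choice[OF allI[OF this]] obtain n where n: "\<forall>z. \<forall>A B. word J A \<longrightarrow> word J B \<longrightarrow> abs ` A \<inter> {..int (n z)} = {} \<longrightarrow>
      abs ` B \<inter> {..int (n z)} = {} \<longrightarrow> wtype J A = fst z \<longrightarrow> wtype J B = snd z \<longrightarrow> \<Sum>A = t + \<Sum>B \<longrightarrow>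
      t = 0 \<and> fst z = snd z" ..
  define m where "m = Max (n ` P)"
  have False if \<alpha>: "\<alpha> \<in> V \<gamma> m" "\<alpha> \<in> V \<delta> m" for \<alpha>
  proof -
    obtain A where A: "word J A" "abs ` A \<inter> {..int m} = {}" "snd \<gamma> = snd \<alpha> + wtype J A" "fst \<alpha> = fst \<gamma> + \<Sum>A"
      using \<alpha>(1) by (auto simp: below_def)
    obtain B where B: "word J B" "abs ` B \<inter> {..int m} = {}" "snd \<delta> = snd \<alpha> + wtype J B" "fst \<alpha> = fst \<delta> + \<Sum>B"
      using \<alpha>(2) by (auto simp: below_def)
    have "(wtype J A, wtype J B) \<in> P"
      by (simp add: P_def A(3) B(3))
    then have "n (wtype J A, wtype J B) \<le> m"
      using P by (simp add: m_def)
    then have "{..int (n (wtype J A, wtype J B))} \<subseteq> {..int m}"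
      by auto
    then have "t = 0 \<and> wtype J A = wtype J B"
      using A B n[THEN spec[of _ "(wtype J A, wtype J B)"], THEN spec[of _ A], THEN spec[of _ B]]
      by (auto simp: t_def)
    then show False
      using assms A(3) B(3) by (simp add: t_def prod_eq_iff)
  qed
  then show ?thesis by blast
qed

text \<open>The points of \<open>below J X \<gamma>\<close> outside \<open>V \<gamma> m\<close> are reached through one of finitely many first
  letters; this drives the inductions on the degree of \<open>\<gamma>\<close>.\<close>
lemma below_cases:
  assumes "\<beta> \<in> below J X \<gamma>" "\<beta> \<notin> V \<gamma> m"
  obtains x i \<eta> where "\<bar>x\<bar> \<le> int m" "\<bar>x\<bar> \<notin> X" "x \<in> J i" "snd \<gamma> = \<eta> + axis i 1"
    "\<beta> \<in> below J (insert \<bar>x\<bar> X) (fst \<gamma> + x, \<eta>)"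
proof -
  obtain A where A: "word J A" "abs ` A \<inter> X = {}" "snd \<gamma> = snd \<beta> + wtype J A" "fst \<beta> = fst \<gamma> + \<Sum>A"
    using assms(1) by (auto simp: below_def)
  have "abs ` A \<inter> {..int m} \<noteq> {}"
    using assms(2) A unfolding below_def by blast
  then obtain x where x: "x \<in> A" "\<bar>x\<bar> \<le> int m"
    by auto
  then obtain i where i: "x \<in> J i"
    using A(1) by (auto simp: word_def)
  have fin: "finite A" and inj: "inj_on abs A"
    using A(1) by (simp_all add: word_def)
  have d: "abs ` {x} \<inter> abs ` (A - {x}) = {}"
    using x(1) inj by (auto simp: inj_on_def)
  note U = word_Un[OF word_singleton(1)[OF disj i] word_subset[OF A(1), of "A - {x}"] d]
  have U': "wtype J A = axis i 1 + wtype J (A - {x})" "\<Sum>A = x + \<Sum>(A - {x})"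
    using U(2,3) x(1) word_singleton(2)[OF disj i] by (auto simp: insert_absorb)
  show ?thesis
  proof (rule that[OF x(2) _ i, of "snd \<beta> + wtype J (A - {x})"])
    show "\<bar>x\<bar> \<notin> X"
      using A(2) x(1) by blast
    show "snd \<gamma> = snd \<beta> + wtype J (A - {x}) + axis i 1"
      using A(3) U'(1) by (simp add: ac_simps)
    show "\<beta> \<in> below J (insert \<bar>x\<bar> X) (fst \<gamma> + x, snd \<beta> + wtype J (A - {x}))"
      unfolding below_def using A(2,4) U'(2) d word_subset[OF A(1), of "A - {x}"]
      by (intro CollectI exI[of _ "A - {x}"]) auto
  qed
qed

lemma below_insert:
  assumes "\<bar>x\<bar> \<notin> X" "x \<in> J i" "\<beta> \<in> below J (insert \<bar>x\<bar> X) (\<gamma>0 + x, \<eta>)"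
  shows "\<beta> \<in> below J X (\<gamma>0, \<eta> + axis i 1)"
proof -
  obtain A where A: "word J A" "abs ` A \<inter> insert \<bar>x\<bar> X = {}" "\<eta> = snd \<beta> + wtype J A" "fst \<beta> = \<gamma>0 + x + \<Sum>A"
    using assms(3) by (auto simp: below_def)
  have "abs ` {x} \<inter> abs ` A = {}"
    using A(2) by auto
  note U = word_Un[OF word_singleton(1)[OF disj assms(2)] A(1) this]
  show ?thesis
    unfolding below_def using U A assms(1) word_singleton(2)[OF disj assms(2)]
    by (intro CollectI exI[of _ "{x} \<union> A"]) (auto simp: ac_simps)
qed

definition degree :: "(nat, 'k) vec \<Rightarrow> nat" where
  "degree \<eta> = (\<Sum>i\<in>UNIV. \<eta> $ i)"

lemma degree_axis: "degree (\<eta> + axis i 1) = Suc (degree \<eta>)"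
  by (simp add: degree_def sum.distrib axis_def)

text \<open>Induction on the degree. After \<delta> has been separated from \<gamma>, the remaining
  points of the set pass through one of finitely many letters x and lie in sets of smaller degree,
  none of which contains \<delta>. A letter determines its index i by disjointness, so one bound for
  each x is enough.\<close>

lemma below_closed: "\<delta> \<notin> below J X \<gamma> \<Longrightarrow> \<exists>m. V \<delta> m \<inter> below J X \<gamma> = {}"
proof (induction "degree (snd \<gamma>)" arbitrary: \<gamma> X rule: less_induct)
  case less
  have "\<gamma> \<noteq> \<delta>"
    using less.prems below_self by blast
  then obtain m where m: "V \<gamma> m \<inter> V \<delta> m = {}"
    using V_separate by blast
  have "\<exists>k. \<forall>i \<eta>. \<bar>x\<bar> \<notin> X \<longrightarrow> x \<in> J i \<longrightarrow> snd \<gamma> = \<eta> + axis i 1 \<longrightarrow>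
      V \<delta> k \<inter> below J (insert \<bar>x\<bar> X) (fst \<gamma> + x, \<eta>) = {}" for x
  proof (cases "\<exists>i \<eta>. \<bar>x\<bar> \<notin> X \<and> x \<in> J i \<and> snd \<gamma> = \<eta> + axis i 1")
    case True
    then obtain i \<eta> where i: "\<bar>x\<bar> \<notin> X" "x \<in> J i" "snd \<gamma> = \<eta> + axis i 1"
      by blast
    have "\<delta> \<notin> below J (insert \<bar>x\<bar> X) (fst \<gamma> + x, \<eta>)"
      using below_insert[OF i(1,2)] less.prems i(3) by (metis prod.collapse)
    moreover have "degree \<eta> < degree (snd \<gamma>)"
      unfolding i(3) degree_axis by simp
    ultimately obtain k where k: "V \<delta> k \<inter> below J (insert \<bar>x\<bar> X) (fst \<gamma> + x, \<eta>) = {}"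
      using less.hyps[of "(fst \<gamma> + x, \<eta>)"] by auto
    have "i' = i \<and> \<eta>' = \<eta>" if "x \<in> J i'" "snd \<gamma> = \<eta>' + axis i' 1" for i' \<eta>'
    proof -
      have "i' = i"
        using disj i(2) that(1) by (auto simp: disjoint_family_on_def)
      then show ?thesis
        using that(2) i(3) by simp
    qed
    then show ?thesis
      using k by blast
  qed blast
  then obtain k where k: "\<And>x i \<eta>. \<bar>x\<bar> \<notin> X \<Longrightarrow> x \<in> J i \<Longrightarrow> snd \<gamma> = \<eta> + axis i 1 \<Longrightarrow>
      V \<delta> (k x) \<inter> below J (insert \<bar>x\<bar> X) (fst \<gamma> + x, \<eta>) = {}"
    by metis
  define M where "M = max m (Max (k ` {- int m..int m}))"
  have "\<alpha> \<notin> below J X \<gamma>" if \<alpha>: "\<alpha> \<in> V \<delta> M" for \<alpha>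
  proof
    assume 1: "\<alpha> \<in> below J X \<gamma>"
    have "\<alpha> \<notin> V \<gamma> m"
      using m \<alpha> V_antimono[of m M \<delta>] by (auto simp: M_def)
    with 1 obtain x i \<eta> where x: "\<bar>x\<bar> \<le> int m" "\<bar>x\<bar> \<notin> X" "x \<in> J i" "snd \<gamma> = \<eta> + axis i 1"
        "\<alpha> \<in> below J (insert \<bar>x\<bar> X) (fst \<gamma> + x, \<eta>)"
      by (rule below_cases)
    have "k x \<le> Max (k ` {- int m..int m})"
      using x(1) by (intro Max_ge imageI) (auto simp: abs_le_iff)
    then have "k x \<le> M"
      by (simp add: M_def)
    then have "\<alpha> \<in> V \<delta> (k x)"
      using \<alpha> V_antimono[of "k x" M \<delta>] by blast
    then show False
      using k[OF x(2-4)] x(5) by blast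
  qed
  then show ?case by blast
qed

text \<open>Induction on the degree: the prescribed neighbourhood of \<gamma> leaves uncovered only
  points lying in finitely many sets of smaller degree, one for each short first letter.\<close>

lemma below_compact: "\<exists>A. finite A \<and> below J X \<gamma> \<subseteq> (\<Union>\<alpha>\<in>A. V \<alpha> (N \<alpha>))"
proof (induction "degree (snd \<gamma>)" arbitrary: \<gamma> X rule: less_induct)
  case less
  define m where "m = N \<gamma>"
  have "\<exists>A. finite A \<and> (\<forall>i \<eta>. x \<in> J i \<longrightarrow> snd \<gamma> = \<eta> + axis i 1 \<longrightarrow>
      below J (insert \<bar>x\<bar> X) (fst \<gamma> + x, \<eta>) \<subseteq> (\<Union>\<alpha>\<in>A. V \<alpha> (N \<alpha>)))" for x
  proof (cases "\<exists>i \<eta>. x \<in> J i \<and> snd \<gamma> = \<eta> + axis i 1")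
    case True
    then obtain i \<eta> where i: "x \<in> J i" "snd \<gamma> = \<eta> + axis i 1"
      by blast
    have "degree \<eta> < degree (snd \<gamma>)"
      unfolding i(2) degree_axis by simp
    then obtain A where A: "finite A" "below J (insert \<bar>x\<bar> X) (fst \<gamma> + x, \<eta>) \<subseteq> (\<Union>\<alpha>\<in>A. V \<alpha> (N \<alpha>))"
      using less.hyps[of "(fst \<gamma> + x, \<eta>)" "insert \<bar>x\<bar> X"] by auto
    have "i' = i \<and> \<eta>' = \<eta>" if "x \<in> J i'" "snd \<gamma> = \<eta>' + axis i' 1" for i' \<eta>'
    proof -
      have "i' = i"
        using disj i(1) that(1) by (auto simp: disjoint_family_on_def)
      then show ?thesis
        using that(2) i(2) by simp
    qed
    then show ?thesis
      using A by blast
  qed blast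
  from choice[OF allI[OF this]] obtain A where
    "\<forall>x. finite (A x) \<and> (\<forall>i \<eta>. x \<in> J i \<longrightarrow> snd \<gamma> = \<eta> + axis i 1 \<longrightarrow>
      below J (insert \<bar>x\<bar> X) (fst \<gamma> + x, \<eta>) \<subseteq> (\<Union>\<alpha>\<in>A x. V \<alpha> (N \<alpha>)))" ..
  then have A: "\<And>x. finite (A x)" "\<And>x i \<eta>. x \<in> J i \<Longrightarrow> snd \<gamma> = \<eta> + axis i 1 \<Longrightarrow>
      below J (insert \<bar>x\<bar> X) (fst \<gamma> + x, \<eta>) \<subseteq> (\<Union>\<alpha>\<in>A x. V \<alpha> (N \<alpha>))"
    by simp_all
  define B where "B = insert \<gamma> (\<Union>x\<in>{- int m..int m}. A x)"
  have "\<beta> \<in> (\<Union>\<alpha>\<in>B. V \<alpha> (N \<alpha>))" if \<beta>: "\<beta> \<in> below J X \<gamma>" for \<beta>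
  proof (cases "\<beta> \<in> V \<gamma> m")
    case True
    then show ?thesis
      by (auto simp: B_def m_def)
  next
    case False
    with \<beta> obtain x i \<eta> where x: "\<bar>x\<bar> \<le> int m" "\<bar>x\<bar> \<notin> X" "x \<in> J i" "snd \<gamma> = \<eta> + axis i 1"
        "\<beta> \<in> below J (insert \<bar>x\<bar> X) (fst \<gamma> + x, \<eta>)"
      by (rule below_cases)
    have "x \<in> {- int m..int m}"
      using x(1) by auto
    then show ?thesis
      using A(2)[OF x(3,4)] x(5) unfolding B_def by blast
  qed
  moreover have "finite B"
    using A(1) by (simp add: B_def)
  ultimately show ?case by blast
qed

text \<open>The sets \<open>V (from_nat k) 0\<close> are countably many compact open sets covering
  the semigroup, and every compact set lies in a finite union of them. The complements of the
  initial unions therefore form a decreasing base at infinity.\<close>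

definition nbS :: "'k S \<Rightarrow> nat \<Rightarrow> 'k S set" where
  "nbS s n = (case s of Some \<gamma> \<Rightarrow> Some ` V \<gamma> n | None \<Rightarrow> - Some ` (\<Union>k<n. V (from_nat k) 0))"

lemma nbS_simps: "nbS (Some \<gamma>) n = Some ` V \<gamma> n" "nbS None n = - Some ` (\<Union>k<n. V (from_nat k) 0)"
  by (simp_all add: nbS_def)

sublocale clopen_base nbS
proof
  show "s \<in> nbS s n" for s n
    by (cases s) (simp_all add: nbS_def below_self)
  show "nbS s n \<subseteq> nbS s m" if "m \<le> n" for s m n
    using V_antimono[OF that] that by (cases s) (fastforce simp: nbS_def)+
  show "\<exists>m. nbS t m \<subseteq> nbS s n" if t: "t \<in> nbS s n" for s t n
  proof (cases s)
    case (Some \<gamma>)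
    then obtain \<beta> where \<beta>: "t = Some \<beta>" "\<beta> \<in> V \<gamma> n"
      using t by (auto simp: nbS_def)
    obtain m where "V \<beta> m \<subseteq> V \<gamma> n"
      using V_open[OF \<beta>(2)] by blast
    then show ?thesis
      unfolding Some \<beta>(1) nbS_simps by blast
  next
    case None
    show ?thesis
    proof (cases t)
      case (Some \<beta>)
      then have "\<beta> \<notin> V (from_nat k) 0" if "k < n" for k
        using \<open>t \<in> nbS s n\<close> None that by (auto simp: nbS_def)
      then have "\<forall>k. \<exists>m. k < n \<longrightarrow> V \<beta> m \<inter> V (from_nat k) 0 = {}"
        using below_closed by blast
      then obtain m where m: "\<And>k. k < n \<Longrightarrow> V \<beta> (m k) \<inter> V (from_nat k) 0 = {}"
        by metis
      have "m k \<le> Max (m ` {..<n})" if "k < n" for k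
        using that by (intro Max_ge) auto
      then have "V \<beta> (Max (m ` {..<n})) \<inter> V (from_nat k) 0 = {}" if "k < n" for k
        using m[OF that] V_antimono[of "m k" _ \<beta>] that by blast
      then have "nbS t (Max (m ` {..<n})) \<subseteq> nbS s n"
        unfolding Some None nbS_simps by blast
      then show ?thesis ..
    qed (use None in blast)
  qed
  show "\<exists>m. nbS t m \<inter> nbS s n = {}" if t: "t \<notin> nbS s n" for s t n
  proof (cases s)
    case (Some \<gamma>)
    show ?thesis
    proof (cases t)
      case None
      have "V \<gamma> n \<subseteq> V (from_nat (to_nat \<gamma>)) 0"
        using V_antimono[of 0 n] by simp
      then have "nbS t (Suc (to_nat \<gamma>)) \<inter> nbS s n = {}"
        unfolding Some None nbS_simps by blast
      then show ?thesis ..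
    next
      case (Some \<beta>)
      then have "\<beta> \<notin> V \<gamma> n"
        using t \<open>s = Some \<gamma>\<close> by (auto simp: nbS_def)
      then obtain m where "V \<beta> m \<inter> V \<gamma> n = {}"
        using below_closed by blast
      then have "nbS t m \<inter> nbS s n = {}"
        unfolding Some \<open>s = Some \<gamma>\<close> nbS_simps by blast
      then show ?thesis ..
    qed
  next
    case None
    then obtain \<beta> k where \<beta>: "t = Some \<beta>" "k < n" "\<beta> \<in> V (from_nat k) 0"
      using t by (auto simp: nbS_def)
    obtain m where "V \<beta> m \<subseteq> V (from_nat k) 0"
      using V_open[OF \<beta>(3)] by blast
    then have "nbS t m \<inter> nbS s n = {}"
      unfolding None \<beta>(1) nbS_simps using \<beta>(2) by blast
    then show ?thesis ..
  qed
  show "\<exists>n. t \<notin> nbS s n" if t: "s \<noteq> t" for s t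
  proof (cases s)
    case (Some \<gamma>)
    show ?thesis
    proof (cases t)
      case None
      then show ?thesis
        using Some by (auto simp: nbS_def)
    next
      case (Some \<beta>)
      then obtain m where "V \<gamma> m \<inter> V \<beta> m = {}"
        using V_separate \<open>s = Some \<gamma>\<close> t by blast
      then have "\<beta> \<notin> V \<gamma> m"
        using below_self by blast
      then show ?thesis
        unfolding Some \<open>s = Some \<gamma>\<close> nbS_simps by blast
    qed
  next
    case None
    then obtain \<beta> where \<beta>: "t = Some \<beta>"
      using t by (cases t) auto
    have "\<beta> \<in> V (from_nat (to_nat \<beta>)) 0"
      using below_self by simp
    then have "t \<notin> nbS s (Suc (to_nat \<beta>))"
      unfolding None \<beta> nbS_simps by blast
    then show ?thesis ..
  qed
  show "\<exists>A. finite A \<and> (\<Union>s\<in>A. nbS s (N s)) = UNIV" for N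
  proof -
    have "\<exists>A. finite A \<and> V (from_nat k) 0 \<subseteq> (\<Union>\<alpha>\<in>A. V \<alpha> (N (Some \<alpha>)))" for k
      by (rule below_compact[where N="\<lambda>\<alpha>. N (Some \<alpha>)"])
    from choice[OF allI[OF this]] obtain A where
      "\<forall>k. finite (A k) \<and> V (from_nat k) 0 \<subseteq> (\<Union>\<alpha>\<in>A k. V \<alpha> (N (Some \<alpha>)))" ..
    then have A: "\<And>k. finite (A k)" "\<And>k. V (from_nat k) 0 \<subseteq> (\<Union>\<alpha>\<in>A k. V \<alpha> (N (Some \<alpha>)))"
      by blast+
    define B where "B = insert None (Some ` (\<Union>k<N None. A k))"
    have "s \<in> (\<Union>s\<in>B. nbS s (N s))" for s
    proof (cases "s \<in> nbS None (N None)")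
      case False
      then obtain \<beta> k where "s = Some \<beta>" "k < N None" "\<beta> \<in> V (from_nat k) 0"
        by (auto simp: nbS_def)
      then obtain \<alpha> where "\<alpha> \<in> A k" "\<beta> \<in> V \<alpha> (N (Some \<alpha>))"
        using A(2)[of k] by blast
      then show ?thesis
        using \<open>s = Some \<beta>\<close> \<open>k < N None\<close> by (auto simp: B_def nbS_simps)
    qed (simp add: B_def)
    moreover have "finite B"
      using A(1) by (simp add: B_def)
    ultimately show ?thesis by blast
  qed
qed

section \<open>Agreement with the given topologies on the semigroup and its compactification\<close>

lemma openin_T: "openin (T_topology J) U \<longleftrightarrow> (\<forall>\<gamma>\<in>U. \<exists>n. V \<gamma> n \<subseteq> U)"
  by (simp add: openin_T_topology T_nbhd_eq_below[OF disj])

lemma topspace_T: "topspace (T_topology J) = UNIV"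
proof -
  have "openin (T_topology J) UNIV"
    by (simp add: openin_T)
  then show ?thesis
    using openin_subset by blast
qed

lemma openin_V: "openin (T_topology J) (V \<gamma> n)"
  unfolding openin_T using V_open by blast

lemma compactin_V: "compactin (T_topology J) (V \<gamma> n)"
  unfolding compactin_def topspace_T
proof (intro conjI allI impI, simp)
  fix \<U> assume U: "(\<forall>U\<in>\<U>. openin (T_topology J) U) \<and> V \<gamma> n \<subseteq> \<Union> \<U>"
  have "\<exists>m W. V \<alpha> m \<inter> V \<gamma> n = {} \<or> W \<in> \<U> \<and> V \<alpha> m \<subseteq> W" for \<alpha>
  proof (cases "\<alpha> \<in> V \<gamma> n")
    case True
    then obtain W where "W \<in> \<U>" "\<alpha> \<in> W"
      using U by blast
    then show ?thesis
      using U unfolding openin_T by blast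
  qed (use below_closed in blast)
  then obtain N W where NW: "\<And>\<alpha>. V \<alpha> (N \<alpha>) \<inter> V \<gamma> n = {} \<or> W \<alpha> \<in> \<U> \<and> V \<alpha> (N \<alpha>) \<subseteq> W \<alpha>"
    by metis
  obtain A where A: "finite A" "V \<gamma> n \<subseteq> (\<Union>\<alpha>\<in>A. V \<alpha> (N \<alpha>))"
    using below_compact[of "{..int n}" \<gamma> N] by blast
  have "V \<gamma> n \<subseteq> \<Union>(W ` A \<inter> \<U>)"
  proof
    fix \<beta> assume "\<beta> \<in> V \<gamma> n"
    then obtain \<alpha> where "\<alpha> \<in> A" "\<beta> \<in> V \<alpha> (N \<alpha>)"
      using A(2) by blast
    then show "\<beta> \<in> \<Union>(W ` A \<inter> \<U>)"
      using NW[of \<alpha>] \<open>\<beta> \<in> V \<gamma> n\<close> by blast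
  qed
  then show "\<exists>\<F>. finite \<F> \<and> \<F> \<subseteq> \<U> \<and> V \<gamma> n \<subseteq> \<Union> \<F>"
    using A(1) by (intro exI[of _ "W ` A \<inter> \<U>"]) auto
qed

text \<open>The point at infinity is the only issue. A compact set is covered by finitely many of
  the open sets \<open>V (from_nat k) 0\<close>; conversely a finite union of these is compact, and
  so is each closed set inside it.\<close>

lemma openin_S_topology: "openin (S_topology J) U \<longleftrightarrow> (\<forall>s\<in>U. \<exists>n. nbS s n \<subseteq> U)"
proof
  assume "openin (S_topology J) U"
  then consider (fin) W where "openin (T_topology J) W" "U = Some ` W"
    | (inf) C where "compactin (T_topology J) C" "closedin (T_topology J) C" "U = insert None (Some ` (- C))"
    unfolding S_topology_def openin_Alexandroff_compactification topspace_T by (auto simp: Compl_eq_Diff_UNIV)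
  then show "\<forall>s\<in>U. \<exists>n. nbS s n \<subseteq> U"
  proof cases
    case fin
    show ?thesis
    proof
      fix s assume "s \<in> U"
      then obtain \<gamma> where \<gamma>: "s = Some \<gamma>" "\<gamma> \<in> W"
        using fin(2) by blast
      then obtain n where "V \<gamma> n \<subseteq> W"
        using fin(1) unfolding openin_T by blast
      then show "\<exists>n. nbS s n \<subseteq> U"
        unfolding \<gamma>(1) fin(2) nbS_simps by blast
    qed
  next
    case inf
    have "\<exists>n. nbS s n \<subseteq> U" if "s \<in> U" for s
    proof (cases s)
      case None
      have "\<exists>\<F>. finite \<F> \<and> \<F> \<subseteq> range (\<lambda>k. V (from_nat k) 0) \<and> C \<subseteq> \<Union>\<F>"
      proof (rule compactinD[OF inf(1)])
        show "C \<subseteq> \<Union> (range (\<lambda>k. V (from_nat k) 0))"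
        proof
          fix \<beta> assume "\<beta> \<in> C"
          have "\<beta> \<in> V (from_nat (to_nat \<beta>)) 0"
            using below_self by simp
          then show "\<beta> \<in> \<Union> (range (\<lambda>k. V (from_nat k) 0))" by blast
        qed
      qed (auto simp: openin_V[where n=0, simplified])
      then obtain K where K: "finite K" "C \<subseteq> (\<Union>k\<in>K. V (from_nat k) 0)"
        by (metis finite_subset_image)
      obtain n where n: "K \<subseteq> {..<n}"
        using K(1) finite_nat_iff_bounded by blast
      have "t \<in> U" if t: "t \<in> nbS s n" for t
      proof (cases t)
        case (Some \<beta>)
        then have "\<beta> \<notin> C"
          using t K(2) n unfolding None nbS_simps by blast
        then show ?thesis
          by (simp add: Some inf(3))
      qed (simp add: inf(3))
      then show ?thesis by blast
    next
      case (Some \<beta>)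
      then have "\<beta> \<in> - C"
        using that inf(3) by auto
      moreover have "openin (T_topology J) (- C)"
        using inf(2) by (simp add: closedin_def topspace_T Compl_eq_Diff_UNIV)
      ultimately obtain n where "V \<beta> n \<subseteq> - C"
        unfolding openin_T by blast
      then show ?thesis
        unfolding Some nbS_simps inf(3) by blast
    qed
    then show ?thesis by blast
  qed
next
  assume U: "\<forall>s\<in>U. \<exists>n. nbS s n \<subseteq> U"
  define W where "W = {\<gamma>. Some \<gamma> \<in> U}"
  have W: "openin (T_topology J) W"
    unfolding openin_T
  proof
    fix \<gamma> assume "\<gamma> \<in> W"
    then obtain n where "nbS (Some \<gamma>) n \<subseteq> U"
      using U by (auto simp: W_def)
    then show "\<exists>n. V \<gamma> n \<subseteq> W"
      unfolding nbS_simps W_def by blast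
  qed
  show "openin (S_topology J) U"
  proof (cases "None \<in> U")
    case False
    then have "t \<in> Some ` W" if "t \<in> U" for t
      using that by (cases t) (auto simp: W_def)
    then have "U = Some ` W"
      by (auto simp: W_def)
    then show ?thesis
      using W by (simp add: S_topology_def)
  next
    case True
    then obtain n where n: "nbS None n \<subseteq> U"
      using U by blast
    have closed: "closedin (T_topology J) (- W)"
      using W by (simp add: closedin_def topspace_T Compl_eq_Diff_UNIV Diff_Diff_Int)
    have "compactin (T_topology J) (\<Union>((\<lambda>k. V (from_nat k) 0) ` {..<n}))"
      by (rule compactin_Union) (auto simp: compactin_V[where n=0, simplified])
    moreover have "- W \<subseteq> \<Union>((\<lambda>k. V (from_nat k) 0) ` {..<n})"
      using n unfolding nbS_simps W_def by blast
    ultimately have "compactin (T_topology J) (- W)"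
      using closed by (rule closed_compactin)
    moreover have "U = insert None (Some ` (topspace (T_topology J) - (- W)))"
    proof (rule set_eqI)
      show "t \<in> U \<longleftrightarrow> t \<in> insert None (Some ` (topspace (T_topology J) - (- W)))" for t
        using True by (cases t) (auto simp: W_def topspace_T)
    qed
    ultimately show ?thesis
      using closed unfolding S_topology_def openin_Alexandroff_compactification by blast
  qed
qed

lemma C_S_eq_cfun: "C_S J = cfun"
proof -
  have "openin (S_topology J) UNIV"
    by (simp add: openin_S_topology)
  then have top: "topspace (S_topology J) = UNIV"
    using openin_subset by blast
  have "continuous_map (S_topology J) euclidean f \<longleftrightarrow> f \<in> cfun" for f :: "'k S \<Rightarrow> complex"
  proof
    assume f: "continuous_map (S_topology J) euclidean f"
    show "f \<in> cfun"
      unfolding cfun_def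
    proof (intro CollectI allI impI)
      fix s and e :: real assume e: "e > 0"
      have "openin (S_topology J) {t \<in> topspace (S_topology J). f t \<in> ball (f s) e}"
        by (rule openin_continuous_map_preimage[OF f]) simp
      from this[unfolded openin_S_topology, rule_format, of s]
      obtain n where "nbS s n \<subseteq> {t. f t \<in> ball (f s) e}"
        using e by (auto simp: top)
      then have "\<forall>t\<in>nbS s n. norm (f t - f s) < e"
        by (auto simp: dist_norm norm_minus_commute)
      then show "\<exists>n. \<forall>t\<in>nbS s n. norm (f t - f s) < e" ..
    qed
  next
    assume f: "f \<in> cfun"
    show "continuous_map (S_topology J) euclidean f"
      unfolding continuous_map openin_S_topology
    proof (intro conjI allI impI ballI)
      fix U s assume U: "openin euclidean U" and s: "s \<in> {x \<in> topspace (S_topology J). f x \<in> U}"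
      then obtain e where e: "e > 0" "ball (f s) e \<subseteq> U"
        by (auto simp: open_contains_ball)
      obtain n where "\<forall>t\<in>nbS s n. norm (f t - f s) < e"
        using cfunD[OF f e(1)] by blast
      then have "nbS s n \<subseteq> {x \<in> topspace (S_topology J). f x \<in> U}"
        using e(2) by (auto simp: top dist_norm norm_minus_commute subset_iff)
      then show "\<exists>n. nbS s n \<subseteq> {x \<in> topspace (S_topology J). f x \<in> U}" ..
    qed simp
  qed
  then show ?thesis
    by (auto simp: C_S_def)
qed

section \<open>Continuity of translations\<close>

lemma V_add_iff: "\<beta> + \<delta> \<in> V (\<gamma> + \<delta>) n \<longleftrightarrow> \<beta> \<in> V \<gamma> n"
  using below_add[of "fst \<beta>" "fst \<delta>" "snd \<beta>" "snd \<delta>" J "{..int n}" "fst \<gamma>" "snd \<gamma>"] by (simp add: plus_prod_def)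

text \<open>At finite points translation by \<delta> matches basic neighbourhoods exactly. At
  infinity the map must be shown proper: the preimages of the sets \<open>V \<gamma> 0\<close> are
  covered by finitely many such sets.\<close>

lemma cfun_translate:
  assumes f: "f \<in> cfun"
  shows "(\<lambda>s. f (S_plus s t)) \<in> cfun"
proof (cases t)
  case (Some \<delta>)
  show ?thesis
    unfolding cfun_def
  proof (intro CollectI allI impI)
    fix s and e :: real assume e: "e > 0"
    show "\<exists>n. \<forall>u\<in>nbS s n. norm (f (S_plus u t) - f (S_plus s t)) < e"
    proof (cases s)
      case (Some \<gamma>)
      obtain n where n: "\<forall>t\<in>nbS (Some (\<gamma> + \<delta>)) n. norm (f t - f (Some (\<gamma> + \<delta>))) < e"
        using cfunD[OF f e] by blast
      have "norm (f (S_plus u t) - f (S_plus s t)) < e" if "u \<in> nbS s n" for u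
        using that n unfolding \<open>t = Some \<delta>\<close> Some nbS_simps by (auto simp: V_add_iff)
      then show ?thesis by blast
    next
      case None
      obtain n where n: "\<forall>t\<in>nbS None n. norm (f t - f None) < e"
        using cfunD[OF f e] by blast
      \<comment> \<open>The preimage is \<open>V \<rho> 0\<close> when \<gamma> = \<rho> + \<delta>.
        Otherwise it is empty: points of \<open>V \<gamma> 0\<close> lie below \<gamma> in
        coordinates 1 to k, so \<gamma> would dominate \<delta> there and the difference \<rho>
        would exist.\<close>
      have "\<exists>A. finite A \<and> {\<beta>. \<beta> + \<delta> \<in> V \<gamma> 0} \<subseteq> (\<Union>\<alpha>\<in>A. V \<alpha> 0)" for \<gamma>
      proof (cases "\<exists>\<rho>. \<gamma> = \<rho> + \<delta>")
        case True
        then obtain \<rho> where "\<gamma> = \<rho> + \<delta>" ..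
        then have "{\<beta>. \<beta> + \<delta> \<in> V \<gamma> 0} = V \<rho> 0"
          by (simp only: V_add_iff Collect_mem_eq)
        then show ?thesis
          by (intro exI[of _ "{\<rho>}"]) simp
      next
        case False
        have "\<beta> + \<delta> \<notin> V \<gamma> 0" for \<beta>
        proof
          assume "\<beta> + \<delta> \<in> V \<gamma> 0"
          then obtain A where "snd \<gamma> = snd (\<beta> + \<delta>) + wtype J A"
            unfolding below_def by blast
          then have "\<gamma> = (fst \<gamma> - fst \<delta>, snd \<beta> + wtype J A) + \<delta>"
            by (simp add: prod_eq_iff add.assoc add.commute[of "wtype J A"])
          then show False
            using False by blast
        qed
        then show ?thesis
          by (intro exI[of _ "{}"]) auto
      qed
      from choice[OF allI[OF this]] obtain A where
        "\<forall>\<gamma>. finite (A \<gamma>) \<and> {\<beta>. \<beta> + \<delta> \<in> V \<gamma> 0} \<subseteq> (\<Union>\<alpha>\<in>A \<gamma>. V \<alpha> 0)" ..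
      then have A: "\<And>\<gamma>. finite (A \<gamma>)" "\<And>\<gamma>. {\<beta>. \<beta> + \<delta> \<in> V \<gamma> 0} \<subseteq> (\<Union>\<alpha>\<in>A \<gamma>. V \<alpha> 0)"
        by blast+
      have "finite (to_nat ` (\<Union>k<n. A (from_nat k)))"
        using A(1) by simp
      then obtain m where m: "to_nat ` (\<Union>k<n. A (from_nat k)) \<subseteq> {..<m}"
        using finite_nat_iff_bounded by blast
      have "S_plus u t \<in> nbS None n" if u: "u \<in> nbS None m" for u
      proof (rule ccontr)
        assume "S_plus u t \<notin> nbS None n"
        then obtain \<beta> k where \<beta>: "u = Some \<beta>" "k < n" "\<beta> + \<delta> \<in> V (from_nat k) 0"
          unfolding nbS_simps Some by (cases u) auto
        then obtain \<alpha> where \<alpha>: "\<alpha> \<in> A (from_nat k)" "\<beta> \<in> V \<alpha> 0"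
          using A(2) by blast
        then have "to_nat \<alpha> < m" "\<beta> \<in> V (from_nat (to_nat \<alpha>)) 0"
          using m \<beta>(2) by auto
        then show False
          using u unfolding \<beta>(1) nbS_simps by blast
      qed
      then show ?thesis
        using n by (auto simp: None)
    qed
  qed
qed (simp add: cfun_const)

end

section \<open>Weak-star limits in the kernel of the projection\<close>

lemma lin_on_sum:
  assumes "lin_closed V" "lin_on V \<phi>" "finite I" "\<And>i. i \<in> I \<Longrightarrow> f i \<in> V"
  shows "(\<lambda>s. \<Sum>i\<in>I. f i s) \<in> V" "\<phi> (\<lambda>s. \<Sum>i\<in>I. f i s) = (\<Sum>i\<in>I. \<phi> (f i))"
  using lin_sum(1)[OF assms(1,3), of f "\<lambda>_. 1"] lin_sum(2)[OF assms(1,3) _ assms(2), of f "\<lambda>_. 1"] assms(4)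
  by simp_all

text \<open>The image measure under \<open>h\<close>, meaningful for injective
  \<open>h\<close>.\<close>

definition push :: "('b \<Rightarrow> 'a) \<Rightarrow> ('b \<Rightarrow> complex) \<Rightarrow> 'a \<Rightarrow> complex" where
  "push h b s = (if s \<in> range h then b (inv h s) else 0)"

lemma has_sum_push:
  fixes g :: "'a \<Rightarrow> 'c::{comm_monoid_add, topological_space}"
  assumes h: "inj h" and g: "((\<lambda>t. g (h t)) has_sum x) UNIV" and 0: "\<And>s. s \<notin> range h \<Longrightarrow> g s = 0"
  shows "(g has_sum x) UNIV"
proof -
  have "(g has_sum x) (range h)"
    using g has_sum_reindex[OF h, of g x] by (simp add: o_def)
  then show ?thesis
    using 0 has_sum_cong_neutral[of "range h" UNIV g g x] by auto
qed

lemma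
  assumes h: "inj h" and b: "b \<in> l1"
  shows push_l1: "push h b \<in> l1" "l1_norm (push h b) = l1_norm b"
    and pairing_push: "f \<in> linf \<Longrightarrow> pairing f (push h b) = pairing (\<lambda>t. f (h t)) b"
proof -
  have "((\<lambda>s. norm (push h b s)) has_sum l1_norm b) UNIV"
  proof (rule has_sum_push[OF h])
    show "((\<lambda>t. norm (push h b (h t))) has_sum l1_norm b) UNIV"
      using b by (simp add: push_def inv_f_f[OF h] l1_norm_def l1_def)
  qed (simp add: push_def)
  then show "push h b \<in> l1" "l1_norm (push h b) = l1_norm b"
    by (auto simp: l1_def l1_norm_def has_sum_imp_summable infsumI)
  assume f: "f \<in> linf"
  have fh: "(\<lambda>t. f (h t)) \<in> linf"
    by (rule linfI, rule linf_norm_ge[OF f])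
  have "((\<lambda>s. f s * push h b s) has_sum pairing (\<lambda>t. f (h t)) b) UNIV"
  proof (rule has_sum_push[OF h])
    show "((\<lambda>t. f (h t) * push h b (h t)) has_sum pairing (\<lambda>t. f (h t)) b) UNIV"
      using pairing_has_sum[OF fh b] by (simp add: push_def inv_f_f[OF h])
  qed (simp add: push_def)
  then show "pairing f (push h b) = pairing (\<lambda>t. f (h t)) b"
    by (simp add: pairing_def infsumI)
qed

lemma l1_pull:
  assumes h: "inj h" and b: "b \<in> l1"
  shows "(\<lambda>t. b (h t)) \<in> l1" "l1_norm (\<lambda>t. b (h t)) \<le> l1_norm b"
proof -
  have *: "(\<Sum>t\<in>A. norm (b (h t))) \<le> l1_norm b" if "finite A" for A
  proof -
    have "(\<Sum>t\<in>A. norm (b (h t))) = (\<Sum>s\<in>h ` A. norm (b s))"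
      using inj_on_subset[OF h] by (subst sum.reindex) auto
    also have "\<dots> \<le> l1_norm b"
      using that by (intro l1_norm_sum_le b) auto
    finally show ?thesis .
  qed
  show "(\<lambda>t. b (h t)) \<in> l1" "l1_norm (\<lambda>t. b (h t)) \<le> l1_norm b"
    by (rule l1I[OF *]; assumption)+
qed

text \<open>The part of the measure carried by \<open>A\<close>, still defined on the whole
  space.\<close>

definition rst :: "'a set \<Rightarrow> ('a \<Rightarrow> complex) \<Rightarrow> 'a \<Rightarrow> complex" where
  "rst A \<mu> = (\<lambda>s. if s \<in> A then \<mu> s else 0)"

lemma rst_l1: "\<mu> \<in> l1 \<Longrightarrow> rst A \<mu> \<in> l1" "\<mu> \<in> l1 \<Longrightarrow> l1_norm (rst A \<mu>) \<le> l1_norm \<mu>"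
  using l1_dominated[of \<mu> "rst A \<mu>"] by (auto simp: rst_def)

lemma pairing_rst_range:
  assumes h: "inj h" and \<mu>: "\<mu> \<in> l1" and A: "A \<subseteq> range h" and f: "f \<in> linf"
  shows "pairing f (rst A \<mu>) = pairing (\<lambda>t. f (h t)) (\<lambda>t. rst A \<mu> (h t))"
proof -
  have "push h (\<lambda>t. rst A \<mu> (h t)) = rst A \<mu>"
    using A by (auto simp: push_def rst_def fun_eq_iff f_inv_into_f)
  then show ?thesis
    using pairing_push[OF h l1_pull(1)[OF h rst_l1(1)[OF \<mu>, of A]] f] by simp
qed

lemma pairing_rst_UN:
  assumes "finite I" "\<mu> \<in> l1" "f \<in> linf" "disjoint_family_on A I"
  shows "pairing f (rst (\<Union>i\<in>I. A i) \<mu>) = (\<Sum>i\<in>I. pairing f (rst (A i) \<mu>))"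
proof -
  have "rst (\<Union>i\<in>I. A i) \<mu> s = (\<Sum>i\<in>I. rst (A i) \<mu> s)" for s
  proof (cases "\<exists>i\<in>I. s \<in> A i")
    case True
    then obtain i where i: "i \<in> I" "s \<in> A i"
      by blast
    have "(\<Sum>j\<in>I. rst (A j) \<mu> s) = (\<Sum>j\<in>{i}. rst (A j) \<mu> s)"
      using assms(1,4) i by (intro sum.mono_neutral_right) (auto simp: rst_def disjoint_family_on_def)
    then show ?thesis
      using i by (auto simp: rst_def)
  qed (auto simp: rst_def)
  then have "rst (\<Union>i\<in>I. A i) \<mu> = (\<lambda>s. \<Sum>i\<in>I. rst (A i) \<mu> s)"
    by blast
  then show ?thesis
    using pairing_sum_right[OF assms(1,3), of "\<lambda>i. rst (A i) \<mu>"] rst_l1(1)[OF assms(2)] by simp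
qed

lemma inj_S_int: "inj S_int"
  by (auto simp: inj_def S_int_def)

lemma l1_embed_eq_push: "l1_embed b = push S_int b"
proof
  fix s :: "'a S"
  show "l1_embed b s = push S_int b s"
  proof (cases "s \<in> range S_int")
    case True
    then obtain n where "s = S_int n" by blast
    then show ?thesis
      by (simp add: push_def inv_f_f[OF inj_S_int]) (simp add: l1_embed_def S_int_def)
  next
    case False
    then show ?thesis
      unfolding push_def l1_embed_def S_int_def by (auto split: option.splits simp: image_iff prod_eq_iff)
  qed
qed

lemmas l1_embed_l1 = push_l1[OF inj_S_int, folded l1_embed_eq_push]

lemma pairing_l1_embed: "f \<in> linf \<Longrightarrow> b \<in> l1 \<Longrightarrow> pairing f (l1_embed b) = pairing (restrict_int f) b"
  unfolding l1_embed_eq_push restrict_int_def by (rule pairing_push[OF inj_S_int])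

lemma restrict_int_linf: "f \<in> linf \<Longrightarrow> restrict_int f \<in> linf"
  unfolding restrict_int_def by (rule linfI) (rule linf_norm_ge)

lemma l1_embed_delta: "l1_embed (delta n) = delta (S_int n)"
  by (auto simp: fun_eq_iff l1_embed_def delta_def S_int_def prod_eq_iff split: option.splits)

lemma conv_pow_Suc: "conv_pow a (Suc m) = conv (+) a (conv_pow a m)"
  by (simp add: conv_pow_def)

lemma conv_pow_l1: "a \<in> l1 \<Longrightarrow> conv_pow a m \<in> l1"
  by (induction m) (simp_all add: conv_pow_Suc conv_l1, simp add: conv_pow_def delta_l1)

definition S_pow :: "'k \<Rightarrow> nat \<Rightarrow> ('k::finite) S" where
  "S_pow i r = Some (0, axis i r)"

lemma S_pow_0: "S_pow i 0 = S_int 0"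
  by (simp add: S_pow_def S_int_def vec_eq_iff axis_def)

lemma S_pow_Suc: "S_pow i (Suc r) = S_plus (S_unit i) (S_pow i r)"
  by (simp add: S_pow_def S_unit_def vec_eq_iff axis_def)

locale theta = J_sets J for J :: "'k::finite \<Rightarrow> int set" +
  fixes a :: "'k \<Rightarrow> int \<Rightarrow> complex" and \<Theta> :: "('k S \<Rightarrow> complex) \<Rightarrow> int \<Rightarrow> complex"
  assumes a_l1: "\<And>i. a i \<in> l1"
    and a_tendsto: "\<And>i. (\<lambda>m. linf_norm (conv_pow (a i) m)) \<longlonglongrightarrow> 0"
    and \<Theta>: "bounded_hom_projection \<Theta>"
    and \<Theta>_unit: "\<And>i. \<Theta> (delta (S_unit i)) = a i"
begin

lemma \<Theta>_l1: "\<mu> \<in> l1 \<Longrightarrow> \<Theta> \<mu> \<in> l1"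
  and \<Theta>_lincomb: "\<mu> \<in> l1 \<Longrightarrow> \<nu> \<in> l1 \<Longrightarrow> \<Theta> (\<lambda>s. c * \<mu> s + d * \<nu> s) = (\<lambda>n. c * \<Theta> \<mu> n + d * \<Theta> \<nu> n)"
  and \<Theta>_embed: "b \<in> l1 \<Longrightarrow> \<Theta> (l1_embed b) = b"
  and \<Theta>_conv: "\<mu> \<in> l1 \<Longrightarrow> \<nu> \<in> l1 \<Longrightarrow> \<Theta> (conv S_plus \<mu> \<nu>) = conv (+) (\<Theta> \<mu>) (\<Theta> \<nu>)"
  using \<Theta> unfolding bounded_hom_projection_def by blast+

text \<open>A bound for the norm of \<open>\<Theta>\<close>, chosen nonnegative so that it can
  multiply inequalities.\<close>

definition C :: real where
  "C = (SOME C. C \<ge> 0 \<and> (\<forall>\<mu>\<in>l1. l1_norm (\<Theta> \<mu>) \<le> C * l1_norm \<mu>))"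

lemma C_props: "C \<ge> 0 \<and> (\<forall>\<mu>\<in>l1. l1_norm (\<Theta> \<mu>) \<le> C * l1_norm \<mu>)"
proof -
  obtain C' where C': "\<forall>\<mu>\<in>l1. l1_norm (\<Theta> \<mu>) \<le> C' * l1_norm \<mu>"
    using \<Theta> unfolding bounded_hom_projection_def by blast
  have "l1_norm (\<Theta> \<mu>) \<le> \<bar>C'\<bar> * l1_norm \<mu>" if "\<mu> \<in> l1" for \<mu>
    using C' that mult_right_mono[OF abs_ge_self[of C'] l1_norm_nonneg[of \<mu>]] by fastforce
  then have "\<exists>C\<ge>0. \<forall>\<mu>\<in>l1. l1_norm (\<Theta> \<mu>) \<le> C * l1_norm \<mu>"
    by (intro exI[of _ "\<bar>C'\<bar>"]) auto
  then show ?thesis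
    unfolding C_def by (rule someI_ex)
qed

lemma C_nonneg: "C \<ge> 0"
  and \<Theta>_bound: "\<mu> \<in> l1 \<Longrightarrow> l1_norm (\<Theta> \<mu>) \<le> C * l1_norm \<mu>"
  using C_props by blast+

definition \<theta> :: "'k S \<Rightarrow> int \<Rightarrow> complex" where
  "\<theta> s = \<Theta> (delta s)"

lemma \<theta>_l1: "\<theta> s \<in> l1"
  and \<theta>_bound: "l1_norm (\<theta> s) \<le> C"
  using \<Theta>_l1[OF delta_l1(1), of s] \<Theta>_bound[OF delta_l1(1), of s] by (simp_all add: \<theta>_def delta_l1(2))

lemma \<theta>_plus: "\<theta> (S_plus s t) = conv (+) (\<theta> s) (\<theta> t)"
  using \<Theta>_conv[OF delta_l1(1) delta_l1(1), of s t] by (simp add: \<theta>_def conv_delta_delta)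

lemma \<theta>_int: "\<theta> (S_int n) = delta n"
  using \<Theta>_embed[OF delta_l1(1), of n] by (simp add: \<theta>_def l1_embed_delta)

text \<open>Since the point at infinity absorbs translations, \<open>\<theta> None\<close> is
  invariant under convolution with \<open>delta 1\<close>, so it is constant, and a constant in
  \<open>l1\<close> over the integers is 0.\<close>

lemma \<theta>_None: "\<theta> None = (\<lambda>_. 0)"
proof -
  let ?b = "\<theta> None"
  have "?b = conv (+) ?b (delta 1)"
    using \<theta>_plus[of None "S_int 1"] by (simp add: \<theta>_int)
  then have step: "?b n = ?b (n - 1)" for n
    using conv_int[OF \<theta>_l1 delta_l1(1), of None 1 n] by (simp add: pairing_delta)
  have const: "?b (int n) = ?b 0" for n
  proof (induction n)
    case (Suc n)
    then show ?case
      using step[of "int (Suc n)"] by simp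
  qed simp
  have neg: "?b (- int n) = ?b 0" for n
  proof (induction n)
    case (Suc n)
    have "- int n - 1 = - int (Suc n)"
      by simp
    then show ?case
      using Suc step[of "- int n"] unfolding \<open>- int n - 1 = - int (Suc n)\<close> by simp
  qed simp
  have "?b 0 = 0"
  proof (rule ccontr)
    assume "?b 0 \<noteq> 0"
    then obtain N :: nat where N: "real N * norm (?b 0) > l1_norm ?b"
      using ex_less_of_nat_mult[of "norm (?b 0)"] by auto
    have "real N * norm (?b 0) = (\<Sum>n\<in>int ` {..<N}. norm (?b n))"
      by (subst sum.reindex) (auto simp: const)
    also have "\<dots> \<le> l1_norm ?b"
      by (intro l1_norm_sum_le \<theta>_l1) auto
    finally show False
      using N by simp
  qed
  then have "?b n = 0" for n
    using const[of "nat n"] neg[of "nat (- n)"] by (cases "n \<ge> 0") auto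
  then show ?thesis
    by blast
qed

lemma \<theta>_pow: "\<theta> (S_pow i r) = conv_pow (a i) r"
proof (induction r)
  case 0
  then show ?case
    by (simp add: S_pow_0 \<theta>_int conv_pow_def)
next
  case (Suc r)
  then show ?case
    by (simp add: S_pow_Suc \<theta>_plus conv_pow_Suc) (simp add: \<theta>_def \<Theta>_unit)
qed

text \<open>For bounded x, pairing with the image under \<open>\<Theta>\<close> is a bounded
  functional on \<open>l1\<close> and hence is given by its values on point masses. Thus
  \<open>\<Theta>\<close> is determined by \<open>\<theta>\<close>.\<close>

lemma pairing_\<theta>: "x \<in> linf \<Longrightarrow> (\<lambda>s. pairing x (\<theta> s)) \<in> linf"
  and \<Theta>_rep: "x \<in> linf \<Longrightarrow> \<mu> \<in> l1 \<Longrightarrow> pairing x (\<Theta> \<mu>) = pairing (\<lambda>s. pairing x (\<theta> s)) \<mu>"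
proof -
  have lin: "lin_on l1 (\<lambda>\<mu>. pairing x (\<Theta> \<mu>))" if "x \<in> linf" for x
    using that by (simp add: lin_on_def \<Theta>_lincomb pairing_lincomb_right \<Theta>_l1)
  have bnd: "norm (pairing x (\<Theta> \<mu>)) \<le> (linf_norm x * C) * l1_norm \<mu>" if "x \<in> linf" "\<mu> \<in> l1" for x \<mu>
    using pairing_bound[OF that(1) \<Theta>_l1[OF that(2)]] mult_left_mono[OF \<Theta>_bound[OF that(2)] linf_norm_nonneg[OF that(1)]]
    by (simp add: mult.assoc)
  show "(\<lambda>s. pairing x (\<theta> s)) \<in> linf" if "x \<in> linf"
    unfolding \<theta>_def by (rule l1_functional(1)[OF lin[OF that] bnd[OF that] l1_zero(1)])
  show "pairing x (\<Theta> \<mu>) = pairing (\<lambda>s. pairing x (\<theta> s)) \<mu>" if "x \<in> linf" "\<mu> \<in> l1"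
    unfolding \<theta>_def by (rule l1_functional(2)[OF lin[OF that(1)] bnd[OF that(1)] that(2)])
qed

text \<open>A sum in place of the maximum over i; it tends to 0 because there are finitely many
  indices.\<close>

definition \<epsilon> :: "nat \<Rightarrow> real" where
  "\<epsilon> r = (\<Sum>i\<in>UNIV. linf_norm (conv_pow (a i) r))"

lemma \<epsilon>_tendsto: "\<epsilon> \<longlonglongrightarrow> 0"
  unfolding \<epsilon>_def[abs_def] using tendsto_sum[of UNIV "\<lambda>i m. linf_norm (conv_pow (a i) m)" "\<lambda>_. 0" sequentially] a_tendsto
  by simp

lemma linf_norm_pow_le: "linf_norm (conv_pow (a i) r) \<le> \<epsilon> r"
  unfolding \<epsilon>_def using l1_subset_linf conv_pow_l1[OF a_l1]
  by (intro member_le_sum) (auto intro!: linf_norm_nonneg)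

lemma conv_pow_bound:
  assumes "b \<in> l1"
  shows "norm (conv (+) b (conv_pow (a i) r) n) \<le> \<epsilon> r * l1_norm b"
proof -
  have "norm (conv (+) (conv_pow (a i) r) b n) \<le> linf_norm (conv_pow (a i) r) * l1_norm b"
    by (rule conv_int_bound[OF conv_pow_l1[OF a_l1] assms])
  also have "\<dots> \<le> \<epsilon> r * l1_norm b"
    by (intro mult_right_mono linf_norm_pow_le l1_norm_nonneg)
  finally show ?thesis
    by (simp add: conv_commute[OF assms conv_pow_l1[OF a_l1] add.commute])
qed

definition box :: "nat \<Rightarrow> 'k S set" where
  "box r = {Some \<gamma> |\<gamma>. \<forall>i. snd \<gamma> $ i < r}"

text \<open>The choice of one index \<open>i\<close> makes the sets \<open>part r i\<close> disjoint.\<close>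
definition part :: "nat \<Rightarrow> 'k \<Rightarrow> 'k S set" where
  "part r i = {Some \<gamma> |\<gamma>. snd \<gamma> $ i \<ge> r \<and> i = (SOME i. snd \<gamma> $ i \<ge> r)}"

lemma part_range: "part r i \<subseteq> range (\<lambda>s. S_plus s (S_pow i r))"
proof
  fix s assume "s \<in> part r i"
  then obtain \<gamma> where \<gamma>: "s = Some \<gamma>" "snd \<gamma> $ i \<ge> r"
    by (auto simp: part_def)
  have "s = S_plus (Some (fst \<gamma>, \<chi> j. snd \<gamma> $ j - axis i r $ j)) (S_pow i r)"
    using \<gamma> by (auto simp: S_pow_def prod_eq_iff vec_eq_iff axis_def)
  then show "s \<in> range (\<lambda>s. S_plus s (S_pow i r))"
    by blast
qed

lemma Compl_box: "- box r = insert None (\<Union>i. part r i)"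
proof (intro equalityI subsetI)
  fix s assume s: "s \<in> - box r"
  show "s \<in> insert None (\<Union>i. part r i)"
  proof (cases s)
    case (Some \<gamma>)
    then have "\<not> (\<forall>i. snd \<gamma> $ i < r)"
      using s unfolding box_def by blast
    then obtain i where "snd \<gamma> $ i \<ge> r"
      by (auto simp: not_less)
    then have "snd \<gamma> $ (SOME i. snd \<gamma> $ i \<ge> r) \<ge> r"
      by (rule someI)
    then have "s \<in> part r (SOME i. snd \<gamma> $ i \<ge> r)"
      unfolding part_def Some by blast
    then show ?thesis
      by blast
  qed simp
qed (auto simp: box_def part_def not_less)

lemma disjoint_part: "disjoint_family (part r)"
  by (auto simp: disjoint_family_on_def part_def)

lemma inj_S_plus: "inj (\<lambda>s. S_plus s (Some \<gamma>))"
proof (rule injI)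
  fix s t :: "('a::finite) S" assume "S_plus s (Some \<gamma>) = S_plus t (Some \<gamma>)"
  then show "s = t"
    by (cases s; cases t) auto
qed

text \<open>Outside the box s is infinite or of the form t + r e_i. In the second case
  \<open>\<theta> s\<close> is the convolution of \<open>\<theta> t\<close>, of norm at most
  \<open>C\<close>, with the r-th power of a_i.\<close>

lemma \<theta>_off_box:
  assumes "s \<notin> box r"
  shows "norm (\<theta> s n) \<le> \<epsilon> r * C"
proof -
  have \<epsilon>: "\<epsilon> r \<ge> 0"
    unfolding \<epsilon>_def using l1_subset_linf conv_pow_l1[OF a_l1] by (intro sum_nonneg linf_norm_nonneg) auto
  have "s \<in> insert None (\<Union>i. part r i)"
    using assms Compl_box by blast
  then consider "s = None" | i where "s \<in> part r i"
    by blast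
  then show ?thesis
  proof cases
    case 1
    then show ?thesis
      using \<epsilon> C_nonneg by (simp add: \<theta>_None)
  next
    case 2
    then obtain t where "s = S_plus t (S_pow i r)"
      using part_range by blast
    then have "norm (\<theta> s n) \<le> \<epsilon> r * l1_norm (\<theta> t)"
      using conv_pow_bound[OF \<theta>_l1] by (simp add: \<theta>_plus \<theta>_pow)
    also have "\<dots> \<le> \<epsilon> r * C"
      by (intro mult_left_mono \<theta>_bound \<epsilon>)
    finally show ?thesis .
  qed
qed

text \<open>The operation on functions whose adjoint is convolution with \<open>l1_embed b\<close>.
  It preserves \<open>cfun\<close>, which is the weak-star continuity of that convolution.\<close>

definition smear :: "(int \<Rightarrow> complex) \<Rightarrow> ('k S \<Rightarrow> complex) \<Rightarrow> 'k S \<Rightarrow> complex" where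
  "smear b f = (\<lambda>s. pairing (\<lambda>m. f (S_plus s (S_int m))) b)"

lemma cfun_smear: "f \<in> cfun \<Longrightarrow> b \<in> l1 \<Longrightarrow> smear b f \<in> cfun"
  unfolding smear_def by (rule cfun_average[OF cfun_translate linf_norm_ge[OF cfun_linf]])

lemma pairing_smear:
  assumes "f \<in> cfun" "b \<in> l1" "\<mu> \<in> l1"
  shows "pairing (smear b f) \<mu> = pairing f (conv S_plus \<mu> (l1_embed b))"
proof -
  have "(\<lambda>t. f (S_plus s t)) \<in> linf" for s
    by (rule linfI, rule linf_norm_ge[OF cfun_linf[OF assms(1)]])
  then have "pairing (\<lambda>t. f (S_plus s t)) (l1_embed b) = smear b f s" for s
    by (simp add: pairing_l1_embed assms(2) restrict_int_def smear_def)
  then show ?thesis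
    using pairing_conv[OF assms(3) l1_embed_l1(1)[OF assms(2)] cfun_linf[OF assms(1)], of S_plus] by simp
qed

lemma pairing_restrict_conv:
  assumes "f \<in> cfun" "b \<in> l1" "c \<in> l1"
  shows "pairing (restrict_int f) (conv (+) c b) = pairing (restrict_int (smear b f)) c"
proof -
  have "pairing (restrict_int f) (conv (+) c b) = pairing (\<lambda>t. pairing (\<lambda>u. restrict_int f (t + u)) b) c"
    by (rule pairing_conv[OF assms(3,2) restrict_int_linf[OF cfun_linf[OF assms(1)]]])
  also have "(\<lambda>t. pairing (\<lambda>u. restrict_int f (t + u)) b) = restrict_int (smear b f)"
    by (simp add: fun_eq_iff restrict_int_def smear_def S_int_def)
  finally show ?thesis .
qed

text \<open>On the kernel of \<open>\<Theta>\<close> the functions \<open>f\<close> and \<open>defect f\<close> have the same pairings. In general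
  \<open>defect f\<close> is not continuous.\<close>
definition defect :: "('k S \<Rightarrow> complex) \<Rightarrow> 'k S \<Rightarrow> complex" where
  "defect f s = f s - pairing (restrict_int f) (\<theta> s)"

lemma defect_linf: "f \<in> linf \<Longrightarrow> defect f \<in> linf"
  unfolding defect_def by (intro linf_diff pairing_\<theta> restrict_int_linf)

lemma pairing_defect:
  assumes "f \<in> linf" "\<mu> \<in> l1"
  shows "pairing (defect f) \<mu> = pairing f \<mu> - pairing (restrict_int f) (\<Theta> \<mu>)"
  unfolding defect_def
  by (simp add: pairing_diff_left assms pairing_\<theta> restrict_int_linf \<Theta>_rep)

lemma weak_limit_unique:
  assumes "\<mu> \<in> l1" "\<nu> \<in> l1" "\<And>f. f \<in> cfun \<Longrightarrow> pairing f \<mu> = pairing f \<nu>"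
  shows "\<mu> = \<nu>"
proof -
  have d: "(\<lambda>s. \<mu> s - \<nu> s) \<in> l1"
    by (rule l1_diff[OF assms(1,2)])
  have "l1_norm (\<lambda>s. \<mu> s - \<nu> s) \<le> \<bar>0\<bar>"
    by (rule l1_norm_le_dual[OF d]) (simp add: pairing_diff_right assms cfun_linf)
  then have "norm (\<mu> s - \<nu> s) \<le> 0" for s
    using l1_norm_ge[OF d, of s] by linarith
  then show ?thesis
    by (auto simp: fun_eq_iff)
qed

definition K :: "('k S \<Rightarrow> complex) set" where
  "K = l1_kernel \<Theta>"

lemma K_iff: "\<mu> \<in> K \<longleftrightarrow> \<mu> \<in> l1 \<and> \<Theta> \<mu> = (\<lambda>_. 0)"
  by (simp add: K_def l1_kernel_def)

lemma lin_on_\<Theta>: "lin_on l1 (\<lambda>\<mu>. \<Theta> \<mu> n)"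
  by (simp add: lin_on_def \<Theta>_lincomb)

lemma lin_closed_K: "lin_closed K"
  using \<Theta>_lincomb[OF l1_zero(1) l1_zero(1), of 0 0] by (auto simp: lin_closed_def K_iff l1_zero(1) l1_lincomb \<Theta>_lincomb)

context
  fixes L :: "('i \<Rightarrow> complex) \<Rightarrow> complex" and \<kappa> :: "'i \<Rightarrow> 'k S \<Rightarrow> complex" and R :: real
  assumes L: "lin_on linf L" "\<And>x. x \<in> linf \<Longrightarrow> norm (L x) \<le> linf_norm x"
    and \<kappa>: "\<And>i. \<kappa> i \<in> l1" "\<And>i. l1_norm (\<kappa> i) \<le> R"
begin

lemma pairing_net_linf:
  assumes "\<And>i. \<nu> i \<in> l1" "\<And>i. l1_norm (\<nu> i) \<le> B" "f \<in> linf"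
  shows "(\<lambda>i. pairing f (\<nu> i)) \<in> linf"
proof (rule linfI)
  show "norm (pairing f (\<nu> i)) \<le> linf_norm f * B" for i
    using pairing_bound[OF assms(3) assms(1)] mult_left_mono[OF assms(2) linf_norm_nonneg[OF assms(3)]] order_trans
    by blast
qed

text \<open>For each of the finitely many \<open>p\<close> occurring in the box, \<open>n \<mapsto> defect f (n, p)\<close> does extend
  continuously from \<open>\<int>\<close>, and the limit picks up a multiple of \<open>\<delta>\<^sub>p - \<theta> p\<close>.\<close>
lemma box_limit:
  "\<exists>\<xi>\<in>K. \<forall>f\<in>cfun. L (\<lambda>i. pairing (defect f) (rst (box r) (\<kappa> i))) = pairing f \<xi>"
proof -
  define B :: "(nat, 'k) vec set" where "B = {p. \<forall>i. p $ i < r}"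
  have B: "finite B"
    by (rule finite_subset[OF _ finite_vec_le[of "\<chi> i. r"]]) (auto simp: B_def less_imp_le)
  define h where "h p n = (Some (n, p) :: 'k S)" for p n
  have inj: "inj (h p)" for p
    by (auto simp: inj_def h_def)
  define \<kappa>p where "\<kappa>p p i = (\<lambda>n. \<kappa> i (h p n))" for p i
  have \<kappa>p: "\<kappa>p p i \<in> l1" "l1_norm (\<kappa>p p i) \<le> R" for p i
    using l1_pull[OF inj \<kappa>(1)[of i], of p] \<kappa>(2)[of i] by (auto simp: \<kappa>p_def)
  have box: "box r = (\<Union>p\<in>B. range (h p))"
    by (auto simp: box_def B_def h_def)
  have disj: "disjoint_family_on (\<lambda>p. range (h p)) B"
    by (auto simp: disjoint_family_on_def h_def)
  have split: "pairing g (rst (box r) (\<kappa> i)) = (\<Sum>p\<in>B. pairing (\<lambda>n. g (h p n)) (\<kappa>p p i))" if "g \<in> linf" for g i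
  proof -
    have "pairing g (rst (range (h p)) (\<kappa> i)) = pairing (\<lambda>n. g (h p n)) (\<kappa>p p i)" for p
      using pairing_rst_range[OF inj \<kappa>(1) order_refl that, of p i] by (simp add: rst_def \<kappa>p_def)
    then show ?thesis
      unfolding box by (simp add: pairing_rst_UN[OF B \<kappa>(1) that disj])
  qed
  \<comment> \<open>The slice with exponent vector p is moved back to the integers before the limit
    is taken; the translation by p is restored in the definition of \<open>\<xi>\<close>.\<close>
  have "\<exists>\<zeta>. weak_limit L (\<lambda>i. l1_embed (\<kappa>p p i)) \<zeta>" for p
    using ex_weak_limit[OF L, of "\<lambda>i. l1_embed (\<kappa>p p i)" R] l1_embed_l1[OF \<kappa>p(1)] \<kappa>p(2) by metis
  then obtain \<zeta> where \<zeta>: "\<And>p. weak_limit L (\<lambda>i. l1_embed (\<kappa>p p i)) (\<zeta> p)"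
    by metis
  have \<zeta>l: "\<zeta> p \<in> l1" for p
    using \<zeta> by (simp add: weak_limit_def)
  define t where "t p = (Some (0, p) :: 'k S)" for p
  \<comment> \<open>Membership in the kernel holds because \<open>\<Theta>\<close> is multiplicative
    and takes the same value \<open>\<theta> (t p)\<close> on both second factors.\<close>
  define \<xi> where "\<xi> p = (\<lambda>s. conv S_plus (\<zeta> p) (delta (t p)) s - conv S_plus (\<zeta> p) (l1_embed (\<theta> (t p))) s)" for p
  have \<xi>l: "\<xi> p \<in> l1" for p
    unfolding \<xi>_def by (intro l1_diff conv_l1 \<zeta>l delta_l1 l1_embed_l1 \<theta>_l1)
  have \<xi>K: "\<xi> p \<in> K" for p
  proof -
    have "\<Theta> (\<xi> p) n = 0" for n
      unfolding \<xi>_def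
      using lin_on_diff[OF lin_on_\<Theta>[of n] conv_l1(1)[OF \<zeta>l delta_l1(1)] conv_l1(1)[OF \<zeta>l l1_embed_l1(1)[OF \<theta>_l1]], of S_plus p "t p" S_plus p "t p"]
      by (simp add: \<Theta>_conv \<zeta>l delta_l1 l1_embed_l1 \<theta>_l1 \<Theta>_embed flip: \<theta>_def)
    then show ?thesis
      using \<xi>l by (simp add: K_iff fun_eq_iff)
  qed
  have lim: "L (\<lambda>i. pairing (\<lambda>n. defect f (h p n)) (\<kappa>p p i)) = pairing f (\<xi> p)" if f: "f \<in> cfun" for f p
  proof -
    \<comment> \<open>A continuous function on the whole space whose restriction to the integers is
      the slice of \<open>defect f\<close>: there \<open>h p n\<close> is n + t p, and
      \<open>\<theta> (h p n)\<close> is \<open>\<theta> (t p)\<close> translated by n.\<close>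
    let ?g = "\<lambda>s. f (S_plus s (t p)) - smear (\<theta> (t p)) f s"
    have g: "?g \<in> cfun"
      by (intro lin_closed_diff[OF lin_closed_cfun] cfun_translate cfun_smear f \<theta>_l1)
    have "defect f (h p n) = restrict_int ?g n" for n
    proof -
      have st: "h p n = S_plus (S_int n) (t p)"
        by (simp add: h_def S_int_def t_def)
      have "pairing (restrict_int f) (\<theta> (h p n)) = smear (\<theta> (t p)) f (S_int n)"
        unfolding st \<theta>_plus pairing_restrict_conv[OF f \<theta>_l1 \<theta>_l1] by (simp add: \<theta>_int pairing_delta restrict_int_def)
      then show ?thesis
        by (simp add: defect_def st restrict_int_def)
    qed
    then have "L (\<lambda>i. pairing (\<lambda>n. defect f (h p n)) (\<kappa>p p i)) = L (\<lambda>i. pairing ?g (l1_embed (\<kappa>p p i)))"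
      by (simp add: pairing_l1_embed[OF cfun_linf[OF g] \<kappa>p(1)])
    also have "\<dots> = pairing ?g (\<zeta> p)"
      using \<zeta>[of p] g by (simp add: weak_limit_def)
    also have "\<dots> = pairing (\<lambda>s. f (S_plus s (t p))) (\<zeta> p) - pairing (smear (\<theta> (t p)) f) (\<zeta> p)"
      by (intro pairing_diff_left cfun_linf cfun_translate cfun_smear f \<theta>_l1 \<zeta>l)
    also have "pairing (\<lambda>s. f (S_plus s (t p))) (\<zeta> p) = pairing f (conv S_plus (\<zeta> p) (delta (t p)))"
      using pairing_conv[OF \<zeta>l delta_l1(1) cfun_linf[OF f], of S_plus p "t p"] by (simp add: pairing_delta)
    also have "pairing (smear (\<theta> (t p)) f) (\<zeta> p) = pairing f (conv S_plus (\<zeta> p) (l1_embed (\<theta> (t p))))"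
      by (rule pairing_smear[OF f \<theta>_l1 \<zeta>l])
    finally show ?thesis
      unfolding \<xi>_def by (simp add: pairing_diff_right cfun_linf f conv_l1 \<zeta>l delta_l1 l1_embed_l1 \<theta>_l1)
  qed
  show ?thesis
  proof (intro bexI[of _ "\<lambda>s. \<Sum>p\<in>B. \<xi> p s"] ballI)
    show "(\<lambda>s. \<Sum>p\<in>B. \<xi> p s) \<in> K"
      using lin_sum(1)[OF lin_closed_K B, of \<xi> "\<lambda>_. 1"] \<xi>K by simp
    fix f assume f: "f \<in> cfun"
    have "(\<lambda>n. defect f (h p n)) \<in> linf" for p
      by (rule linfI, rule linf_norm_ge[OF defect_linf[OF cfun_linf[OF f]]])
    then have xl: "(\<lambda>i. pairing (\<lambda>n. defect f (h p n)) (\<kappa>p p i)) \<in> linf" for p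
      by (rule pairing_net_linf[OF \<kappa>p])
    show "L (\<lambda>i. pairing (defect f) (rst (box r) (\<kappa> i))) = pairing f (\<lambda>s. \<Sum>p\<in>B. \<xi> p s)"
      using lin_on_sum(2)[OF lin_closed_linf L(1) B xl]
      by (simp add: split[OF defect_linf[OF cfun_linf[OF f]]] lim[OF f] pairing_sum_right[OF B cfun_linf[OF f] \<xi>l])
  qed
qed

text \<open>Off the box every \<open>\<theta> s\<close> has some \<open>a\<^sub>i\<^sup>r\<close> as a factor, and this factor survives in the limit.\<close>
lemma far_limit:
  "\<exists>\<alpha> \<eta>. \<alpha> \<in> l1 \<and> l1_norm \<alpha> \<le> R \<and> (\<forall>s\<in>box r. \<alpha> s = 0) \<and> (\<forall>i. \<eta> i \<in> l1 \<and> l1_norm (\<eta> i) \<le> C * R) \<and>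
    (\<forall>f\<in>cfun. L (\<lambda>i. pairing (defect f) (rst (- box r) (\<kappa> i))) =
      pairing f \<alpha> - (\<Sum>i\<in>UNIV. pairing f (conv S_plus (\<eta> i) (l1_embed (conv_pow (a i) r)))))"
proof -
  have rl: "rst (- box r) (\<kappa> j) \<in> l1" "l1_norm (rst (- box r) (\<kappa> j)) \<le> R" for j
    using rst_l1[OF \<kappa>(1), of "- box r" j] \<kappa>(2)[of j] by auto
  obtain \<alpha> where \<alpha>: "weak_limit L (\<lambda>i. rst (- box r) (\<kappa> i)) \<alpha>" "l1_norm \<alpha> \<le> R"
    using ex_weak_limit[OF L, of "\<lambda>i. rst (- box r) (\<kappa> i)" R] rl by metis
  have \<alpha>l: "\<alpha> \<in> l1"
    using \<alpha>(1) by (simp add: weak_limit_def)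
  have \<alpha>0: "\<alpha> s = 0" if s: "s \<in> box r" for s
  proof -
    \<comment> \<open>Passing to a neighbourhood can only lower the coordinates 1 to k, so the box
      is open and the indicators of neighbourhoods of s do not meet the parts of the net outside
      it.\<close>
    have sub: "nbS s n \<subseteq> box r" for n
    proof
      fix t assume t: "t \<in> nbS s n"
      obtain \<gamma> where \<gamma>: "s = Some \<gamma>" "\<forall>i. snd \<gamma> $ i < r"
        using s by (auto simp: box_def)
      then obtain \<beta> where \<beta>: "t = Some \<beta>" "\<beta> \<in> V \<gamma> n"
        using t by (auto simp: nbS_simps)
      then obtain A where A: "snd \<gamma> = snd \<beta> + wtype J A"
        unfolding below_def by blast
      have "snd \<beta> $ i < r" for i
        using \<gamma>(2)[rule_format, of i] unfolding A by simp
      then show "t \<in> box r"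
        unfolding box_def \<beta>(1) by blast
    qed
    have "pairing (ind (nbS s n)) (rst (- box r) (\<kappa> i)) = 0" for n i
    proof -
      have "ind (nbS s n) t * rst (- box r) (\<kappa> i) t = 0" for t
        using sub[of n] by (auto simp: ind_def rst_def)
      then show ?thesis
        unfolding pairing_def by (intro infsum_0)
    qed
    then have "pairing (ind (nbS s n)) \<alpha> = 0" for n
      using \<alpha>(1) cfun_ind[OF clopen_nb, of s n] lin_on_zero[OF L(1) linf_zero(1)] by (simp add: weak_limit_def)
    then show ?thesis
      using pairing_ind_nb_tendsto[OF \<alpha>l, of s] by (simp add: LIMSEQ_const_iff)
  qed
  define sh where "sh i = (\<lambda>s. S_plus s (S_pow i r))" for i :: 'k
  have inj: "inj (sh i)" for i
    unfolding sh_def S_pow_def by (rule inj_S_plus)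
  \<comment> \<open>The portion of the measure in \<open>part r i\<close>, moved back by r e_i. Its
    image under \<open>\<Theta>\<close> is what remains once the factor a_i^r has been split off,
    and this factor is transferred to f by \<open>smear\<close>.\<close>
  define \<rho> where "\<rho> i j = (\<lambda>s. rst (part r i) (\<kappa> j) (sh i s))" for i j
  have \<rho>l: "\<rho> i j \<in> l1" "l1_norm (\<rho> i j) \<le> R" for i j
  proof -
    note p = l1_pull[OF inj[of i] rst_l1(1)[OF \<kappa>(1)[of j], of "part r i"]]
    show "\<rho> i j \<in> l1"
      unfolding \<rho>_def by (rule p(1))
    show "l1_norm (\<rho> i j) \<le> R"
      unfolding \<rho>_def using p(2) rst_l1(2)[OF \<kappa>(1), of "part r i" j] \<kappa>(2)[of j] by linarith
  qed
  have \<Theta>\<rho>: "\<Theta> (\<rho> i j) \<in> l1" "l1_norm (\<Theta> (\<rho> i j)) \<le> C * R" for i j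
    using \<Theta>_l1[OF \<rho>l(1)] order_trans[OF \<Theta>_bound[OF \<rho>l(1)] mult_left_mono[OF \<rho>l(2) C_nonneg]] by auto
  have "\<exists>\<eta>. weak_limit L (\<lambda>j. l1_embed (\<Theta> (\<rho> i j))) \<eta> \<and> l1_norm \<eta> \<le> C * R" for i
    using ex_weak_limit[OF L, of "\<lambda>j. l1_embed (\<Theta> (\<rho> i j))" "C * R"] l1_embed_l1[OF \<Theta>\<rho>(1)] \<Theta>\<rho>(2) by metis
  then obtain \<eta> where \<eta>: "\<And>i. weak_limit L (\<lambda>j. l1_embed (\<Theta> (\<rho> i j))) (\<eta> i)" "\<And>i. l1_norm (\<eta> i) \<le> C * R"
    by metis
  have \<eta>l: "\<eta> i \<in> l1" for i
    using \<eta>(1) by (simp add: weak_limit_def)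
  have far: "pairing (restrict_int f) (\<Theta> (rst (- box r) (\<kappa> j))) =
      (\<Sum>i\<in>UNIV. pairing (smear (conv_pow (a i) r) f) (l1_embed (\<Theta> (\<rho> i j))))" if f: "f \<in> cfun" for f j
  proof -
    let ?x = "restrict_int f"
    let ?h = "\<lambda>s. pairing ?x (\<theta> s)"
    have x: "?x \<in> linf"
      by (rule restrict_int_linf[OF cfun_linf[OF f]])
    note h = pairing_\<theta>[OF x]
    have eq: "?h s * rst (- box r) (\<kappa> j) s = ?h s * rst (\<Union>i. part r i) (\<kappa> j) s" for s
      unfolding Compl_box by (auto simp: rst_def \<theta>_None)
    have "pairing ?h (rst (- box r) (\<kappa> j)) = pairing ?h (rst (\<Union>i. part r i) (\<kappa> j))"
      unfolding pairing_def[of ?h] by (intro infsum_cong eq)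
    also have "\<dots> = (\<Sum>i\<in>UNIV. pairing ?h (rst (part r i) (\<kappa> j)))"
      by (rule pairing_rst_UN[OF finite \<kappa>(1) h disjoint_part])
    also have "\<dots> = (\<Sum>i\<in>UNIV. pairing (smear (conv_pow (a i) r) f) (l1_embed (\<Theta> (\<rho> i j))))"
    proof (rule sum.cong)
      fix i :: 'k
      let ?b = "conv_pow (a i) r"
      note b = conv_pow_l1[OF a_l1, of i r]
      have y: "restrict_int (smear ?b f) \<in> linf"
        by (rule restrict_int_linf[OF cfun_linf[OF cfun_smear[OF f b]]])
      have "pairing ?h (rst (part r i) (\<kappa> j)) = pairing (\<lambda>s. ?h (sh i s)) (\<rho> i j)"
        unfolding \<rho>_def by (rule pairing_rst_range[OF inj \<kappa>(1) _ h]) (use part_range in \<open>simp add: sh_def\<close>)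
      also have "(\<lambda>s. ?h (sh i s)) = (\<lambda>s. pairing (restrict_int (smear ?b f)) (\<theta> s))"
        unfolding sh_def \<theta>_plus \<theta>_pow by (simp add: pairing_restrict_conv[OF f b \<theta>_l1])
      also have "pairing \<dots> (\<rho> i j) = pairing (restrict_int (smear ?b f)) (\<Theta> (\<rho> i j))"
        by (rule \<Theta>_rep[OF y \<rho>l(1), symmetric])
      also have "\<dots> = pairing (smear ?b f) (l1_embed (\<Theta> (\<rho> i j)))"
        by (rule pairing_l1_embed[OF cfun_linf[OF cfun_smear[OF f b]] \<Theta>\<rho>(1), symmetric])
      finally show "pairing ?h (rst (part r i) (\<kappa> j)) = pairing (smear ?b f) (l1_embed (\<Theta> (\<rho> i j)))" .
    qed simp
    finally show ?thesis
      by (simp add: \<Theta>_rep[OF x rl(1)])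
  qed
  show ?thesis
  proof (intro exI[of _ \<alpha>] exI[of _ \<eta>] conjI ballI allI \<alpha>l \<alpha>(2) \<alpha>0 \<eta>l \<eta>(2))
    fix f assume f: "f \<in> cfun"
    let ?b = "\<lambda>i. conv_pow (a i) r"
    have bl: "?b i \<in> l1" for i
      by (rule conv_pow_l1[OF a_l1])
    have z1: "(\<lambda>j. pairing f (rst (- box r) (\<kappa> j))) \<in> linf"
      by (rule pairing_net_linf[OF rl cfun_linf[OF f]])
    have z2: "(\<lambda>j. pairing (smear (?b i) f) (l1_embed (\<Theta> (\<rho> i j)))) \<in> linf" for i
      by (rule pairing_net_linf[of _ "C * R"]) (simp_all add: l1_embed_l1 \<Theta>\<rho> cfun_linf cfun_smear f bl)
    have "L (\<lambda>j. pairing (defect f) (rst (- box r) (\<kappa> j))) =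
        L (\<lambda>j. pairing f (rst (- box r) (\<kappa> j)) - (\<Sum>i\<in>UNIV. pairing (smear (?b i) f) (l1_embed (\<Theta> (\<rho> i j)))))"
      by (simp add: pairing_defect[OF cfun_linf[OF f] rl(1)] far[OF f])
    also have "\<dots> = L (\<lambda>j. pairing f (rst (- box r) (\<kappa> j))) -
        L (\<lambda>j. \<Sum>i\<in>UNIV. pairing (smear (?b i) f) (l1_embed (\<Theta> (\<rho> i j))))"
      by (rule lin_on_diff[OF L(1) z1 lin_on_sum(1)[OF lin_closed_linf L(1) finite z2]])
    also have "L (\<lambda>j. pairing f (rst (- box r) (\<kappa> j))) = pairing f \<alpha>"
      using \<alpha>(1) f by (simp add: weak_limit_def)
    also have "L (\<lambda>j. \<Sum>i\<in>UNIV. pairing (smear (?b i) f) (l1_embed (\<Theta> (\<rho> i j)))) =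
        (\<Sum>i\<in>UNIV. L (\<lambda>j. pairing (smear (?b i) f) (l1_embed (\<Theta> (\<rho> i j)))))"
      by (rule lin_on_sum(2)[OF lin_closed_linf L(1) finite z2])
    also have "\<dots> = (\<Sum>i\<in>UNIV. pairing f (conv S_plus (\<eta> i) (l1_embed (?b i))))"
      using \<eta>(1) cfun_smear[OF f bl] pairing_smear[OF f bl \<eta>l] by (simp add: weak_limit_def)
    finally show "L (\<lambda>i. pairing (defect f) (rst (- box r) (\<kappa> i))) =
      pairing f \<alpha> - (\<Sum>i\<in>UNIV. pairing f (conv S_plus (\<eta> i) (l1_embed (?b i))))" .
  qed
qed

text \<open>For \<kappa> in the kernel f can be replaced by \<open>defect f\<close>. Adding the two
  limits gives, for each r, \<open>\<mu>\<close> as \<xi> + \<alpha> minus the convolutions of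
  \<eta>_i with a_i^r. The term \<xi> is killed by \<open>\<Theta>\<close>; the images of the other
  terms are small in every coordinate, \<alpha> because it lives off the box and the convolutions
  because of their explicit factor.\<close>

lemma K_weak_limit:
  assumes \<kappa>K: "\<And>i. \<kappa> i \<in> K" and \<mu>: "weak_limit L \<kappa> \<mu>"
  shows "\<mu> \<in> K"
proof -
  have \<mu>l: "\<mu> \<in> l1"
    using \<mu> by (simp add: weak_limit_def)
  \<comment> \<open>The first term accounts for \<alpha>. Each of the k other terms carries
    \<open>C * R\<close> from the norm of \<eta>_i and a further \<open>C\<close> from applying
    \<open>\<Theta>\<close> to it.\<close>
  define M where "M = C * R + real CARD('k) * (C * (C * R))"
  have bound: "norm (\<Theta> \<mu> n) \<le> \<epsilon> r * M" for n r
  proof -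
    obtain \<xi> where \<xi>: "\<xi> \<in> K" "\<forall>f\<in>cfun. L (\<lambda>i. pairing (defect f) (rst (box r) (\<kappa> i))) = pairing f \<xi>"
      using box_limit[of r] ..
    obtain \<alpha> \<eta> where \<alpha>: "\<alpha> \<in> l1" "l1_norm \<alpha> \<le> R" "\<forall>s\<in>box r. \<alpha> s = 0"
      and \<eta>': "\<forall>i. \<eta> i \<in> l1 \<and> l1_norm (\<eta> i) \<le> C * R"
      and lim: "\<forall>f\<in>cfun. L (\<lambda>i. pairing (defect f) (rst (- box r) (\<kappa> i))) =
        pairing f \<alpha> - (\<Sum>i\<in>UNIV. pairing f (conv S_plus (\<eta> i) (l1_embed (conv_pow (a i) r))))"
      using far_limit[of r] by (elim exE conjE)
    have \<eta>: "\<eta> i \<in> l1" "l1_norm (\<eta> i) \<le> C * R" for i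
      using \<eta>' by simp_all
    let ?c = "\<lambda>i. conv S_plus (\<eta> i) (l1_embed (conv_pow (a i) r))"
    have bl: "conv_pow (a i) r \<in> l1" for i
      by (rule conv_pow_l1[OF a_l1])
    have cl: "?c i \<in> l1" for i
      by (intro conv_l1 \<eta> l1_embed_l1 bl)
    have \<xi>l: "\<xi> \<in> l1" "\<Theta> \<xi> n = 0"
      using \<xi>(1) by (simp_all add: K_iff)
    have sl: "(\<lambda>s. \<Sum>i\<in>UNIV. ?c i s) \<in> l1"
      by (intro l1_sum cl) simp
    have \<xi>\<alpha>: "(\<lambda>s. \<xi> s + \<alpha> s) \<in> l1"
      by (rule l1_add[OF \<xi>l(1) \<alpha>(1)])
    let ?\<nu> = "\<lambda>s. (\<xi> s + \<alpha> s) - (\<Sum>i\<in>UNIV. ?c i s)"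
    have "pairing f \<mu> = pairing f ?\<nu>" if f: "f \<in> cfun" for f
    proof -
      have fl: "f \<in> linf" and dl: "defect f \<in> linf"
        using cfun_linf[OF f] defect_linf by auto
      have \<kappa>l: "rst A (\<kappa> j) \<in> l1" "l1_norm (rst A (\<kappa> j)) \<le> R" for A j
        using rst_l1[OF \<kappa>(1), of A j] \<kappa>(2)[of j] by auto
      have "pairing f (\<kappa> j) = pairing (defect f) (rst (box r) (\<kappa> j)) + pairing (defect f) (rst (- box r) (\<kappa> j))" for j
      proof -
        have "\<kappa> j = (\<lambda>s. rst (box r) (\<kappa> j) s + rst (- box r) (\<kappa> j) s)"
          by (auto simp: rst_def)
        then have "pairing (defect f) (\<kappa> j) = pairing (defect f) (rst (box r) (\<kappa> j)) + pairing (defect f) (rst (- box r) (\<kappa> j))"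
          using pairing_add_right[OF dl \<kappa>l(1) \<kappa>l(1), of "box r" j "- box r" j] by simp
        moreover have "pairing (defect f) (\<kappa> j) = pairing f (\<kappa> j)"
          using pairing_defect[OF fl \<kappa>(1), of j] \<kappa>K[of j] by (simp add: K_iff)
        ultimately show ?thesis
          by simp
      qed
      then have "pairing f \<mu> = L (\<lambda>j. pairing (defect f) (rst (box r) (\<kappa> j)) + pairing (defect f) (rst (- box r) (\<kappa> j)))"
        using \<mu> f by (simp add: weak_limit_def)
      also have "\<dots> = L (\<lambda>j. pairing (defect f) (rst (box r) (\<kappa> j))) + L (\<lambda>j. pairing (defect f) (rst (- box r) (\<kappa> j)))"
        by (intro lin_on_add[OF L(1)] pairing_net_linf[OF \<kappa>l dl])
      also have "\<dots> = pairing f ?\<nu>"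
        by (simp add: \<xi>(2)[rule_format, OF f] lim[rule_format, OF f] pairing_diff_right[OF fl \<xi>\<alpha> sl] pairing_add_right[OF fl \<xi>l(1) \<alpha>(1)]
            pairing_sum_right[OF finite fl cl])
      finally show ?thesis .
    qed
    then have "\<mu> = ?\<nu>"
      by (rule weak_limit_unique[OF \<mu>l l1_diff[OF \<xi>\<alpha> sl]])
    then have "\<Theta> \<mu> n = \<Theta> ?\<nu> n"
      by simp
    also have "\<dots> = \<Theta> (\<lambda>s. \<xi> s + \<alpha> s) n - \<Theta> (\<lambda>s. \<Sum>i\<in>UNIV. ?c i s) n"
      by (rule lin_on_diff[OF lin_on_\<Theta> \<xi>\<alpha> sl])
    also have "\<Theta> (\<lambda>s. \<xi> s + \<alpha> s) n = \<Theta> \<alpha> n"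
      using lin_on_add[OF lin_on_\<Theta> \<xi>l(1) \<alpha>(1), of n] \<xi>l(2) by simp
    also have "\<Theta> (\<lambda>s. \<Sum>i\<in>UNIV. ?c i s) n = (\<Sum>i\<in>UNIV. \<Theta> (?c i) n)"
      by (rule lin_on_sum(2)[OF lin_closed_l1 lin_on_\<Theta> finite cl])
    also have "norm (\<Theta> \<alpha> n - (\<Sum>i\<in>UNIV. \<Theta> (?c i) n)) \<le> norm (\<Theta> \<alpha> n) + (\<Sum>i\<in>UNIV. norm (\<Theta> (?c i) n))"
      by (rule order_trans[OF norm_triangle_ineq4 add_left_mono[OF norm_sum]])
    also have "norm (\<Theta> \<alpha> n) \<le> \<epsilon> r * C * R"
    proof -
      \<comment> \<open>As \<alpha> vanishes on the box, only those values of
        \<open>\<theta>\<close> enter that are bounded by \<open>\<epsilon> r * C\<close>.\<close>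
      let ?h = "\<lambda>s. if s \<in> box r then 0 else \<theta> s n"
      have e: "\<epsilon> r * C \<ge> 0"
        using order_trans[OF norm_ge_zero \<theta>_off_box[of None r n]] by (simp add: box_def)
      have "\<Theta> \<alpha> n = pairing (\<lambda>s. \<theta> s n) \<alpha>"
        using \<Theta>_rep[OF delta_linf \<alpha>(1), of n] by (simp add: pairing_delta_left)
      also have "\<dots> = pairing ?h \<alpha>"
        unfolding pairing_def by (intro infsum_cong) (simp add: \<alpha>(3))
      also have "norm \<dots> \<le> (\<epsilon> r * C) * l1_norm \<alpha>"
        by (rule pairing_bound'[OF _ \<alpha>(1)]) (use e \<theta>_off_box in auto)
      also have "\<dots> \<le> (\<epsilon> r * C) * R"
        by (rule mult_left_mono[OF \<alpha>(2) e])
      finally show ?thesis .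
    qed
    also have "(\<Sum>i\<in>UNIV. norm (\<Theta> (?c i) n)) \<le> (\<Sum>i\<in>(UNIV :: 'k set). \<epsilon> r * (C * (C * R)))"
    proof (rule sum_mono)
      fix i :: 'k
      have e: "\<epsilon> r \<ge> 0"
        unfolding \<epsilon>_def using l1_subset_linf bl by (intro sum_nonneg linf_norm_nonneg) auto
      have "\<Theta> (?c i) = conv (+) (\<Theta> (\<eta> i)) (conv_pow (a i) r)"
        by (simp add: \<Theta>_conv \<eta> l1_embed_l1 bl \<Theta>_embed)
      then have "norm (\<Theta> (?c i) n) \<le> \<epsilon> r * l1_norm (\<Theta> (\<eta> i))"
        using conv_pow_bound[OF \<Theta>_l1[OF \<eta>(1)]] by simp
      also have "\<dots> \<le> \<epsilon> r * (C * (C * R))"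
        by (intro mult_left_mono e order_trans[OF \<Theta>_bound[OF \<eta>(1)]] \<eta>(2) C_nonneg)
      finally show "norm (\<Theta> (?c i) n) \<le> \<epsilon> r * (C * (C * R))" .
    qed
    finally show ?thesis
      by (simp add: M_def algebra_simps)
  qed
  have "\<Theta> \<mu> n = 0" for n
  proof -
    \<comment> \<open>The left side of the bound does not involve r.\<close>
    have "(\<lambda>r. \<epsilon> r * M) \<longlonglongrightarrow> 0"
      using tendsto_mult_right[OF \<epsilon>_tendsto, of M] by simp
    then have "norm (\<Theta> \<mu> n) \<le> 0"
      by (rule LIMSEQ_le_const) (use bound in auto)
    then show ?thesis by simp
  qed
  then show ?thesis
    using \<mu>l by (simp add: K_iff fun_eq_iff)
qed

end

end

section \<open>The predual and the projection\<close>

lemma weak_star_subbase: "x \<in> E \<Longrightarrow> open U \<Longrightarrow> openin (weak_star_topology E) {a \<in> l1. pairing x a \<in> U}"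
  unfolding weak_star_topology_def by (rule topology_generated_by_Basis) blast

lemma topspace_weak_star: "topspace (weak_star_topology E) = l1"
  unfolding weak_star_topology_def topology_generated_by_topspace by auto

text \<open>Eventual membership passes through finite intersections and arbitrary unions, so only
  subbasic sets have to be checked.\<close>

lemma limitin_weak_star:
  assumes a: "a \<in> l1" and g: "\<And>n. g n \<in> l1"
    and lim: "\<And>x. x \<in> E \<Longrightarrow> ((\<lambda>n. pairing x (g n)) \<longlongrightarrow> pairing x a) F"
  shows "limitin (weak_star_topology E) g a F"
  unfolding limitin_def topspace_weak_star
proof (intro conjI allI impI a)
  fix U assume "openin (weak_star_topology E) U \<and> a \<in> U"
  then have "generate_topology_on (insert l1 {{a \<in> l1. pairing x a \<in> U} |x U. x \<in> E \<and> open U}) U" "a \<in> U"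
    by (simp_all add: weak_star_topology_def openin_topology_generated_by_iff)
  then show "eventually (\<lambda>n. g n \<in> U) F"
  proof (induction rule: generate_topology_on.induct)
    case (UN \<U>)
    then obtain W where "W \<in> \<U>" "a \<in> W" "eventually (\<lambda>n. g n \<in> W) F"
      by blast
    then show ?case
      by (auto elim: eventually_mono)
  next
    case (Basis s)
    then consider "s = l1" | x W where "s = {a \<in> l1. pairing x a \<in> W}" "x \<in> E" "open W"
      by blast
    then show ?case
    proof cases
      case 2
      then show ?thesis
        using topological_tendstoD[OF lim[OF 2(2)] 2(3)] Basis(2) g by (auto elim: eventually_mono)
    qed (simp add: g)
  qed (auto simp: eventually_conj_iff)
qed

context theta
begin

definition F :: "('k S \<Rightarrow> complex) set" where
  "F = pre_annihilator (C_S J) (l1_kernel \<Theta>)"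

definition E :: "(int \<Rightarrow> complex) set" where
  "E = restrict_int ` F"

text \<open>The inverse of the restriction from \<open>F\<close> to \<open>E\<close>.\<close>
definition ext :: "(int \<Rightarrow> complex) \<Rightarrow> 'k S \<Rightarrow> complex" where
  "ext x s = pairing x (\<theta> s)"

lemma F_iff: "f \<in> F \<longleftrightarrow> f \<in> cfun \<and> (\<forall>\<mu>\<in>K. pairing f \<mu> = 0)"
  by (simp add: F_def pre_annihilator_def C_S_eq_cfun K_def)

lemma F_linf: "f \<in> F \<Longrightarrow> f \<in> linf"
  by (simp add: F_iff cfun_linf)

text \<open>The difference of \<mu> and \<open>l1_embed (\<Theta> \<mu>)\<close> lies in the kernel
  because \<open>\<Theta>\<close> is a projection; so elements of \<open>F\<close> see a measure
  only through its image.\<close>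

lemma F_pairing:
  assumes "f \<in> F" "\<mu> \<in> l1"
  shows "pairing f \<mu> = pairing (restrict_int f) (\<Theta> \<mu>)"
proof -
  note e = l1_embed_l1(1)[OF \<Theta>_l1[OF assms(2)]]
  have "\<Theta> (\<lambda>s. \<mu> s - l1_embed (\<Theta> \<mu>) s) n = 0" for n
    using lin_on_diff[OF lin_on_\<Theta> assms(2) e, of n] by (simp add: \<Theta>_embed \<Theta>_l1 assms(2))
  then have "(\<lambda>s. \<mu> s - l1_embed (\<Theta> \<mu>) s) \<in> K"
    by (simp add: K_iff l1_diff assms(2) e fun_eq_iff)
  then have "pairing f (\<lambda>s. \<mu> s - l1_embed (\<Theta> \<mu>) s) = 0"
    using assms(1) by (simp add: F_iff)
  then show ?thesis
    using pairing_diff_right[OF F_linf[OF assms(1)] assms(2) e] pairing_l1_embed[OF F_linf[OF assms(1)] \<Theta>_l1[OF assms(2)]]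
    by simp
qed

lemma ext_restrict: "f \<in> F \<Longrightarrow> ext (restrict_int f) = f"
  using F_pairing[OF _ delta_l1(1), of f] by (auto simp: ext_def \<theta>_def pairing_delta fun_eq_iff)

lemma ext_bound: "x \<in> linf \<Longrightarrow> norm (ext x s) \<le> C * linf_norm x"
  unfolding ext_def using pairing_bound[OF _ \<theta>_l1, of x s] mult_left_mono[OF \<theta>_bound[of s] linf_norm_nonneg[of x]]
  by (simp add: mult.commute)

lemma restrict_ext: "restrict_int (ext x) = x"
  by (simp add: restrict_int_def ext_def \<theta>_int pairing_delta)

lemma ext_F:
  assumes "x \<in> linf" "ext x \<in> cfun"
  shows "ext x \<in> F"
proof -
  have "pairing (ext x) \<mu> = 0" if "\<mu> \<in> K" for \<mu>
    using \<Theta>_rep[OF assms(1), of \<mu>] that by (simp add: ext_def[abs_def] K_iff)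
  then show ?thesis
    using assms(2) by (simp add: F_iff)
qed

text \<open>The canonical extension always annihilates the kernel, so membership in \<open>E\<close>
  becomes a question of continuity alone.\<close>

lemma E_iff: "x \<in> E \<longleftrightarrow> x \<in> linf \<and> ext x \<in> cfun"
proof
  assume "x \<in> E"
  then obtain f where f: "f \<in> F" "x = restrict_int f"
    by (auto simp: E_def)
  then show "x \<in> linf \<and> ext x \<in> cfun"
    using ext_restrict[OF f(1)] restrict_int_linf[OF F_linf[OF f(1)]] by (simp add: F_iff)
next
  assume "x \<in> linf \<and> ext x \<in> cfun"
  then show "x \<in> E"
    unfolding E_def using ext_F restrict_ext by (intro image_eqI[of _ _ "ext x"]) auto
qed

lemma ext_E: "x \<in> E \<Longrightarrow> ext x \<in> F"
  by (simp add: E_iff ext_F)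

lemma E_linf: "x \<in> E \<Longrightarrow> x \<in> linf"
  by (simp add: E_iff)

lemma lin_closed_E: "lin_closed E"
proof -
  have "ext (\<lambda>n. c * x n + d * y n) = (\<lambda>s. c * ext x s + d * ext y s)" if "x \<in> linf" "y \<in> linf" for x y c d
    using pairing_lincomb_left[OF that \<theta>_l1] by (simp add: ext_def fun_eq_iff)
  moreover have "ext (\<lambda>_. 0) = (\<lambda>_. 0)"
    by (simp add: ext_def[abs_def])
  ultimately show ?thesis
    by (simp add: lin_closed_def E_iff linf_zero linf_lincomb cfun_lincomb cfun_const)
qed

lemma lin_closed_F: "lin_closed F"
  by (auto simp: lin_closed_def F_iff K_iff cfun_const cfun_lincomb pairing_lincomb_left cfun_linf)

text \<open>The Krein-Smulian theorem asks for positive distance to the kernel. This is supplied by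
  boundedness: elements of the coset of \<mu> all have the same nonzero image under
  \<open>\<Theta>\<close>.\<close>

lemma F_separates:
  assumes \<mu>: "\<mu> \<in> l1" "\<mu> \<notin> K"
  shows "\<exists>f\<in>F. pairing f \<mu> \<noteq> 0"
proof -
  obtain n where n: "\<Theta> \<mu> n \<noteq> 0"
    using assms by (auto simp: K_iff)
  define N where "N = l1_norm (\<Theta> \<mu>)"
  have N: "N > 0"
    using l1_norm_ge[OF \<Theta>_l1[OF \<mu>(1)], of n] n unfolding N_def
    by (metis norm_le_zero_iff not_le order_trans)
  \<comment> \<open>The denominator exceeds \<open>C\<close>, which makes the distance estimate
    strict, and it is positive even when \<open>C\<close> is 0.\<close>
  define d where "d = N / (2 * (C + 1))"
  have d: "d > 0"
    using N C_nonneg by (simp add: d_def)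
  have far: "l1_norm (\<lambda>s. \<mu> s + \<kappa> s) > d" if "\<kappa> \<in> K" for \<kappa>
  proof -
    have \<kappa>: "\<kappa> \<in> l1" "\<Theta> \<kappa> = (\<lambda>_. 0)"
      using that by (simp_all add: K_iff)
    let ?l = "l1_norm (\<lambda>s. \<mu> s + \<kappa> s)"
    have "\<Theta> (\<lambda>s. \<mu> s + \<kappa> s) = \<Theta> \<mu>"
      using \<Theta>_lincomb[OF \<mu>(1) \<kappa>(1), of 1 1] by (simp add: \<kappa>(2))
    then have le: "N \<le> C * ?l"
      using \<Theta>_bound[OF l1_add(1)[OF \<mu>(1) \<kappa>(1)]] by (simp add: N_def)
    have "?l > 0"
      using le N C_nonneg l1_norm_nonneg[of "\<lambda>s. \<mu> s + \<kappa> s"] by (cases "?l = 0") auto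
    then have "C * ?l < 2 * (C + 1) * ?l"
      using C_nonneg by (intro mult_strict_right_mono) auto
    then show ?thesis
      using le C_nonneg by (simp add: d_def divide_less_eq mult.commute)
  qed
  show ?thesis
  proof (rule krein_smulian[OF lin_closed_K _ _ \<mu>(1) d far])
    show "K \<subseteq> l1"
      by (auto simp: K_iff)
  next
    fix L :: "(('k S \<Rightarrow> complex) set \<Rightarrow> complex) \<Rightarrow> complex" and \<kappa> \<nu> R
    assume "lin_on linf L" "\<And>x. x \<in> linf \<Longrightarrow> norm (L x) \<le> linf_norm x" "\<And>i. \<kappa> i \<in> K"
      "\<And>i. l1_norm (\<kappa> i) \<le> R" "weak_limit L \<kappa> \<nu>"
    then show "\<nu> \<in> K"
      by (intro K_weak_limit[of L \<kappa> R \<nu>]) (simp_all add: K_iff)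
  next
    fix g assume "g \<in> cfun" "\<And>\<kappa>. \<kappa> \<in> K \<Longrightarrow> pairing g \<kappa> = 0" "pairing g \<mu> \<noteq> 0"
    then show ?thesis
      by (intro bexI[of _ g]) (auto simp: F_iff)
  qed
qed

text \<open>By separation the complement is the union of the open sets on which some member of
  \<open>F\<close> does not vanish.\<close>

lemma closedin_kernel: "closedin (weak_star_topology (C_S J)) (l1_kernel \<Theta>)"
  unfolding closedin_def topspace_weak_star K_def[symmetric]
proof
  show "K \<subseteq> l1"
    by (auto simp: K_iff)
  have "l1 - K = (\<Union>f\<in>F. {a \<in> l1. pairing f a \<in> - {0}})"
    using F_separates by (auto simp: F_iff)
  moreover have "openin (weak_star_topology (C_S J)) {a \<in> l1. pairing f a \<in> - {0}}" if "f \<in> F" for f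
    by (rule weak_star_subbase) (use that in \<open>auto simp: F_iff C_S_eq_cfun\<close>)
  ultimately show "openin (weak_star_topology (C_S J)) (l1 - K)"
    by auto
qed

text \<open>Embedded elements of the kernel are 0, as \<open>\<Theta>\<close> is the identity on the
  embedded copy of \<open>l1\<close>; so separation by \<open>F\<close> on the large space gives
  separation by \<open>E\<close> on the integers.\<close>

lemma E_separates:
  assumes "b \<in> l1" "c \<in> l1" "\<And>x. x \<in> E \<Longrightarrow> pairing x b = pairing x c"
  shows "b = c"
proof -
  let ?d = "\<lambda>n. b n - c n"
  have d: "?d \<in> l1"
    by (rule l1_diff[OF assms(1,2)])
  have "pairing f (l1_embed ?d) = 0" if "f \<in> F" for f
    using assms that restrict_int_linf[OF F_linf[OF that]]
    by (simp add: pairing_l1_embed F_linf d pairing_diff_right E_def)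
  then have "l1_embed ?d \<in> K"
    using F_separates[OF l1_embed_l1(1)[OF d]] by blast
  then show ?thesis
    using \<Theta>_embed[OF d] by (auto simp: K_iff fun_eq_iff)
qed

text \<open>The functional is pulled back to \<open>F\<close>, extended by Hahn-Banach and
  represented on \<open>cfun\<close> by a measure \<mu>. Its image \<open>\<Theta> \<mu>\<close>
  represents the original functional, and the factor \<open>C\<close> comes from applying
  \<open>\<Theta>\<close>.\<close>

lemma E_functional:
  assumes \<phi>: "lin_on E \<phi>" and le: "\<And>x. x \<in> E \<Longrightarrow> norm (\<phi> x) \<le> N * linf_norm x" and N: "N \<ge> 0"
  shows "\<exists>b\<in>l1. l1_norm b \<le> C * N \<and> (\<forall>x\<in>E. \<phi> x = pairing x b)"
proof -
  define \<psi> where "\<psi> f = \<phi> (restrict_int f)" for f :: "'k S \<Rightarrow> complex"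
  have "lin_on F \<psi>"
    using \<phi> by (simp add: lin_on_def \<psi>_def E_def restrict_int_def)
  moreover have "norm (\<psi> f) \<le> N * linf_norm f" if "f \<in> F" for f
  proof -
    have "linf_norm (restrict_int f) \<le> linf_norm f"
      unfolding restrict_int_def by (rule linf_norm_le, rule linf_norm_ge[OF F_linf[OF that]])
    then show ?thesis
      using le[of "restrict_int f"] that N mult_left_mono order_trans unfolding \<psi>_def E_def by blast
  qed
  moreover have "F \<subseteq> linf"
    using F_linf by blast
  ultimately show ?thesis
  proof (rule_tac hahn_banach_linf[OF lin_closed_F _ _ _ N, of \<psi>])
    fix L assume L: "lin_on linf L" "\<And>f. f \<in> linf \<Longrightarrow> norm (L f) \<le> N * linf_norm f"
      and LF: "\<And>f. f \<in> F \<Longrightarrow> L f = \<psi> f"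
    have "bounded_functional N L"
      using L lin_on_subset[OF L(1) cfun_subset_linf] by (simp add: bounded_functional_def cfun_linf)
    then show ?thesis
    proof (rule riesz)
      fix \<mu> assume \<mu>: "\<mu> \<in> l1" "l1_norm \<mu> \<le> \<bar>N\<bar>" "\<And>f. f \<in> cfun \<Longrightarrow> L f = pairing f \<mu>"
      show ?thesis
      proof (intro bexI[of _ "\<Theta> \<mu>"] conjI ballI \<Theta>_l1 \<mu>)
        show "l1_norm (\<Theta> \<mu>) \<le> C * N"
          using \<Theta>_bound[OF \<mu>(1)] mult_left_mono[OF \<mu>(2) C_nonneg] N by simp
        fix x assume x: "x \<in> E"
        have "\<phi> x = L (ext x)"
          using LF[OF ext_E[OF x]] by (simp add: \<psi>_def restrict_ext)
        also have "\<dots> = pairing x (\<Theta> \<mu>)"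
          using \<mu>(3) F_pairing[OF ext_E[OF x] \<mu>(1)] ext_E[OF x] by (simp add: F_iff restrict_ext)
        finally show "\<phi> x = pairing x (\<Theta> \<mu>)" .
      qed
    qed
  qed
qed

text \<open>Extension is bounded by \<open>C\<close> in the sup norm, so uniform limits on the
  integers extend to uniform limits of continuous functions.\<close>

lemma closed_subspace_E: "closed_subspace_linf E"
  unfolding closed_subspace_linf_def
proof (intro conjI allI impI ballI)
  show "E \<subseteq> linf"
    using E_linf by blast
  show "(\<lambda>_. 0) \<in> E"
    by (rule lin_closed_zero[OF lin_closed_E])
  show "(\<lambda>s. x s + y s) \<in> E" if "x \<in> E" "y \<in> E" for x y
    by (rule lin_closed_add[OF lin_closed_E that])
  show "(\<lambda>s. c * x s) \<in> E" if "x \<in> E" for c x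
    by (rule lin_closed_cmult[OF lin_closed_E that])
  fix X :: "nat \<Rightarrow> int \<Rightarrow> complex" and x
  assume *: "(\<forall>m. X m \<in> E) \<and> x \<in> linf \<and> (\<lambda>m. linf_norm (\<lambda>s. X m s - x s)) \<longlonglongrightarrow> 0"
  then have X: "\<And>m. X m \<in> E" and x: "x \<in> linf" and lim: "(\<lambda>m. linf_norm (\<lambda>s. X m s - x s)) \<longlonglongrightarrow> 0"
    by blast+
  have "ext x \<in> cfun"
  proof (rule cfun_approx)
    fix e :: real assume e: "e > 0"
    have "e / (C + 1) > 0"
      using e C_nonneg by simp
    then obtain m where "norm (linf_norm (\<lambda>s. X m s - x s) - 0) < e / (C + 1)"
      using LIMSEQ_D[OF lim, of "e / (C + 1)"] by blast
    then have m: "linf_norm (\<lambda>s. X m s - x s) < e / (C + 1)"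
      by (simp add: abs_less_iff)
    have d: "(\<lambda>s. X m s - x s) \<in> linf"
      by (rule linf_diff[OF E_linf[OF X] x])
    have "norm (ext x s - ext (X m) s) \<le> e" for s
    proof -
      have "ext (X m) s - ext x s = ext (\<lambda>s. X m s - x s) s"
        unfolding ext_def by (rule pairing_diff_left[OF E_linf[OF X] x \<theta>_l1, symmetric])
      then have "norm (ext x s - ext (X m) s) \<le> C * linf_norm (\<lambda>s. X m s - x s)"
        using ext_bound[OF d, of s] norm_minus_commute[of "ext x s" "ext (X m) s"] by simp
      also have "\<dots> \<le> C * (e / (C + 1))"
        using m C_nonneg by (intro mult_left_mono) auto
      also have "\<dots> \<le> e"
        using e C_nonneg by (simp add: field_simps)
      finally show ?thesis .
    qed
    then show "\<exists>g\<in>cfun. \<forall>s. norm (ext x s - g s) \<le> e"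
      using X by (intro bexI[of _ "ext (X m)"]) (auto simp: E_iff)
  qed
  then show "x \<in> E"
    using x by (simp add: E_iff)
qed

lemma iota_eq_iff: "b \<in> l1 \<Longrightarrow> c \<in> l1 \<Longrightarrow> iota E b = iota E c \<longleftrightarrow> b = c"
proof
  assume l1: "b \<in> l1" "c \<in> l1" and eq: "iota E b = iota E c"
  have "pairing x b = pairing x c" if "x \<in> E" for x
    using fun_cong[OF eq, of x] that by (simp add: iota_def)
  then show "b = c"
    by (rule E_separates[OF l1])
qed simp

lemma concrete_predual_E: "concrete_predual E"
  unfolding concrete_predual_def
proof (intro conjI ballI allI)
  note Eadd = lin_closed_add[OF lin_closed_E] and Emult = lin_closed_cmult[OF lin_closed_E]
  show "closed_subspace_linf E"
    by (rule closed_subspace_E)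
  show "iota E (\<lambda>n. c * b n + d * b' n) = (\<lambda>x\<in>E. c * iota E b x + d * iota E b' x)" if "b \<in> l1" "b' \<in> l1" for b b' c d
    by (simp add: iota_def fun_eq_iff pairing_lincomb_right E_linf that)
  have dual: "iota E b \<in> dual_space E" if b: "b \<in> l1" for b
    unfolding dual_space_def
  proof (intro CollectI conjI ballI allI exI[of _ "l1_norm b"])
    show "iota E b \<in> extensional E"
      by (simp add: iota_def)
    show "iota E b (\<lambda>s. x s + y s) = iota E b x + iota E b y" if "x \<in> E" "y \<in> E" for x y
      using that Eadd[OF that] pairing_lincomb_left[OF E_linf E_linf b, of x y 1 1] by (simp add: iota_def)
    show "iota E b (\<lambda>s. c * x s) = c * iota E b x" if "x \<in> E" for c x
      using that Emult[OF that] pairing_lincomb_left[OF E_linf E_linf b, of x x c 0] by (simp add: iota_def)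
    show "norm (iota E b x) \<le> l1_norm b * linf_norm x" if "x \<in> E" for x
      using that pairing_bound[OF E_linf[OF that] b] by (simp add: iota_def mult.commute)
  qed
  show "bij_betw (iota E) l1 (dual_space E)"
    unfolding bij_betw_def
  proof (intro conjI equalityI)
    show "inj_on (iota E) l1"
      by (simp add: inj_on_def iota_eq_iff)
    show "iota E ` l1 \<subseteq> dual_space E"
      using dual by blast
    show "dual_space E \<subseteq> iota E ` l1"
    proof
      fix \<phi> assume "\<phi> \<in> dual_space E"
      then obtain N where \<phi>: "\<phi> \<in> extensional E" "\<And>x y. x \<in> E \<Longrightarrow> y \<in> E \<Longrightarrow> \<phi> (\<lambda>s. x s + y s) = \<phi> x + \<phi> y"
        "\<And>c x. x \<in> E \<Longrightarrow> \<phi> (\<lambda>s. c * x s) = c * \<phi> x" "\<And>x. x \<in> E \<Longrightarrow> norm (\<phi> x) \<le> N * linf_norm x"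
        unfolding dual_space_def by blast
      have "norm (\<phi> x) \<le> \<bar>N\<bar> * linf_norm x" if "x \<in> E" for x
        using \<phi>(4)[OF that] mult_right_mono[OF abs_ge_self[of N] linf_norm_nonneg[OF E_linf[OF that]]] by linarith
      moreover have "lin_on E \<phi>"
        by (simp add: lin_on_def \<phi>(2,3) Emult)
      ultimately obtain b where b: "b \<in> l1" "\<forall>x\<in>E. \<phi> x = pairing x b"
        using E_functional[of \<phi> "\<bar>N\<bar>"] by auto
      have "\<phi> = iota E b"
        using \<phi>(1) b(2) by (auto simp: iota_def fun_eq_iff extensional_def)
      then show "\<phi> \<in> iota E ` l1"
        using b(1) by blast
    qed
  qed
  have zero: "(\<lambda>_. 0) \<in> {x \<in> E. linf_norm x \<le> 1}"
    using lin_closed_zero[OF lin_closed_E] by (simp add: linf_zero)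
  have le: "norm (iota E b x) \<le> l1_norm b" if "b \<in> l1" "x \<in> {x \<in> E. linf_norm x \<le> 1}" for b x
  proof -
    have "norm (iota E b x) \<le> linf_norm x * l1_norm b"
      using that pairing_bound[OF E_linf that(1), of x] by (simp add: iota_def)
    also have "\<dots> \<le> 1 * l1_norm b"
      using that(2) by (intro mult_right_mono l1_norm_nonneg) auto
    finally show ?thesis by simp
  qed
  show "\<exists>C. \<forall>b\<in>l1. dual_norm E (iota E b) \<le> C * l1_norm b"
    unfolding dual_norm_def using zero le by (intro exI[of _ 1] ballI) (auto intro!: cSUP_least)
  \<comment> \<open>The functional induced by b is itself represented by some b' of norm at most
    \<open>C * N\<close>, and separation forces b' = b. This is the boundedness of the
    inverse.\<close>
  have "l1_norm b \<le> C * dual_norm E (iota E b)" if b: "b \<in> l1" for b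
  proof -
    define N where "N = dual_norm E (iota E b)"
    have bdd: "bdd_above ((\<lambda>x. norm (iota E b x)) ` {x \<in> E. linf_norm x \<le> 1})"
      using le[OF b] by (intro bdd_aboveI2)
    have up: "norm (iota E b x) \<le> N" if "x \<in> E" "linf_norm x \<le> 1" for x
      unfolding N_def dual_norm_def using that by (intro cSUP_upper bdd) auto
    have N: "N \<ge> 0"
      using up[of "\<lambda>_. 0"] zero norm_ge_zero order_trans by blast
    have bnd: "norm (pairing x b) \<le> N * linf_norm x" if x: "x \<in> E" for x
    proof (cases "linf_norm x = 0")
      case True
      then have "x = (\<lambda>_. 0)"
        using linf_norm_ge[OF E_linf[OF x]] by auto
      then show ?thesis
        by (simp add: linf_zero)
    next
      case False
      then have pos: "linf_norm x > 0"
        using linf_norm_nonneg[OF E_linf[OF x]] by simp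
      let ?c = "complex_of_real (inverse (linf_norm x))"
      have "norm (iota E b (\<lambda>s. ?c * x s)) \<le> N"
        using linf_cmult(2)[OF E_linf[OF x], of ?c] pos by (intro up Emult x) (simp add: norm_inverse)
      then have "norm ?c * norm (pairing x b) \<le> N"
        using Emult[OF x, of ?c] pairing_lincomb_left[OF E_linf[OF x] E_linf[OF x] b, of ?c 0]
        by (simp add: iota_def norm_mult)
      then show ?thesis
        using pos by (simp add: norm_inverse norm_divide field_simps)
    qed
    have "lin_on E (\<lambda>x. pairing x b)"
      using pairing_lincomb_left[OF E_linf E_linf b] by (simp add: lin_on_def)
    then obtain b' where b': "b' \<in> l1" "l1_norm b' \<le> C * N" "\<forall>x\<in>E. pairing x b = pairing x b'"
      using E_functional[OF _ bnd N] by blast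
    then have "b = b'"
      using E_separates[OF b b'(1)] by blast
    then show ?thesis
      using b'(2) by (simp add: N_def)
  qed
  then show "\<exists>C. \<forall>b\<in>l1. l1_norm b \<le> C * dual_norm E (iota E b)"
    by blast
qed

text \<open>The kernel of a homomorphism is an ideal, so it is stable under convolution with the
  point mass at k; dually \<open>F\<close> is stable under translation by integers.\<close>

lemma E_translate:
  assumes "x \<in> E"
  shows "(\<lambda>n. x (n + k)) \<in> E"
proof -
  define f where "f = ext x"
  have f: "f \<in> F" "x = restrict_int f"
    using ext_E[OF assms] by (simp_all add: f_def restrict_ext)
  let ?g = "\<lambda>s. f (S_plus s (S_int k))"
  have "pairing ?g \<mu> = 0" if \<mu>: "\<mu> \<in> K" for \<mu>
  proof -
    have \<mu>l: "\<mu> \<in> l1"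
      using \<mu> by (simp add: K_iff)
    have "\<Theta> (conv S_plus \<mu> (delta (S_int k))) = (\<lambda>_. 0)"
      using \<mu> by (simp add: \<Theta>_conv \<mu>l delta_l1 K_iff) (simp add: conv_def case_prod_unfold)
    then have "conv S_plus \<mu> (delta (S_int k)) \<in> K"
      by (simp add: K_iff conv_l1 \<mu>l delta_l1)
    then have "pairing f (conv S_plus \<mu> (delta (S_int k))) = 0"
      using f(1) by (simp add: F_iff)
    then show ?thesis
      by (simp add: pairing_conv \<mu>l delta_l1 F_linf f(1) pairing_delta)
  qed
  then have "?g \<in> F"
    using f(1) by (simp add: F_iff cfun_translate)
  moreover have "(\<lambda>n. x (n + k)) = restrict_int ?g"
    by (simp add: f(2) restrict_int_def S_int_def)
  ultimately show ?thesis
    by (simp add: E_def)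
qed

lemma shift_invariant_E: "shift_invariant_predual E"
  unfolding shift_invariant_predual_def
proof (intro conjI concrete_predual_E equalityI subsetI)
  fix x assume "x \<in> shift ` E"
  then obtain y where y: "y \<in> E" "x = shift y"
    by blast
  show "x \<in> E"
    unfolding y(2) shift_def using E_translate[OF y(1), of "- 1"] by simp
next
  fix x assume "x \<in> E"
  have "x = shift (\<lambda>n. x (n + 1))"
    by (simp add: shift_def)
  then show "x \<in> shift ` E"
    using E_translate[OF \<open>x \<in> E\<close>, of 1] by blast
qed

text \<open>For n in \<open>J i\<close> with large absolute value the one-letter word consisting of
  n leads from e_i to the integer n, so n tends to e_i in the space; evaluating the extension of x
  at both points gives the claim.\<close>

lemma delta_limit:
  "limitin (weak_star_topology E) delta (a i) (inf (filtercomap abs at_top) (principal (J i)))"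
proof (rule limitin_weak_star[OF a_l1 delta_l1(1)])
  fix x assume x: "x \<in> E"
  define f where "f = ext x"
  have f: "f \<in> cfun"
    using x by (simp add: f_def E_iff)
  have fn: "pairing x (delta n) = f (S_int n)" for n
    by (simp add: f_def ext_def \<theta>_int)
  have fi: "pairing x (a i) = f (S_unit i)"
    by (simp add: f_def ext_def \<theta>_def \<Theta>_unit)
  show "((\<lambda>n. pairing x (delta n)) \<longlongrightarrow> pairing x (a i)) (inf (filtercomap abs at_top) (principal (J i)))"
    unfolding fn fi
  proof (rule tendstoI)
    fix e :: real assume "e > 0"
    then obtain m where m: "\<forall>t\<in>nbS (S_unit i) m. norm (f t - f (S_unit i)) < e"
      using cfunD[OF f] by blast
    have "dist (f (S_int n)) (f (S_unit i)) < e" if n: "n \<in> J i" "int m + 1 \<le> \<bar>n\<bar>" for n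
    proof -
      have "(n, 0) \<in> V (0, axis i 1) m"
        unfolding below_def using n(2) word_singleton[OF disj n(1)]
        by (intro CollectI exI[of _ "{n}"]) simp
      then have "S_int n \<in> nbS (S_unit i) m"
        by (simp add: S_int_def S_unit_def nbS_simps)
      then show ?thesis
        using m by (simp add: dist_norm)
    qed
    then show "\<forall>\<^sub>F n in inf (filtercomap abs at_top) (principal (J i)). dist (f (S_int n)) (f (S_unit i)) < e"
      unfolding eventually_inf_principal eventually_filtercomap_at_top_linorder by blast
  qed
qed

end

section \<open>Existence of the projection\<close>

lemma hom_extension:
  fixes p :: "'a \<Rightarrow> 'a \<Rightarrow> 'a" and \<theta> :: "'a \<Rightarrow> int \<Rightarrow> complex"
  assumes \<theta>: "\<And>s. \<theta> s \<in> l1" "\<And>s. l1_norm (\<theta> s) \<le> M"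
    and hom: "\<And>s t. \<theta> (p s t) = conv (+) (\<theta> s) (\<theta> t)"
    and \<Theta>_def: "\<Theta> = (\<lambda>\<mu> n. pairing (\<lambda>s. \<theta> s n) \<mu>)"
  shows "\<mu> \<in> l1 \<Longrightarrow> \<Theta> \<mu> \<in> l1" "\<mu> \<in> l1 \<Longrightarrow> l1_norm (\<Theta> \<mu>) \<le> M * l1_norm \<mu>"
    and "\<mu> \<in> l1 \<Longrightarrow> \<nu> \<in> l1 \<Longrightarrow> \<Theta> (\<lambda>s. c * \<mu> s + d * \<nu> s) = (\<lambda>n. c * \<Theta> \<mu> n + d * \<Theta> \<nu> n)"
    and "\<Theta> (delta s) = \<theta> s"
    and "\<mu> \<in> l1 \<Longrightarrow> x \<in> linf \<Longrightarrow> pairing x (\<Theta> \<mu>) = pairing (\<lambda>s. pairing x (\<theta> s)) \<mu>"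
    and "\<mu> \<in> l1 \<Longrightarrow> \<nu> \<in> l1 \<Longrightarrow> \<Theta> (conv p \<mu> \<nu>) = conv (+) (\<Theta> \<mu>) (\<Theta> \<nu>)"
proof -
  have \<theta>n: "(\<lambda>s. \<theta> s n) \<in> linf" for n
    by (rule linfI[of _ M], rule order_trans[OF l1_norm_ge[OF \<theta>(1)] \<theta>(2)])
  \<comment> \<open>With corrected phases a finite sum of norms of coordinates is one pairing of
    \<mu> with a function bounded by \<open>M\<close>.\<close>
  have *: "(\<Sum>n\<in>A. norm (\<Theta> \<mu> n)) \<le> M * l1_norm \<mu>" if \<mu>: "\<mu> \<in> l1" and A: "finite A" for \<mu> A
  proof -
    define c where "c n = cnj (sgn (\<Theta> \<mu> n))" for n
    have lin: "lin_on linf (\<lambda>x. pairing x \<mu>)"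
      by (simp add: lin_on_def pairing_lincomb_left \<mu>)
    have "of_real (\<Sum>n\<in>A. norm (\<Theta> \<mu> n)) = (\<Sum>n\<in>A. c n * \<Theta> \<mu> n)"
      by (simp add: c_def cnj_sgn_mult)
    also have "\<dots> = pairing (\<lambda>s. \<Sum>n\<in>A. c n * \<theta> s n) \<mu>"
      unfolding \<Theta>_def using lin_sum(2)[OF lin_closed_linf A _ lin, where f="\<lambda>n s. \<theta> s n" and c=c] \<theta>n by simp
    finally have eq: "of_real (\<Sum>n\<in>A. norm (\<Theta> \<mu> n)) = pairing (\<lambda>s. \<Sum>n\<in>A. c n * \<theta> s n) \<mu>" .
    have "norm (\<Sum>n\<in>A. c n * \<theta> s n) \<le> M" for s
    proof -
      have "norm (\<Sum>n\<in>A. c n * \<theta> s n) \<le> (\<Sum>n\<in>A. norm (\<theta> s n))"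
        by (rule sum_norm_le) (simp add: c_def norm_mult norm_sgn)
      then show ?thesis
        using l1_norm_sum_le[OF \<theta>(1) A, of s] \<theta>(2)[of s] by linarith
    qed
    from pairing_bound'[of "\<lambda>s. \<Sum>n\<in>A. c n * \<theta> s n" M, OF this \<mu>] show ?thesis
      unfolding eq[symmetric] norm_of_real by (simp add: sum_nonneg)
  qed
  show \<Theta>l: "\<Theta> \<mu> \<in> l1" if "\<mu> \<in> l1" for \<mu>
    by (rule l1I(1)[OF *[OF that]])
  show \<Theta>b: "l1_norm (\<Theta> \<mu>) \<le> M * l1_norm \<mu>" if "\<mu> \<in> l1" for \<mu>
    by (rule l1I(2)[OF *[OF that]])
  show lin: "\<Theta> (\<lambda>s. c * \<mu> s + d * \<nu> s) = (\<lambda>n. c * \<Theta> \<mu> n + d * \<Theta> \<nu> n)" if "\<mu> \<in> l1" "\<nu> \<in> l1" for \<mu> \<nu> c d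
    unfolding \<Theta>_def using pairing_lincomb_right[OF \<theta>n that] by simp
  show \<delta>: "\<Theta> (delta s) = \<theta> s" for s
    by (simp add: \<Theta>_def pairing_delta)
  show rep: "pairing x (\<Theta> \<mu>) = pairing (\<lambda>s. pairing x (\<theta> s)) \<mu>" if "\<mu> \<in> l1" "x \<in> linf" for x \<mu>
  proof -
    have "lin_on l1 (\<lambda>\<mu>. pairing x (\<Theta> \<mu>))"
      using that by (simp add: lin_on_def lin pairing_lincomb_right \<Theta>l)
    moreover have "norm (pairing x (\<Theta> \<mu>)) \<le> (linf_norm x * M) * l1_norm \<mu>" if "\<mu> \<in> l1" for \<mu>
      using pairing_bound[OF \<open>x \<in> linf\<close> \<Theta>l[OF that]] mult_left_mono[OF \<Theta>b[OF that] linf_norm_nonneg[OF \<open>x \<in> linf\<close>]]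
      by (simp add: mult.assoc)
    ultimately show ?thesis
      using l1_functional(2)[of "\<lambda>\<mu>. pairing x (\<Theta> \<mu>)" "linf_norm x * M" \<mu>] that by (simp add: \<delta>)
  qed
  show "\<Theta> (conv p \<mu> \<nu>) = conv (+) (\<Theta> \<mu>) (\<Theta> \<nu>)" if \<mu>: "\<mu> \<in> l1" and \<nu>: "\<nu> \<in> l1" for \<mu> \<nu>
  proof (rule l1_eqI)
    fix x :: "int \<Rightarrow> complex" assume x: "x \<in> linf"
    have conv_linf: "(\<lambda>m. pairing (\<lambda>k. x (m + k)) b) \<in> linf" if "b \<in> l1" for b
      by (rule pairing_linf[OF linf_norm_ge[OF x] that])
    \<comment> \<open>Commuting the factors brings \<open>\<Theta> \<nu>\<close> to the first place,
      where the representation of its pairings through \<open>\<theta>\<close> can be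
      applied.\<close>
    have inner: "pairing x (conv (+) (\<theta> t) (\<Theta> \<nu>)) = pairing (\<lambda>u. pairing x (\<theta> (p t u))) \<nu>" for t
    proof -
      have "pairing x (conv (+) (\<theta> t) (\<Theta> \<nu>)) = pairing x (conv (+) (\<Theta> \<nu>) (\<theta> t))"
        by (simp add: conv_commute[OF \<theta>(1) \<Theta>l[OF \<nu>] add.commute])
      also have "\<dots> = pairing (\<lambda>u. pairing (\<lambda>k. pairing (\<lambda>m. x (k + m)) (\<theta> t)) (\<theta> u)) \<nu>"
        by (simp add: pairing_conv[OF \<Theta>l[OF \<nu>] \<theta>(1) x] rep[OF \<nu> conv_linf[OF \<theta>(1)]])
      also have "\<dots> = pairing (\<lambda>u. pairing x (conv (+) (\<theta> u) (\<theta> t))) \<nu>"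
        by (simp add: pairing_conv[OF \<theta>(1) \<theta>(1) x])
      finally show ?thesis
        by (simp add: hom conv_commute[OF \<theta>(1)[of t] \<theta>(1) add.commute])
    qed
    have xl: "(\<lambda>s. pairing x (\<theta> s)) \<in> linf"
      by (rule linfI[of _ "linf_norm x * M"], rule order_trans[OF pairing_bound[OF x \<theta>(1)]])
        (intro mult_left_mono \<theta>(2) linf_norm_nonneg x)
    have "pairing x (\<Theta> (conv p \<mu> \<nu>)) = pairing (\<lambda>t. pairing (\<lambda>u. pairing x (\<theta> (p t u))) \<nu>) \<mu>"
      by (simp add: rep[OF conv_l1(1)[OF \<mu> \<nu>] x] pairing_conv[OF \<mu> \<nu> xl])
    also have "\<dots> = pairing (\<lambda>t. pairing (\<lambda>m. pairing (\<lambda>k. x (m + k)) (\<Theta> \<nu>)) (\<theta> t)) \<mu>"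
      by (simp add: pairing_conv[OF \<theta>(1) \<Theta>l[OF \<nu>] x] flip: inner)
    also have "\<dots> = pairing x (conv (+) (\<Theta> \<mu>) (\<Theta> \<nu>))"
      by (simp add: pairing_conv[OF \<Theta>l[OF \<mu>] \<Theta>l[OF \<nu>] x] rep[OF \<mu> conv_linf[OF \<Theta>l[OF \<nu>]]])
    finally show "pairing x (\<Theta> (conv p \<mu> \<nu>)) = pairing x (conv (+) (\<Theta> \<mu>) (\<Theta> \<nu>))" .
  qed (intro \<Theta>l conv_l1 \<mu> \<nu>)+
qed

lemma conv_delta_0: "b \<in> l1 \<Longrightarrow> conv (+) (delta (0 :: int)) b = b"
  by (rule conv_eqI) (simp_all add: delta_l1 pairing_delta)

lemma conv_pow_0: "conv_pow a 0 = delta 0"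
  by (simp add: conv_pow_def)

lemma conv_pow_add:
  assumes "a \<in> l1"
  shows "conv_pow a (m + n) = conv (+) (conv_pow a m) (conv_pow a n)"
proof (induction m)
  case 0
  then show ?case
    by (simp add: conv_pow_0 conv_delta_0 conv_pow_l1 assms)
next
  case (Suc m)
  then show ?case
    by (simp add: conv_pow_Suc conv_assoc[OF assms conv_pow_l1[OF assms] conv_pow_l1[OF assms] add.assoc])
qed

lemma conv_conv:
  fixes a b c d :: "int \<Rightarrow> complex"
  assumes "a \<in> l1" "b \<in> l1" "c \<in> l1" "d \<in> l1"
  shows "conv (+) (conv (+) a b) (conv (+) c d) = conv (+) (conv (+) a c) (conv (+) b d)"
proof -
  note assoc = conv_assoc[where p="(+) :: int \<Rightarrow> int \<Rightarrow> int", OF _ _ _ add.assoc]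
  have "conv (+) (conv (+) a b) (conv (+) c d) = conv (+) a (conv (+) (conv (+) b c) d)"
    by (simp add: assoc assms conv_l1(1))
  also have "\<dots> = conv (+) a (conv (+) (conv (+) c b) d)"
    by (simp only: conv_commute[OF assms(2,3) add.commute])
  also have "\<dots> = conv (+) (conv (+) a c) (conv (+) b d)"
    by (simp add: assoc assms conv_l1(1))
  finally show ?thesis .
qed

text \<open>The monomial in the a_i with exponents \<gamma>, its factors taken along a list; in the
  application the list enumerates all indices once.\<close>

definition conv_monomial :: "('k \<Rightarrow> int \<Rightarrow> complex) \<Rightarrow> 'k list \<Rightarrow> ('k \<Rightarrow> nat) \<Rightarrow> int \<Rightarrow> complex" where
  "conv_monomial a xs \<gamma> = foldr (\<lambda>i. conv (+) (conv_pow (a i) (\<gamma> i))) xs (delta 0)"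

lemma conv_monomial_simps:
  "conv_monomial a [] \<gamma> = delta 0"
  "conv_monomial a (i # xs) \<gamma> = conv (+) (conv_pow (a i) (\<gamma> i)) (conv_monomial a xs \<gamma>)"
  by (simp_all add: conv_monomial_def)

context
  fixes a :: "'k \<Rightarrow> int \<Rightarrow> complex"
  assumes a: "\<And>i. a i \<in> l1"
begin

lemma conv_monomial_l1: "conv_monomial a xs \<gamma> \<in> l1"
  by (induction xs) (simp_all add: conv_monomial_simps delta_l1 conv_l1 conv_pow_l1 a)

lemma conv_monomial_add:
  "conv_monomial a xs (\<lambda>i. \<gamma> i + \<beta> i) = conv (+) (conv_monomial a xs \<gamma>) (conv_monomial a xs \<beta>)"
proof (induction xs)
  case (Cons i xs)
  then show ?case
    by (simp add: conv_monomial_simps conv_pow_add a) (rule conv_conv; simp add: conv_monomial_l1 conv_pow_l1 a)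
qed (simp add: conv_monomial_simps conv_delta_0 delta_l1)

lemma conv_monomial_zero: "(\<And>i. i \<in> set xs \<Longrightarrow> \<gamma> i = 0) \<Longrightarrow> conv_monomial a xs \<gamma> = delta 0"
  by (induction xs) (simp_all add: conv_monomial_simps conv_pow_0 conv_delta_0 delta_l1)

lemma conv_monomial_unit:
  "distinct xs \<Longrightarrow> i \<in> set xs \<Longrightarrow> conv_monomial a xs (\<lambda>j. if j = i then 1 else 0) = a i"
proof (induction xs)
  case (Cons j xs)
  have one: "conv (+) (a i) (delta 0) = a i"
    using conv_commute[OF a[of i] delta_l1(1)[of 0] add.commute] conv_delta_0[OF a[of i]] by simp
  show ?case
  proof (cases "j = i")
    case True
    then have "conv_monomial a xs (\<lambda>j. if j = i then 1 else 0) = delta 0"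
      using Cons.prems by (intro conv_monomial_zero) auto
    then show ?thesis
      using True conv_pow_Suc[of "a i" 0] by (simp add: conv_monomial_simps conv_pow_0 one)
  next
    case False
    then show ?thesis
      using Cons by (simp add: conv_monomial_simps conv_pow_0 conv_delta_0 a)
  qed
qed simp

lemma conv_monomial_bound:
  assumes pb: "\<And>i. power_bounded (a i)"
  shows "\<exists>M. \<forall>\<gamma>. l1_norm (conv_monomial a xs \<gamma>) \<le> M"
proof (induction xs)
  case Nil
  then show ?case
    by (intro exI[of _ 1]) (simp add: conv_monomial_simps delta_l1)
next
  case (Cons i xs)
  then obtain M where M: "\<And>\<gamma>. l1_norm (conv_monomial a xs \<gamma>) \<le> M"
    by blast
  obtain N where N: "\<And>m. l1_norm (conv_pow (a i) m) \<le> N"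
    using pb[of i] by (auto simp: power_bounded_def bdd_above_def)
  have "l1_norm (conv_monomial a (i # xs) \<gamma>) \<le> N * M" for \<gamma>
    unfolding conv_monomial_simps
    by (intro order_trans[OF conv_l1(2)] mult_mono M N conv_monomial_l1 conv_pow_l1 a l1_norm_nonneg
        order_trans[OF l1_norm_nonneg N])
  then show ?case
    by blast
qed

end

text \<open>The family \<open>\<theta>\<close> is prescribed by translated monomials and by 0 at
  infinity. Power boundedness bounds all monomials at once, and commutativity of convolution makes
  the family multiplicative, so it extends to all of \<open>l1\<close>.\<close>

lemma ex_bounded_hom_projection:
  fixes a :: "'k::finite \<Rightarrow> int \<Rightarrow> complex"
  assumes a: "\<And>i. a i \<in> l1" and pb: "\<And>i. power_bounded (a i)"
  shows "\<exists>\<Theta> :: ('k S \<Rightarrow> complex) \<Rightarrow> int \<Rightarrow> complex. bounded_hom_projection \<Theta> \<and> (\<forall>i. \<Theta> (delta (S_unit i)) = a i)"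
proof -
  obtain xs :: "'k list" where xs: "set xs = UNIV" "distinct xs"
    using finite_distinct_list[OF finite] by blast
  define P where "P p = conv_monomial a xs (\<lambda>i. p $ i)" for p :: "(nat, 'k) vec"
  obtain M where M: "\<And>\<gamma>. l1_norm (conv_monomial a xs \<gamma>) \<le> M"
    using conv_monomial_bound[where a=a and xs=xs, OF a pb] by blast
  have Pl: "P p \<in> l1" for p
    unfolding P_def by (rule conv_monomial_l1[where a=a, OF a])
  have Padd: "P (p + q) = conv (+) (P p) (P q)" for p q
  proof -
    have "(\<lambda>i. (p + q) $ i) = (\<lambda>i. p $ i + q $ i)"
      by (simp add: fun_eq_iff)
    then show ?thesis
      unfolding P_def by (simp only: conv_monomial_add[where a=a, OF a])
  qed
  have P0: "P 0 = delta 0"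
    unfolding P_def by (rule conv_monomial_zero[where a=a, OF a]) simp
  have Pi: "P (axis i 1) = a i" for i
  proof -
    have "(\<lambda>j. axis i (1 :: nat) $ j) = (\<lambda>j. if j = i then 1 else 0)"
      by (simp add: fun_eq_iff axis_def)
    then show ?thesis
      unfolding P_def using conv_monomial_unit[where a=a and i=i, OF a xs(2)] xs(1) by simp
  qed
  define \<theta> :: "'k S \<Rightarrow> int \<Rightarrow> complex" where
    "\<theta> s = (case s of None \<Rightarrow> (\<lambda>_. 0) | Some \<gamma> \<Rightarrow> conv (+) (delta (fst \<gamma>)) (P (snd \<gamma>)))" for s
  have \<theta>_simps: "\<theta> None = (\<lambda>_. 0)" "\<theta> (Some (n, p)) = conv (+) (delta n) (P p)" for n p
    by (simp_all add: \<theta>_def)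
  have M0: "M \<ge> 0"
    using M l1_norm_nonneg order_trans by blast
  have \<theta>: "\<theta> s \<in> l1 \<and> l1_norm (\<theta> s) \<le> M" for s
  proof (cases s)
    case (Some \<gamma>)
    then show ?thesis
      using conv_l1[OF delta_l1(1) Pl, of "(+)" "fst \<gamma>" "snd \<gamma>"] M order_trans
      by (auto simp: \<theta>_def delta_l1 P_def)
  qed (simp add: \<theta>_def l1_zero M0)
  have zero: "conv (+) (\<lambda>_. 0) b = (\<lambda>_. 0)" "conv (+) b (\<lambda>_. 0) = (\<lambda>_. 0)" for b :: "int \<Rightarrow> complex"
    by (simp_all add: conv_def case_prod_unfold)
  have hom: "\<theta> (S_plus s t) = conv (+) (\<theta> s) (\<theta> t)" for s t
  proof (cases "s = None \<or> t = None")
    case False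
    then obtain m p n q where "s = Some (m, p)" "t = Some (n, q)"
      by auto
    then show ?thesis
      using conv_conv[OF delta_l1(1) Pl delta_l1(1) Pl, of m p n q]
      by (simp add: \<theta>_simps Padd conv_delta_delta)
  qed (auto simp: \<theta>_simps zero)
  define \<Theta> where "\<Theta> = (\<lambda>\<mu> n. pairing (\<lambda>s. \<theta> s n) \<mu>)"
  note \<Theta> = hom_extension[of \<theta> M S_plus, OF conjunct1[OF \<theta>] conjunct2[OF \<theta>] hom \<Theta>_def]
  have embed: "\<Theta> (l1_embed b) = b" if b: "b \<in> l1" for b
  proof (rule l1_eqI)
    show "\<Theta> (l1_embed b) \<in> l1"
      by (rule \<Theta>(1)[OF l1_embed_l1(1)[OF b]])
    fix x :: "int \<Rightarrow> complex" assume x: "x \<in> linf"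
    have "(\<lambda>s. pairing x (\<theta> s)) \<in> linf"
      by (rule linfI[of _ "linf_norm x * M"], rule order_trans[OF pairing_bound[OF x conjunct1[OF \<theta>]]])
        (intro mult_left_mono conjunct2[OF \<theta>] linf_norm_nonneg x)
    moreover have "restrict_int (\<lambda>s. pairing x (\<theta> s)) = x"
      by (simp add: restrict_int_def S_int_def \<theta>_simps P0 conv_delta_delta pairing_delta)
    ultimately show "pairing x (\<Theta> (l1_embed b)) = pairing x b"
      by (simp add: \<Theta>(5)[OF l1_embed_l1(1)[OF b] x] pairing_l1_embed b)
  qed (rule b)
  have "bounded_hom_projection \<Theta>"
    unfolding bounded_hom_projection_def
    by (intro conjI ballI allI exI[of _ M] \<Theta>(1,2,3,6) embed)
  moreover have "\<Theta> (delta (S_unit i)) = a i" for i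
    unfolding \<Theta>(4) S_unit_def \<theta>_simps Pi by (rule conv_delta_0[OF a])
  ultimately show ?thesis
    by blast
qed

text \<open>Since only the values of \<open>\<Theta>\<close> on \<open>l1\<close> are constrained,
  the conclusions are stated for every admissible \<open>\<Theta>\<close>, with existence as a
  separate conjunct so that they are not vacuous.\<close>

theorem theorem5p5:
  fixes J :: "'k::finite \<Rightarrow> int set"
    and a :: "'k \<Rightarrow> int \<Rightarrow> complex"
  assumes "\<And>i. infinite (J i)"
    and "disjoint_family J"
    and "J_condition J"
    and "\<And>i. a i \<in> l1"
    and "\<And>i. power_bounded (a i)"
    and "\<And>i. (\<lambda>m. linf_norm (conv_pow (a i) m)) \<longlonglongrightarrow> 0"
  shows "(\<exists>\<Theta> :: ('k S \<Rightarrow> complex) \<Rightarrow> int \<Rightarrow> complex.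
            bounded_hom_projection \<Theta> \<and> (\<forall>i. \<Theta> (delta (S_unit i)) = a i)) \<and>
         (\<forall>\<Theta> :: ('k S \<Rightarrow> complex) \<Rightarrow> int \<Rightarrow> complex.
            bounded_hom_projection \<Theta> \<and> (\<forall>i. \<Theta> (delta (S_unit i)) = a i) \<longrightarrow>
            closedin (weak_star_topology (C_S J)) (l1_kernel \<Theta>) \<and>
            (let F = pre_annihilator (C_S J) (l1_kernel \<Theta>);
                 E = restrict_int ` F
             in shift_invariant_predual E \<and>
                (\<forall>i. limitin (weak_star_topology E) delta (a i)
                       (inf (filtercomap abs at_top) (principal (J i))))))"
proof (intro conjI allI impI)
  show "\<exists>\<Theta> :: ('k S \<Rightarrow> complex) \<Rightarrow> int \<Rightarrow> complex.
      bounded_hom_projection \<Theta> \<and> (\<forall>i. \<Theta> (delta (S_unit i)) = a i)"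
    by (rule ex_bounded_hom_projection[OF assms(4,5)])
  fix \<Theta> :: "('k S \<Rightarrow> complex) \<Rightarrow> int \<Rightarrow> complex"
  assume \<Theta>: "bounded_hom_projection \<Theta> \<and> (\<forall>i. \<Theta> (delta (S_unit i)) = a i)"
  interpret theta J a \<Theta>
    by unfold_locales (use assms \<Theta> in auto)
  show "closedin (weak_star_topology (C_S J)) (l1_kernel \<Theta>)"
    by (rule closedin_kernel)
  show "let F = pre_annihilator (C_S J) (l1_kernel \<Theta>); E = restrict_int ` F
      in shift_invariant_predual E \<and>
        (\<forall>i. limitin (weak_star_topology E) delta (a i) (inf (filtercomap abs at_top) (principal (J i))))"
    unfolding Let_def F_def[symmetric] E_def[symmetric] by (intro conjI allI shift_invariant_E delta_limit)
qed

end
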